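(* Suppose $t>1$, $0<r<1$, and $f$ is an analytic function in the unit disk $\mathbb{D}$. Then $f$ belongs to the analytic Lipschitz space $\Lambda_t$ if and only if $$f(z)=\int_{\mathbb{D}}\frac{z-w}{1-z\overline{w}}\,d\mu(w),\qquad z\in\mathbb{D},$$ for some complex Borel measure $\mu$ on $\mathbb{D}$ with the property that $$\sup_{z\in\mathbb{D}}\frac{|\mu|(D(z,r))}{(1-|z|^2)^t}<\infty.$$
   Context: $\mathbb{D}$ is the open unit disk in $\mathbb{C}$. For real $t$, the analytic Lipschitz space $\Lambda_t$ on $\mathbb{D}$ consists of all analytic functions $f$ on $\mathbb{D}$ such that $(1-|z|^2)^{k-t}f^{(k)}(z)$ is bounded on $\mathbb{D}$, where $k$ is any nonnegative integer greater than $t$ (the space is independent of the choice of such $k$). $D(z,r)=\left\{w\in\mathbb{D}:\left|\frac{z-w}{1-z\overline{w}}\right|<r\right\}$ is the pseudo-hyperbolic disk at $z$ with radius $r$, and $|\mu|$ denotes the total variation measure of $\mu$. *)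

theory Defs
  imports "HOL-Complex_Analysis.Complex_Analysis"
begin

abbreviation unit_disk :: "complex set"
  where "unit_disk \<equiv> ball 0 1"

(* The space does not depend on the choice of the natural number k > t; k is kept as an
   explicit parameter so that this independence is not built into the definition. *)
definition analytic_Lipschitz :: "nat \<Rightarrow> real \<Rightarrow> (complex \<Rightarrow> complex) set"
  where "analytic_Lipschitz k t =
    {f. f holomorphic_on unit_disk \<and>
        bounded ((\<lambda>z. of_real ((1 - (cmod z)\<^sup>2) powr (real k - t)) * (deriv ^^ k) f z) ` unit_disk)}"

definition pseudohyperbolic_disk :: "complex \<Rightarrow> real \<Rightarrow> complex set"
  where "pseudohyperbolic_disk z r = {w \<in> unit_disk. cmod ((z - w) / (1 - z * cnj w)) < r}"

(* In the definitions below, the argument M only supplies the sigma-algebra (space M, sets M);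
   its emeasure plays no role.  Set functions are only meaningful on sets M. *)

definition complex_measure :: "'a measure \<Rightarrow> ('a set \<Rightarrow> complex) \<Rightarrow> bool"
  where "complex_measure M \<mu> \<longleftrightarrow>
    \<mu> {} = 0 \<and>
    (\<forall>A :: nat \<Rightarrow> 'a set. range A \<subseteq> sets M \<longrightarrow> disjoint_family A \<longrightarrow>
       (\<lambda>i. \<mu> (A i)) sums \<mu> (\<Union>i. A i))"

(* The supremum over all countable measurable partitions of A; finite partitions are
   included because members of P may be empty. *)
definition variation :: "'a measure \<Rightarrow> ('a set \<Rightarrow> 'b::real_normed_vector) \<Rightarrow> 'a set \<Rightarrow> ennreal"
  where "variation M \<mu> A =
    (SUP P \<in> {P :: nat \<Rightarrow> 'a set. range P \<subseteq> sets M \<and> disjoint_family P \<and> (\<Union>i. P i) = A}.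
       \<Sum>i. ennreal (norm (\<mu> (P i))))"

definition total_variation_measure ::
    "'a measure \<Rightarrow> ('a set \<Rightarrow> 'b::real_normed_vector) \<Rightarrow> 'a measure"
  where "total_variation_measure M \<mu> = measure_of (space M) (sets M) (variation M \<mu>)"

(* Jordan decomposition of a finite signed measure: (|\<nu>| + \<nu>) / 2 and (|\<nu>| - \<nu>) / 2.
   The conversion to real loses nothing, since |\<nu>| is finite. *)

definition positive_variation_measure :: "'a measure \<Rightarrow> ('a set \<Rightarrow> real) \<Rightarrow> 'a measure"
  where "positive_variation_measure M \<nu> =
    measure_of (space M) (sets M) (\<lambda>A. ennreal ((enn2real (variation M \<nu> A) + \<nu> A) / 2))"

definition negative_variation_measure :: "'a measure \<Rightarrow> ('a set \<Rightarrow> real) \<Rightarrow> 'a measure"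
  where "negative_variation_measure M \<nu> =
    measure_of (space M) (sets M) (\<lambda>A. ennreal ((enn2real (variation M \<nu> A) - \<nu> A) / 2))"

definition signed_integral :: "'a measure \<Rightarrow> ('a set \<Rightarrow> real) \<Rightarrow> ('a \<Rightarrow> complex) \<Rightarrow> complex"
  where "signed_integral M \<nu> f =
    (LINT x | positive_variation_measure M \<nu>. f x) - (LINT x | negative_variation_measure M \<nu>. f x)"

definition complex_measure_integral ::
    "'a measure \<Rightarrow> ('a set \<Rightarrow> complex) \<Rightarrow> ('a \<Rightarrow> complex) \<Rightarrow> complex"
  where "complex_measure_integral M \<mu> f =
    signed_integral M (\<lambda>A. Re (\<mu> A)) f + \<i> * signed_integral M (\<lambda>A. Im (\<mu> A)) f"

abbreviation borel_disk :: "complex measure"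
  where "borel_disk \<equiv> restrict_space borel unit_disk"

end

theory Submission imports Defs begin

text \<open>
  Since \<open>(z - w) / (1 - z * cnj w) = - w + (\<Sum>n. z ^ Suc n * (1 - \<bar>w\<bar>\<^sup>2) * cnj w ^ n)\<close>, integrating the
  kernel against \<open>g(w) dA(w)\<close> produces the power series whose coefficients are
  weighted moments of \<open>g\<close>.
  For \<open>f\<close> in the Lipschitz space, the density
  \<open>g(w) = (1 - \<bar>w\<bar>\<^sup>2) ^ (k - 2) * (h(w) - c * cnj w)\<close>, with \<open>h\<close> a multiple of the \<open>k\<close>-th derivative of
  \<open>w ^ (k - 1) * f w\<close>, has exactly the Taylor coefficients of \<open>f\<close> as moments (a Beta integral), while the
  term \<open>c * cnj w\<close> only contributes the constant \<open>f 0\<close>. The growth of the \<open>k\<close>-th derivative gives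
  \<open>\<bar>g(w)\<bar> \<le> C (1 - \<bar>w\<bar>\<^sup>2) powr (t - 2)\<close>, which is the Carleson condition for \<open>g dA\<close>.

  Conversely the \<open>k\<close>-th derivative of the transform of \<open>\<mu>\<close> is dominated by
  \<open>\<integral> (1 - \<bar>w\<bar>\<^sup>2) / \<bar>1 - z * cnj w\<bar> ^ (k + 1) d\<bar>\<mu>\<bar>(w)\<close>. The integrand is nearly constant on
  hyperbolic disks, so the Carleson condition lets one replace \<open>d\<bar>\<mu>\<bar>\<close> by \<open>(1 - \<bar>w\<bar>\<^sup>2) powr (t - 2) dA\<close>,
  and the resulting area integral is estimated by the mean value property of the Poisson kernel.
\<close>

section \<open>The variation of a vector measure\<close>

text \<open>The exponents match because a pseudo-hyperbolic disk at \<open>z\<close> has area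
  comparable to \<open>(1 - |z| ^ 2) ^ 2\<close>: a density of size
  \<open>(1 - |w| ^ 2) powr (t - 2)\<close> gives it mass of order
  \<open>(1 - |z| ^ 2) powr t\<close>, and such a density is integrable for \<open>t > 1\<close>.
  The factor \<open>w ^ (k - 1)\<close> aligns degrees. After \<open>k\<close> derivatives the
  constant term of \<open>f\<close> is lost and coefficient \<open>n\<close> is
  \<open>(n + k)! / n!\<close> times coefficient \<open>n + 1\<close> of \<open>f\<close>. The shift
  by one agrees with the kernel series, which pairs \<open>z ^ (n + 1)\<close> with
  \<open>cnj w ^ n\<close>, and the factor cancels the Beta integral
  \<open>n! (k - 1)! / (n + k)!\<close> of \<open>(1 - s) ^ (k - 1) * s ^ n\<close>. In the
  converse, integrals against \<open>\<mu>\<close> are defined through Jordan parts, whose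
  additivity is proved from finiteness of the variation. Finiteness comes from the Carleson
  condition itself, by the averaging argument applied to the constant 1. The positive and negative
  parts of \<open>Re \<mu>\<close> and \<open>Im \<mu>\<close> are dominated by the variation, so
  the derivative estimate is carried out for positive measures only.\<close>

definition vector_measure :: "'a measure \<Rightarrow> ('a set \<Rightarrow> 'b::real_normed_vector) \<Rightarrow> bool"
  where "vector_measure M \<mu> \<longleftrightarrow>
    \<mu> {} = 0 \<and>
    (\<forall>A :: nat \<Rightarrow> 'a set. range A \<subseteq> sets M \<longrightarrow> disjoint_family A \<longrightarrow>
       (\<lambda>i. \<mu> (A i)) sums \<mu> (\<Union>i. A i))"

text \<open>The variation theory is applied to the complex \<open>\<mu>\<close> and to the real set
  functions \<open>Re \<mu>\<close> and \<open>Im \<mu>\<close>, so it is developed under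
  \<open>vector_measure\<close> for any normed codomain; this identifies the complex case.\<close>

lemma complex_measure_eq_vector_measure: "complex_measure M \<mu> = vector_measure M \<mu>"
  by (simp add: complex_measure_def vector_measure_def)

lemma vector_measure_empty: "vector_measure M \<mu> \<Longrightarrow> \<mu> {} = 0"
  by (simp add: vector_measure_def)

lemma vector_measure_sums:
  "vector_measure M \<mu> \<Longrightarrow> range A \<subseteq> sets M \<Longrightarrow> disjoint_family A \<Longrightarrow>
    (\<lambda>i. \<mu> (A i)) sums \<mu> (\<Union>i. A i)"
  by (simp add: vector_measure_def)

lemma vector_measure_bounded_linear:
  assumes "bounded_linear h" "vector_measure M \<mu>"
  shows "vector_measure M (\<lambda>A. h (\<mu> A))"
  using assms(2) bounded_linear.sums[OF assms(1)] linear_0[OF bounded_linear.linear[OF assms(1)]]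
  unfolding vector_measure_def by metis

lemma variation_upper:
  fixes P :: "nat \<Rightarrow> 'a set"
  assumes "range P \<subseteq> sets M" "disjoint_family P" "(\<Union>i. P i) = A"
  shows "(\<Sum>i. ennreal (norm (\<mu> (P i)))) \<le> variation M \<mu> A"
  unfolding variation_def using assms by (intro SUP_upper) auto

lemma variation_least:
  assumes "\<And>P :: nat \<Rightarrow> 'a set. range P \<subseteq> sets M \<Longrightarrow> disjoint_family P \<Longrightarrow> (\<Union>i. P i) = A \<Longrightarrow>
    (\<Sum>i. ennreal (norm (\<mu> (P i)))) \<le> c"
  shows "variation M \<mu> A \<le> c"
  unfolding variation_def using assms by (intro SUP_least) auto

lemma variation_mono_norm:
  assumes "\<And>A. A \<in> sets M \<Longrightarrow> norm (\<nu> A) \<le> norm (\<mu> A)"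
  shows "variation M \<nu> A \<le> variation M \<mu> A"
proof (rule variation_least)
  fix P :: "nat \<Rightarrow> 'a set" assume P: "range P \<subseteq> sets M" "disjoint_family P" "(\<Union>i. P i) = A"
  have "(\<Sum>i. ennreal (norm (\<nu> (P i)))) \<le> (\<Sum>i. ennreal (norm (\<mu> (P i))))"
    using P by (intro suminf_le ennreal_leI assms) auto
  also have "\<dots> \<le> variation M \<mu> A" using P by (rule variation_upper)
  finally show "(\<Sum>i. ennreal (norm (\<nu> (P i)))) \<le> variation M \<mu> A" .
qed

lemma norm_le_variation:
  assumes "\<mu> {} = 0" "A \<in> sets M"
  shows "ennreal (norm (\<mu> A)) \<le> variation M \<mu> A"
proof -
  define P where "P i = (if i = 0 then A else {})" for i :: nat
  have "ennreal (norm (\<mu> (P 0))) = (\<Sum>i\<in>{0}. ennreal (norm (\<mu> (P i))))" by simp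
  also have "\<dots> \<le> (\<Sum>i. ennreal (norm (\<mu> (P i))))" by (intro sum_le_suminf) auto
  also have "\<dots> \<le> variation M \<mu> A"
  proof (rule variation_upper)
    show "disjoint_family P" by (simp add: disjoint_family_on_def P_def)
    show "(\<Union>i. P i) = A" by (auto simp: P_def split: if_splits)
    show "range P \<subseteq> sets M" using assms by (auto simp: P_def)
  qed
  finally show ?thesis by (simp add: P_def)
qed

lemma ennreal_norm_sums_le:
  fixes f :: "nat \<Rightarrow> 'b::real_normed_vector"
  assumes "f sums s"
  shows "ennreal (norm s) \<le> (\<Sum>i. ennreal (norm (f i)))"
proof (rule LIMSEQ_le_const2)
  show "(\<lambda>n. ennreal (norm (sum f {..<n}))) \<longlonglongrightarrow> ennreal (norm s)"
    using assms unfolding sums_def by (intro tendsto_intros)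
  have "ennreal (norm (sum f {..<n})) \<le> (\<Sum>i. ennreal (norm (f i)))" for n
  proof -
    have "ennreal (norm (sum f {..<n})) \<le> ennreal (\<Sum>i<n. norm (f i))"
      by (intro ennreal_leI norm_sum)
    also have "\<dots> = (\<Sum>i<n. ennreal (norm (f i)))" by simp
    also have "\<dots> \<le> (\<Sum>i. ennreal (norm (f i)))" by (intro sum_le_suminf) auto
    finally show ?thesis .
  qed
  then show "\<exists>N. \<forall>n\<ge>N. ennreal (norm (sum f {..<n})) \<le> (\<Sum>i. ennreal (norm (f i)))" by blast
qed

lemma ennreal_suminf_swap:
  fixes f :: "nat \<Rightarrow> nat \<Rightarrow> ennreal"
  shows "(\<Sum>i. \<Sum>j. f i j) = (\<Sum>j. \<Sum>i. f i j)"
  using nn_integral_suminf[of "\<lambda>j i. f i j" "count_space UNIV"]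
  by (simp add: nn_integral_count_space_nat)

text \<open>A partition \<open>P\<close> of the union is refined by intersecting with every
  \<open>A i\<close>. Countable additivity of \<open>\<mu>\<close> bounds each term of the sum over
  \<open>P\<close>, and after exchanging the sums the row for \<open>A i\<close> competes in the
  supremum for \<open>A i\<close>.\<close>

lemma variation_countably_subadditive:
  fixes A :: "nat \<Rightarrow> 'a set"
  assumes mu: "vector_measure M \<mu>" and A: "range A \<subseteq> sets M" "disjoint_family A"
  shows "variation M \<mu> (\<Union>i. A i) \<le> (\<Sum>i. variation M \<mu> (A i))"
proof (rule variation_least)
  fix P :: "nat \<Rightarrow> 'a set"
  assume P: "range P \<subseteq> sets M" "disjoint_family P" "(\<Union>i. P i) = (\<Union>i. A i)"
  have "(\<Sum>j. ennreal (norm (\<mu> (P j)))) \<le> (\<Sum>j. \<Sum>i. ennreal (norm (\<mu> (P j \<inter> A i))))"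
  proof (intro suminf_le ennreal_norm_sums_le)
    fix j
    have "P j = (\<Union>i. P j \<inter> A i)" using P(3) by auto
    moreover have "(\<lambda>i. \<mu> (P j \<inter> A i)) sums \<mu> (\<Union>i. P j \<inter> A i)"
    proof (rule vector_measure_sums[OF mu])
      show "range (\<lambda>i. P j \<inter> A i) \<subseteq> sets M" using P A by auto
      show "disjoint_family (\<lambda>i. P j \<inter> A i)"
        using A(2) unfolding disjoint_family_on_def by blast
    qed
    ultimately show "(\<lambda>i. \<mu> (P j \<inter> A i)) sums \<mu> (P j)" by simp
  qed auto
  also have "\<dots> = (\<Sum>i. \<Sum>j. ennreal (norm (\<mu> (P j \<inter> A i))))" by (rule ennreal_suminf_swap)
  also have "\<dots> \<le> (\<Sum>i. variation M \<mu> (A i))"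
  proof (intro suminf_le variation_upper)
    show "range (\<lambda>j. P j \<inter> A i) \<subseteq> sets M" for i using P A by auto
    show "disjoint_family (\<lambda>j. P j \<inter> A i)" for i
      using P(2) unfolding disjoint_family_on_def by blast
    show "(\<Union>j. P j \<inter> A i) = A i" for i using P(3) by auto
  qed auto
  finally show "(\<Sum>j. ennreal (norm (\<mu> (P j)))) \<le> (\<Sum>i. variation M \<mu> (A i))" .
qed

text \<open>Interleaving a partition of \<open>A\<close> (even indices) with one of \<open>B\<close>
  (odd indices) yields a partition of the union, so every pair of partition sums is bounded; the two
  suprema are then taken one after the other.\<close>

lemma variation_add_le:
  assumes sets: "A \<in> sets M" "B \<in> sets M" and AB: "A \<inter> B = {}"
  shows "variation M \<mu> A + variation M \<mu> B \<le> variation M \<mu> (A \<union> B)"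
proof -
  let ?S = "\<lambda>A. {P :: nat \<Rightarrow> 'a set. range P \<subseteq> sets M \<and> disjoint_family P \<and> (\<Union>i. P i) = A}"
  let ?n = "\<lambda>P i. ennreal (norm (\<mu> (P i)))"
  have PQ: "suminf (?n P) + suminf (?n Q) \<le> variation M \<mu> (A \<union> B)"
    if P: "P \<in> ?S A" and Q: "Q \<in> ?S B" for P Q
  proof -
    define R where "R n = (if even n then P (n div 2) else Q (n div 2))" for n
    have R_double: "R (2 * n) = P n" "R (Suc (2 * n)) = Q n" for n by (simp_all add: R_def)
    have sum_R: "(\<Sum>i<2*n. ?n R i) = (\<Sum>i<n. ?n P i) + (\<Sum>i<n. ?n Q i)" for n
      by (induction n) (simp_all add: R_double add_ac)
    have "suminf (?n R) \<le> variation M \<mu> (A \<union> B)"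
    proof (rule variation_upper)
      show "range R \<subseteq> sets M" using P Q by (auto simp: R_def)
      show "(\<Union>i. R i) = A \<union> B"
      proof
        show "(\<Union>i. R i) \<subseteq> A \<union> B" using P Q by (auto simp: R_def split: if_splits)
        show "A \<union> B \<subseteq> (\<Union>i. R i)"
        proof -
          have "P i \<subseteq> (\<Union>i. R i)" "Q i \<subseteq> (\<Union>i. R i)" for i
            using UN_upper[of "2 * i" UNIV R] UN_upper[of "Suc (2 * i)" UNIV R] by (simp_all add: R_double)
          moreover have "A = (\<Union>i. P i)" "B = (\<Union>i. Q i)" using P Q by simp_all
          ultimately show ?thesis by (simp add: UN_least)
        qed
      qed
      show "disjoint_family R"
        unfolding disjoint_family_on_def
      proof (intro ballI impI)
        fix m n :: nat assume "m \<noteq> n"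
        have sub: "P i \<inter> Q j = {}" for i j
        proof -
          have "P i \<subseteq> A" "Q j \<subseteq> B" using P Q by auto
          then show ?thesis using AB by auto
        qed
        have disj: "P i \<inter> P j = {}" "Q i \<inter> Q j = {}" if "i \<noteq> j" for i j
          using P Q that unfolding disjoint_family_on_def by blast+
        show "R m \<inter> R n = {}"
        proof (cases "even m = even n")
          case True
          then have "m div 2 \<noteq> n div 2" using \<open>m \<noteq> n\<close> by presburger
          then show ?thesis using True disj by (simp add: R_def)
        next
          case False
          then show ?thesis using sub by (auto simp: R_def Int_commute)
        qed
      qed
    qed
    moreover have "suminf (?n P) + suminf (?n Q) \<le> suminf (?n R)"
    proof (rule LIMSEQ_le_const2)
      show "(\<lambda>n. (\<Sum>i<n. ?n P i) + (\<Sum>i<n. ?n Q i)) \<longlonglongrightarrow> suminf (?n P) + suminf (?n Q)"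
        by (intro tendsto_add summable_LIMSEQ) auto
      show "\<exists>N. \<forall>n\<ge>N. (\<Sum>i<n. ?n P i) + (\<Sum>i<n. ?n Q i) \<le> suminf (?n R)"
        unfolding sum_R[symmetric] by (intro exI allI impI sum_le_suminf) auto
    qed
    ultimately show ?thesis by (rule order_trans[rotated])
  qed
  \<comment> \<open>Pulling a summand out of a supremum in \<open>ennreal\<close> needs a nonempty
    index set; \<open>C\<close> followed by empty sets is a partition.\<close>
  have nonempty: "?S C \<noteq> {}" if "C \<in> sets M" for C
    using that by (auto simp: disjoint_family_on_def split: if_splits
        intro!: exI[of _ "\<lambda>i::nat. if i = 0 then C else {}"])
  have "suminf (?n P) + variation M \<mu> B \<le> variation M \<mu> (A \<union> B)" if "P \<in> ?S A" for P
  proof -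
    have "(SUP Q\<in>?S B. suminf (?n P) + suminf (?n Q)) \<le> variation M \<mu> (A \<union> B)"
      using PQ[OF that] by (intro SUP_least)
    then have "suminf (?n P) + (SUP Q\<in>?S B. suminf (?n Q)) \<le> variation M \<mu> (A \<union> B)"
      using nonempty[OF sets(2)] by (subst ennreal_SUP_add_right) auto
    then show ?thesis unfolding variation_def[of M \<mu> B] .
  qed
  then have "(SUP P\<in>?S A. suminf (?n P) + variation M \<mu> B) \<le> variation M \<mu> (A \<union> B)"
    by (intro SUP_least)
  then have "(SUP P\<in>?S A. suminf (?n P)) + variation M \<mu> B \<le> variation M \<mu> (A \<union> B)"
    using nonempty[OF sets(1)] by (subst (asm) ennreal_SUP_add_left) auto
  then show ?thesis unfolding variation_def[of M \<mu> A] .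
qed

lemma variation_mono:
  assumes "A \<in> sets M" "B \<in> sets M" "A \<subseteq> B"
  shows "variation M \<mu> A \<le> variation M \<mu> B"
proof -
  have "variation M \<mu> A + variation M \<mu> (B - A) \<le> variation M \<mu> (A \<union> (B - A))"
    using assms by (intro variation_add_le) auto
  also have "A \<union> (B - A) = B" using assms by auto
  finally show ?thesis by (rule order_trans[rotated]) simp
qed

lemma variation_empty:
  fixes \<mu> :: "'a set \<Rightarrow> 'b::real_normed_vector"
  assumes mu: "\<mu> {} = 0"
  shows "variation M \<mu> {} = 0"
proof -
  have "variation M \<mu> {} \<le> 0"
  proof (rule variation_least)
    fix P :: "nat \<Rightarrow> 'a set" assume "(\<Union>i. P i) = {}"
    then have "P i = {}" for i by (simp only: UNION_empty_conv) simp
    then show "(\<Sum>i. ennreal (norm (\<mu> (P i)))) \<le> 0" by (simp add: mu)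
  qed
  then show ?thesis by simp
qed

lemma variation_countably_additive:
  assumes mu: "vector_measure M \<mu>"
  shows "countably_additive (sets M) (variation M \<mu>)"
  unfolding countably_additive_def
proof (intro allI impI antisym)
  fix A :: "nat \<Rightarrow> 'a set"
  assume A: "range A \<subseteq> sets M" "disjoint_family A" and U: "(\<Union>i. A i) \<in> sets M"
  show "variation M \<mu> (\<Union>i. A i) \<le> (\<Sum>i. variation M \<mu> (A i))"
    using mu A by (rule variation_countably_subadditive)
  \<comment> \<open>The reverse inequality: superadditivity for finitely many sets, then
    monotonicity and the limit of the partial sums.\<close>
  have *: "(\<Sum>i<n. variation M \<mu> (A i)) \<le> variation M \<mu> (\<Union>i<n. A i)" for n
  proof (induction n)
    case (Suc n)
    have "(\<Sum>i<Suc n. variation M \<mu> (A i)) \<le> variation M \<mu> (\<Union>i<n. A i) + variation M \<mu> (A n)"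
      using Suc by (simp add: add_right_mono)
    also have "\<dots> \<le> variation M \<mu> ((\<Union>i<n. A i) \<union> A n)"
    proof (rule variation_add_le)
      show "(\<Union>i<n. A i) \<inter> A n = {}"
      proof -
        have "A i \<inter> A n = {}" if "i < n" for i
          using disjoint_family_onD[OF A(2), of i n] that by simp
        then show ?thesis by blast
      qed
    qed (use A in auto)
    also have "(\<Union>i<n. A i) \<union> A n = (\<Union>i<Suc n. A i)" by (auto simp: less_Suc_eq)
    finally show ?case .
  qed simp
  have "(\<Sum>i<n. variation M \<mu> (A i)) \<le> variation M \<mu> (\<Union>i. A i)" for n
    using A U by (intro order_trans[OF * variation_mono]) auto
  then show "(\<Sum>i. variation M \<mu> (A i)) \<le> variation M \<mu> (\<Union>i. A i)"
    by (intro suminf_le_const) auto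
qed

section \<open>The measures defined from the variation, and the Jordan decomposition\<close>

lemma
  shows space_total_variation_measure [simp]: "space (total_variation_measure M \<mu>) = space M"
    and sets_total_variation_measure [simp, measurable_cong]:
      "sets (total_variation_measure M \<mu>) = sets M"
    and space_positive_variation_measure [simp]: "space (positive_variation_measure M \<nu>) = space M"
    and sets_positive_variation_measure [simp, measurable_cong]:
      "sets (positive_variation_measure M \<nu>) = sets M"
    and space_negative_variation_measure [simp]: "space (negative_variation_measure M \<nu>) = space M"
    and sets_negative_variation_measure [simp, measurable_cong]:
      "sets (negative_variation_measure M \<nu>) = sets M"
  by (simp_all add: total_variation_measure_def positive_variation_measure_def
      negative_variation_measure_def sets.space_closed sets.sigma_sets_eq)

lemma emeasure_total_variation_measure:
  assumes mu: "vector_measure M \<mu>" and A: "A \<in> sets M"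
  shows "emeasure (total_variation_measure M \<mu>) A = variation M \<mu> A"
proof (rule emeasure_measure_of[OF total_variation_measure_def])
  show "positive (sets (total_variation_measure M \<mu>)) (variation M \<mu>)"
    by (simp add: positive_def variation_empty vector_measure_empty[OF mu])
qed (use A variation_countably_additive[OF mu] in \<open>simp_all add: sets.space_closed\<close>)

text \<open>The sign \<open>s\<close> treats both Jordan parts at once. Finiteness turns the
  additivity of \<open>variation\<close>, a statement in \<open>ennreal\<close>, into a convergent
  real series that can be combined with the one for \<open>\<nu>\<close>; the result is nonnegative
  because \<open>\<bar>\<nu> B\<bar>\<close> is at most the variation.\<close>

lemma emeasure_Jordan_aux:
  fixes \<nu> :: "'a set \<Rightarrow> real"
  assumes nu: "vector_measure M \<nu>" and fin: "variation M \<nu> (space M) < \<infinity>"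
    and s: "s \<in> {1, -1}" and A: "A \<in> sets M"
  shows "emeasure (measure_of (space M) (sets M)
      (\<lambda>A. ennreal ((enn2real (variation M \<nu> A) + s * \<nu> A) / 2))) A =
    ennreal ((enn2real (variation M \<nu> A) + s * \<nu> A) / 2)"
proof -
  let ?V = "\<lambda>A. enn2real (variation M \<nu> A)"
  have fin': "variation M \<nu> B < \<infinity>" if "B \<in> sets M" for B
    using variation_mono[OF that sets.top sets.sets_into_space[OF that]] fin by (rule le_less_trans)
  have V: "ennreal (?V B) = variation M \<nu> B" if "B \<in> sets M" for B
    using fin'[OF that] by simp
  have nonneg: "0 \<le> ?V B + s * \<nu> B" if "B \<in> sets M" for B
  proof -
    have "ennreal \<bar>\<nu> B\<bar> \<le> ennreal (?V B)"
      using norm_le_variation[of \<nu>, OF vector_measure_empty[OF nu] that] V[OF that] by simp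
    then have "\<bar>\<nu> B\<bar> \<le> ?V B" by (simp add: ennreal_le_iff)
    then show ?thesis using s by auto
  qed
  have ca: "countably_additive (sets M) (\<lambda>A. ennreal ((?V A + s * \<nu> A) / 2))"
    unfolding countably_additive_def
  proof (intro allI impI)
    fix B :: "nat \<Rightarrow> 'a set"
    assume B: "range B \<subseteq> sets M" "disjoint_family B" and U: "(\<Union>i. B i) \<in> sets M"
    have "(\<Sum>i. ennreal (?V (B i))) = ennreal (?V (\<Union>i. B i))"
      using variation_countably_additive[OF nu] B U
      by (simp add: countably_additive_def V range_subsetD[OF B(1)])
    then have suminf: "(\<Sum>i. ennreal (?V (B i))) = ennreal (?V (\<Union>i. B i))" .
    then have summable: "summable (\<lambda>i. ?V (B i))"
      by (intro summable_suminf_not_top) auto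
    have "ennreal (\<Sum>i. ?V (B i)) = ennreal (?V (\<Union>i. B i))"
      using suminf_ennreal2[OF _ summable] suminf by simp
    then have "(\<lambda>i. ?V (B i)) sums ?V (\<Union>i. B i)"
      using summable by (simp add: sums_iff suminf_nonneg)
    moreover have "(\<lambda>i. \<nu> (B i)) sums \<nu> (\<Union>i. B i)"
      using B by (rule vector_measure_sums[OF nu])
    ultimately have "(\<lambda>i. (?V (B i) + s * \<nu> (B i)) / 2) sums ((?V (\<Union>i. B i) + s * \<nu> (\<Union>i. B i)) / 2)"
      by (intro sums_divide sums_add sums_mult)
    then show "(\<Sum>i. ennreal ((?V (B i) + s * \<nu> (B i)) / 2)) =
        ennreal ((?V (\<Union>i. B i) + s * \<nu> (\<Union>i. B i)) / 2)"
      using nonneg B(1) by (intro suminf_ennreal_eq) auto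
  qed
  show ?thesis
    using ca A sets.sigma_algebra_axioms
    by (intro emeasure_measure_of_sigma)
       (simp_all add: positive_def variation_empty vector_measure_empty[OF nu])
qed

lemma
  fixes \<nu> :: "'a set \<Rightarrow> real"
  assumes "vector_measure M \<nu>" "variation M \<nu> (space M) < \<infinity>" "A \<in> sets M"
  shows emeasure_positive_variation_measure:
      "emeasure (positive_variation_measure M \<nu>) A = ennreal ((enn2real (variation M \<nu> A) + \<nu> A) / 2)"
    and emeasure_negative_variation_measure:
      "emeasure (negative_variation_measure M \<nu>) A = ennreal ((enn2real (variation M \<nu> A) - \<nu> A) / 2)"
  using emeasure_Jordan_aux[OF assms(1,2) _ assms(3), of 1]
    emeasure_Jordan_aux[OF assms(1,2) _ assms(3), of "-1"]
  by (simp_all add: positive_variation_measure_def negative_variation_measure_def)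

text \<open>This is how a Carleson bound on the variation passes to each Jordan part:
  \<open>\<bar>\<nu> A\<bar>\<close> is at most the variation, so half of their sum or difference is
  too.\<close>

lemma
  fixes \<nu> :: "'a set \<Rightarrow> real"
  assumes nu: "vector_measure M \<nu>" and fin: "variation M \<nu> (space M) < \<infinity>" and A: "A \<in> sets M"
  shows emeasure_positive_variation_measure_le:
      "emeasure (positive_variation_measure M \<nu>) A \<le> variation M \<nu> A"
    and emeasure_negative_variation_measure_le:
      "emeasure (negative_variation_measure M \<nu>) A \<le> variation M \<nu> A"
proof -
  have fin': "variation M \<nu> A < \<infinity>"
    using variation_mono[OF A sets.top sets.sets_into_space[OF A]] fin by (rule le_less_trans)
  then have V: "ennreal (enn2real (variation M \<nu> A)) = variation M \<nu> A" by simp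
  have "ennreal \<bar>\<nu> A\<bar> \<le> ennreal (enn2real (variation M \<nu> A))"
    unfolding V using norm_le_variation[of \<nu>, OF vector_measure_empty[OF nu] A] by simp
  then have "\<bar>\<nu> A\<bar> \<le> enn2real (variation M \<nu> A)" by (simp add: ennreal_le_iff)
  then have "ennreal ((enn2real (variation M \<nu> A) + \<nu> A) / 2) \<le> ennreal (enn2real (variation M \<nu> A))"
    "ennreal ((enn2real (variation M \<nu> A) - \<nu> A) / 2) \<le> ennreal (enn2real (variation M \<nu> A))"
    by (auto intro!: ennreal_leI)
  then show "emeasure (positive_variation_measure M \<nu>) A \<le> variation M \<nu> A"
    "emeasure (negative_variation_measure M \<nu>) A \<le> variation M \<nu> A"
    unfolding emeasure_positive_variation_measure[OF assms]
      emeasure_negative_variation_measure[OF assms]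
    by (simp_all only: V)
qed

section \<open>Set functions with a density\<close>

lemma vector_measure_density:
  fixes g :: "'a \<Rightarrow> 'b::{banach, second_countable_topology}"
  assumes g: "integrable M g"
  shows "vector_measure M (\<lambda>A. LINT x:A|M. g x)"
  unfolding vector_measure_def
proof (intro conjI allI impI)
  fix A :: "nat \<Rightarrow> 'a set" assume A: "range A \<subseteq> sets M" "disjoint_family A"
  have int: "set_integrable M B g" if "B \<in> sets M" for B
    using integrable_mult_indicator[OF that g] by (simp add: set_integrable_def)
  have disj: "\<And>x i j. x \<in> A i \<Longrightarrow> x \<in> A j \<Longrightarrow> i = j"
    using A(2) by (auto simp: disjoint_family_on_def)
  have ind: "(\<lambda>i. indicator (A i) x *\<^sub>R g x) sums (indicator (\<Union>i. A i) x *\<^sub>R g x)" for x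
  proof (cases "x \<in> (\<Union>i. A i)")
    case True
    then obtain n where n: "x \<in> A n" by auto
    have "indicator (A i) x *\<^sub>R g x = (if i = n then g x else 0)" for i
      using n disj[OF n, of i] by (cases "x \<in> A i") auto
    moreover have "indicat_real (\<Union>i. A i) x = 1" using n by (intro indicator_simps(1)) blast
    ultimately show ?thesis using sums_single[of n "\<lambda>_. g x"] by simp
  qed (simp add: indicator_def)
  \<comment> \<open>Dominated convergence with majorant \<open>norm (g x)\<close>: the sets are
    disjoint, so a partial sum is \<open>g\<close> restricted to a finite union.\<close>
  have "(\<lambda>n. LINT x|M. (\<Sum>i<n. indicator (A i) x *\<^sub>R g x)) \<longlonglongrightarrow> (LINT x|M. indicator (\<Union>i. A i) x *\<^sub>R g x)"
  proof (rule integral_dominated_convergence[where w = "\<lambda>x. norm (g x)"])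
    show "(\<lambda>x. indicator (\<Union>i. A i) x *\<^sub>R g x) \<in> borel_measurable M"
      using g A(1) by (intro borel_measurable_scaleR borel_measurable_indicator) auto
    show "(\<lambda>x. \<Sum>i<n. indicator (A i) x *\<^sub>R g x) \<in> borel_measurable M" for n
      using g A(1) by (intro borel_measurable_sum borel_measurable_scaleR borel_measurable_indicator) auto
    show "AE x in M. (\<lambda>n. \<Sum>i<n. indicator (A i) x *\<^sub>R g x) \<longlonglongrightarrow> indicator (\<Union>i. A i) x *\<^sub>R g x"
      using ind by (simp add: sums_def)
    show "AE x in M. norm (\<Sum>i<n. indicator (A i) x *\<^sub>R g x) \<le> norm (g x)" for n
    proof (intro AE_I2)
      fix x
      have "(\<Sum>i<n. indicat_real (A i) x) = indicator (\<Union>i<n. A i) x"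
        by (rule indicator_UN_disjoint[symmetric])
           (use A(2) in \<open>auto simp: disjoint_family_on_def\<close>)
      then have "(\<Sum>i<n. indicator (A i) x *\<^sub>R g x) = indicator (\<Union>i<n. A i) x *\<^sub>R g x"
        by (simp flip: scaleR_sum_left)
      then show "norm (\<Sum>i<n. indicator (A i) x *\<^sub>R g x) \<le> norm (g x)"
        by (simp add: indicator_def)
    qed
  qed (use g in simp)
  moreover have "(LINT x|M. (\<Sum>i<n. indicator (A i) x *\<^sub>R g x)) = (\<Sum>i<n. LINT x:A i|M. g x)" for n
    unfolding set_lebesgue_integral_def
    using int A(1) by (intro Bochner_Integration.integral_sum) (auto simp: set_integrable_def)
  ultimately show "(\<lambda>i. LINT x:A i|M. g x) sums (LINT x:(\<Union>i. A i)|M. g x)"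
    by (simp only: sums_def set_lebesgue_integral_def)
qed (simp add: set_lebesgue_integral_def)

lemma norm_set_integral_le:
  fixes g :: "'a \<Rightarrow> 'b::{banach, second_countable_topology}"
  assumes g: "integrable M g" and A: "A \<in> sets M"
  shows "ennreal (norm (LINT x:A|M. g x)) \<le> (\<integral>\<^sup>+x\<in>A. ennreal (norm (g x)) \<partial>M)"
proof -
  have "ennreal (norm (LINT x:A|M. g x)) \<le> (\<integral>\<^sup>+x. norm (indicator A x *\<^sub>R g x) \<partial>M)"
    unfolding set_lebesgue_integral_def
    by (intro integral_norm_bound_ennreal integrable_mult_indicator A g)
  also have "\<dots> = (\<integral>\<^sup>+x\<in>A. ennreal (norm (g x)) \<partial>M)"
    by (intro nn_integral_cong) (simp add: indicator_def)
  finally show ?thesis .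
qed

lemma variation_density_le:
  fixes g :: "'a \<Rightarrow> 'b::{banach, second_countable_topology}"
  assumes g: "integrable M g"
  shows "variation M (\<lambda>A. LINT x:A|M. g x) A \<le> (\<integral>\<^sup>+x\<in>A. ennreal (norm (g x)) \<partial>M)"
proof (rule variation_least)
  fix P :: "nat \<Rightarrow> 'a set" assume P: "range P \<subseteq> sets M" "disjoint_family P" "(\<Union>i. P i) = A"
  have "(\<Sum>i. ennreal (norm (LINT x:P i|M. g x))) \<le> (\<Sum>i. \<integral>\<^sup>+x\<in>P i. ennreal (norm (g x)) \<partial>M)"
    using P by (intro suminf_le norm_set_integral_le g) auto
  also have "\<dots> = (\<integral>\<^sup>+x\<in>(\<Union>i. P i). ennreal (norm (g x)) \<partial>M)"
    using P g by (intro nn_integral_disjoint_family[symmetric]) auto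
  finally show "(\<Sum>i. ennreal (norm (LINT x:P i|M. g x))) \<le> (\<integral>\<^sup>+x\<in>A. ennreal (norm (g x)) \<partial>M)"
    using P by simp
qed

text \<open>The upper bound is \<open>variation_density_le\<close>. For the lower bound
  \<open>A\<close> is split by the sign of \<open>g\<close>; two sets already realise the integral
  of \<open>\<bar>g\<bar>\<close>.\<close>

lemma variation_real_density:
  fixes g :: "'a \<Rightarrow> real"
  assumes g[measurable]: "integrable M g" and A[measurable]: "A \<in> sets M"
  shows "variation M (\<lambda>A. LINT x:A|M. g x) A = ennreal (LINT x:A|M. \<bar>g x\<bar>)"
proof -
  let ?\<nu> = "\<lambda>A. LINT x:A|M. g x"
  define P where "P = A \<inter> {x \<in> space M. 0 \<le> g x}"
  define N where "N = A \<inter> {x \<in> space M. g x < 0}"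
  have [measurable]: "P \<in> sets M" "N \<in> sets M" by (simp_all add: P_def N_def)
  have PN: "P \<inter> N = {}" "P \<union> N = A"
    using sets.sets_into_space[OF A] by (auto simp: P_def N_def)
  have int: "set_integrable M B g" "set_integrable M B (\<lambda>x. \<bar>g x\<bar>)" if "B \<in> sets M" for B
    using integrable_mult_indicator[OF that g]
      integrable_mult_indicator[OF that integrable_abs[OF g]] by (simp_all add: set_integrable_def)
  have nn: "(\<integral>\<^sup>+x\<in>A. ennreal (norm (g x)) \<partial>M) = ennreal (LINT x:A|M. \<bar>g x\<bar>)"
    using int[OF A] by (subst nn_integral_set_ennreal, subst nn_integral_eq_integral)
      (auto simp: set_integrable_def set_lebesgue_integral_def mult.commute)
  show ?thesis
  proof (rule antisym)
    show "variation M ?\<nu> A \<le> ennreal (LINT x:A|M. \<bar>g x\<bar>)"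
      using variation_density_le[OF g, of A] unfolding nn .
    have "(LINT x:A|M. \<bar>g x\<bar>) = (LINT x:P|M. \<bar>g x\<bar>) + (LINT x:N|M. \<bar>g x\<bar>)"
      using PN int by (subst PN(2)[symmetric], intro set_integral_Un) auto
    also have "(LINT x:P|M. \<bar>g x\<bar>) = (LINT x:P|M. g x)"
      by (intro set_lebesgue_integral_cong) (auto simp: P_def)
    also have "(LINT x:N|M. \<bar>g x\<bar>) = - (LINT x:N|M. g x)"
    proof -
      have "(LINT x:N|M. \<bar>g x\<bar>) = (LINT x:N|M. - g x)"
        by (intro set_lebesgue_integral_cong) (auto simp: N_def)
      then show ?thesis by (simp add: set_lebesgue_integral_def)
    qed
    finally have "(LINT x:A|M. \<bar>g x\<bar>) \<le> norm (?\<nu> P) + norm (?\<nu> N)" by simp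
    then have "ennreal (LINT x:A|M. \<bar>g x\<bar>) \<le> ennreal (norm (?\<nu> P)) + ennreal (norm (?\<nu> N))"
      by (simp add: ennreal_leI flip: ennreal_plus)
    also have "\<dots> \<le> variation M ?\<nu> P + variation M ?\<nu> N"
      by (intro add_mono norm_le_variation) (auto simp: set_lebesgue_integral_def)
    also have "\<dots> \<le> variation M ?\<nu> (P \<union> N)"
      using PN by (intro variation_add_le) auto
    finally show "ennreal (LINT x:A|M. \<bar>g x\<bar>) \<le> variation M ?\<nu> A" by (simp add: PN)
  qed
qed

text \<open>With the variation known, the defining formulas become integrals of
  \<open>(\<bar>g\<bar> + g) / 2\<close> and \<open>(\<bar>g\<bar> - g) / 2\<close>, which are the
  positive and negative parts of \<open>g\<close>; \<open>s\<close> in the proof is the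
  sign.\<close>

lemma
  fixes g :: "'a \<Rightarrow> real"
  assumes g[measurable]: "integrable M g"
  shows positive_variation_measure_density:
      "positive_variation_measure M (\<lambda>A. LINT x:A|M. g x) = density M (\<lambda>x. ennreal (max 0 (g x)))"
    and negative_variation_measure_density:
      "negative_variation_measure M (\<lambda>A. LINT x:A|M. g x) = density M (\<lambda>x. ennreal (max 0 (- g x)))"
proof -
  let ?\<nu> = "\<lambda>A. LINT x:A|M. g x"
  have int: "set_integrable M B g" "set_integrable M B (\<lambda>x. \<bar>g x\<bar>)" if "B \<in> sets M" for B
    using integrable_mult_indicator[OF that g]
      integrable_mult_indicator[OF that integrable_abs[OF g]] by (simp_all add: set_integrable_def)
  have fin: "variation M ?\<nu> (space M) < \<infinity>"
    by (simp add: variation_real_density[OF g])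
  have nn: "0 \<le> (LINT x:B|M. \<bar>g x\<bar>)" for B
    by (auto simp: set_lebesgue_integral_def intro!: integral_nonneg_AE)
  have *: "((LINT x:B|M. \<bar>g x\<bar>) + s * (LINT x:B|M. g x)) / 2 = (LINT x:B|M. max 0 (s * g x))"
    if B: "B \<in> sets M" and s: "s = 1 \<or> s = -1" for B and s :: real
  proof -
    have "(LINT x:B|M. max 0 (s * g x)) = (LINT x:B|M. (\<bar>g x\<bar> + s * g x) / 2)"
      using s by (intro set_lebesgue_integral_cong B) (auto simp: max_def)
    also have "\<dots> = ((LINT x:B|M. \<bar>g x\<bar>) + (LINT x:B|M. s * g x)) / 2"
      using int[OF B] by (simp add: set_integral_add)
    finally show ?thesis by simp
  qed
  have dens: "emeasure (density M (\<lambda>x. ennreal (max 0 (s * g x)))) B = ennreal (LINT x:B|M. max 0 (s * g x))"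
    if B: "B \<in> sets M" for B and s :: real
  proof -
    have "integrable M (\<lambda>x. max 0 (s * g x))" using g by simp
    then have "set_integrable M B (\<lambda>x. max 0 (s * g x))"
      using integrable_mult_indicator[OF B, of "\<lambda>x. max 0 (s * g x)"] by (simp add: set_integrable_def)
    then show ?thesis
      using B by (subst emeasure_density, measurable, subst nn_integral_set_ennreal, subst nn_integral_eq_integral)
        (auto simp: set_integrable_def set_lebesgue_integral_def mult.commute)
  qed
  show "positive_variation_measure M ?\<nu> = density M (\<lambda>x. ennreal (max 0 (g x)))"
  proof (rule measure_eqI)
    fix B assume "B \<in> sets (positive_variation_measure M ?\<nu>)"
    then have B: "B \<in> sets M" by simp
    show "emeasure (positive_variation_measure M ?\<nu>) B = emeasure (density M (\<lambda>x. ennreal (max 0 (g x)))) B"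
      using *[OF B, of 1] dens[OF B, of 1] B nn
      by (simp add: emeasure_positive_variation_measure[OF vector_measure_density[OF g] fin]
          variation_real_density[OF g])
  qed simp
  show "negative_variation_measure M ?\<nu> = density M (\<lambda>x. ennreal (max 0 (- g x)))"
  proof (rule measure_eqI)
    fix B assume "B \<in> sets (negative_variation_measure M ?\<nu>)"
    then have B: "B \<in> sets M" by simp
    show "emeasure (negative_variation_measure M ?\<nu>) B = emeasure (density M (\<lambda>x. ennreal (max 0 (- g x)))) B"
      using *[OF B, of "-1"] dens[OF B, of "-1"] B nn
      by (simp add: emeasure_negative_variation_measure[OF vector_measure_density[OF g] fin]
          variation_real_density[OF g])
  qed simp
qed

text \<open>Moving \<open>Re\<close> or \<open>Im\<close> inside \<open>LINT x:A|M\<close> is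
  justified for \<open>A\<close> in \<open>sets M\<close>, so values on measurable sets have to
  suffice; the lemma serves as a congruence rule for that rewriting.\<close>

lemma signed_integral_cong_sets:
  assumes "M = M'" "h = h'" and "\<And>A. A \<in> sets M' \<Longrightarrow> \<nu> A = \<nu>' A"
  shows "signed_integral M \<nu> h = signed_integral M' \<nu>' h'"
proof -
  have "variation M \<nu> A = variation M \<nu>' A" for A
    using assms by (intro antisym variation_mono_norm) auto
  then have "positive_variation_measure M \<nu> = positive_variation_measure M \<nu>'"
    "negative_variation_measure M \<nu> = negative_variation_measure M \<nu>'"
    using assms unfolding positive_variation_measure_def negative_variation_measure_def
    by (intro measure_of_eq; simp add: sets.space_closed sets.sigma_sets_eq)+
  then show ?thesis using assms by (simp add: signed_integral_def)
qed

lemma signed_integral_density: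
  fixes g :: "'a \<Rightarrow> real" and h :: "'a \<Rightarrow> complex"
  assumes g[measurable]: "integrable M g" and h[measurable]: "h \<in> borel_measurable M"
    and gh: "integrable M (\<lambda>x. g x *\<^sub>R h x)"
  shows "signed_integral M (\<lambda>A. LINT x:A|M. g x) h = (LINT x|M. g x *\<^sub>R h x)"
proof -
  have int: "integrable M (\<lambda>x. max 0 (s * g x) *\<^sub>R h x)" if "s = 1 \<or> s = -1" for s
    using gh by (rule Bochner_Integration.integrable_bound)
      (use that in \<open>auto simp: max_def abs_mult intro!: mult_right_mono\<close>)
  have "signed_integral M (\<lambda>A. LINT x:A|M. g x) h =
      (LINT x|M. max 0 (g x) *\<^sub>R h x) - (LINT x|M. max 0 (- g x) *\<^sub>R h x)"
    unfolding signed_integral_def positive_variation_measure_density[OF g]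
      negative_variation_measure_density[OF g]
    by (subst (1 2) integral_density) auto
  also have "\<dots> = (LINT x|M. max 0 (g x) *\<^sub>R h x - max 0 (- g x) *\<^sub>R h x)"
    using int[of 1] int[of "-1"] by (intro Bochner_Integration.integral_diff[symmetric]) auto
  also have "\<dots> = (LINT x|M. g x *\<^sub>R h x)"
    by (intro Bochner_Integration.integral_cong) (auto simp: max_def)
  finally show ?thesis .
qed

lemma complex_measure_integral_density:
  fixes g h :: "'a \<Rightarrow> complex"
  assumes g[measurable]: "integrable M g" and h[measurable]: "h \<in> borel_measurable M"
    and gh: "integrable M (\<lambda>x. g x * h x)"
  shows "complex_measure_integral M (\<lambda>A. LINT x:A|M. g x) h = (LINT x|M. g x * h x)"
proof -
  have eq: "Re (LINT x:A|M. g x) = (LINT x:A|M. Re (g x))"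
    "Im (LINT x:A|M. g x) = (LINT x:A|M. Im (g x))" if "A \<in> sets M" for A
    using integrable_mult_indicator[OF that g] unfolding set_lebesgue_integral_def
    by (simp_all flip: integral_Re integral_Im)
  have int: "integrable M (\<lambda>x. Re (g x) *\<^sub>R h x)" "integrable M (\<lambda>x. Im (g x) *\<^sub>R h x)"
    using gh by (auto elim!: Bochner_Integration.integrable_bound
        simp: norm_mult abs_Re_le_cmod abs_Im_le_cmod intro!: mult_right_mono AE_I2)
  have "complex_measure_integral M (\<lambda>A. LINT x:A|M. g x) h =
      (LINT x|M. Re (g x) *\<^sub>R h x) + \<i> * (LINT x|M. Im (g x) *\<^sub>R h x)"
    unfolding complex_measure_integral_def using g int
    by (simp add: eq signed_integral_density cong: signed_integral_cong_sets)
  also have "\<dots> = (LINT x|M. Re (g x) *\<^sub>R h x + \<i> * (Im (g x) *\<^sub>R h x))"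
    using int by (simp del: mult_scaleR_right)
  also have "\<dots> = (LINT x|M. g x * h x)"
    by (intro Bochner_Integration.integral_cong refl) (simp add: complex_eq_iff)
  finally show ?thesis .
qed

section \<open>Rotation invariance and polar coordinates on the disk\<close>

text \<open>An isometry from \<open>real^2\<close> to \<open>complex\<close>. Through it the
  invariance of Lebesgue measure under an \<open>orthogonal_transformation\<close> of
  \<open>real^2\<close> becomes invariance under multiplication by a unimodular number.\<close>

definition vec_to_complex :: "real^2 \<Rightarrow> complex"
  where "vec_to_complex v = Complex (v $ 1) (v $ 2)"

definition complex_to_vec :: "complex \<Rightarrow> real^2"
  where "complex_to_vec z = vector [Re z, Im z]"

lemma vec_to_complex_to_vec [simp]: "vec_to_complex (complex_to_vec z) = z"
  by (simp add: vec_to_complex_def complex_to_vec_def)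

lemma complex_to_vec_to_complex [simp]: "complex_to_vec (vec_to_complex v) = v"
  by (simp add: vec_to_complex_def complex_to_vec_def vec_eq_iff forall_2)

lemma cmod_vec_to_complex [simp]: "cmod (vec_to_complex v) = norm v"
  by (simp add: vec_to_complex_def cmod_def norm_vec_def L2_set_def sum_2)

lemma norm_complex_to_vec [simp]: "norm (complex_to_vec z) = cmod z"
  by (metis cmod_vec_to_complex vec_to_complex_to_vec)

lemma linear_vec_to_complex: "linear vec_to_complex"
  by (rule linearI) (simp_all add: vec_to_complex_def complex_eq_iff)

lemma linear_complex_to_vec: "linear complex_to_vec"
  by (rule linearI) (simp_all add: complex_to_vec_def vec_eq_iff forall_2)

lemma vec_to_complex_measurable [measurable]: "vec_to_complex \<in> borel_measurable borel"
  using linear_vec_to_complex linear_continuous_on linear_conv_bounded_linear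
  by (intro borel_measurable_continuous_onI) blast

lemma vimage_vec_to_complex_box:
  "vec_to_complex -` box l u = box (complex_to_vec l) (complex_to_vec u)"
  by (auto simp: mem_box_cart mem_box[of _ l] vec_to_complex_def complex_to_vec_def Basis_complex_def
      forall_2)

lemma lborel_complex_eq_distr: "(lborel :: complex measure) = distr lborel borel vec_to_complex"
proof (rule lborel_eqI)
  fix l u :: complex assume le: "\<And>b. b \<in> Basis \<Longrightarrow> l \<bullet> b \<le> u \<bullet> b"
  have le': "Re l \<le> Re u" "Im l \<le> Im u" using le[of 1] le[of \<i>] by (simp_all add: Basis_complex_def)
  have B2: "(Basis :: (real^2) set) = {axis 1 1, axis 2 1}"
    by (auto simp: Basis_vec_def UNIV_2)
  have ne: "axis 1 (1::real) \<noteq> (axis 2 1 :: real^2)" by (simp add: axis_eq_axis)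
  have "emeasure (distr lborel borel vec_to_complex) (box l u) =
      emeasure lborel (box (complex_to_vec l) (complex_to_vec u))"
    by (subst emeasure_distr) (auto simp: vimage_vec_to_complex_box)
  also have "\<dots> = (\<Prod>b\<in>Basis. (u - l) \<bullet> b)"
    using le' ne by (simp add: emeasure_lborel_box_eq B2 Basis_complex_def complex_to_vec_def inner_axis
        inner_complex_def)
  finally show "emeasure (distr lborel borel vec_to_complex) (box l u) = (\<Prod>b\<in>Basis. (u - l) \<bullet> b)" .
qed simp

text \<open>Comparing on boxes suffices. The preimage of a box under multiplication by
  \<open>a\<close> is, in \<open>real^2\<close>, the image of a box under the inverse rotation
  \<open>T\<close>, and \<open>measure_orthogonal_image\<close> applies to it.\<close>

lemma lborel_distr_rotation:
  fixes a :: complex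
  assumes a: "cmod a = 1"
  shows "distr lborel borel ((*) a) = lborel"
proof (rule lborel_eqI[symmetric])
  fix l u :: complex assume le: "\<And>b. b \<in> Basis \<Longrightarrow> l \<bullet> b \<le> u \<bullet> b"
  define T where "T v = complex_to_vec (cnj a * vec_to_complex v)" for v
  have aa: "a * cnj a = 1" "cnj a * a = 1"
    using a by (simp_all add: complex_norm_square[symmetric] mult.commute)
  have "linear T"
    unfolding T_def
    by (intro linear_compose[OF linear_vec_to_complex, unfolded o_def]
        linear_compose[OF _ linear_complex_to_vec, unfolded o_def] linear_times)
  then have T: "orthogonal_transformation T"
    by (simp add: orthogonal_transformation T_def norm_mult a)
  let ?B = "box (complex_to_vec l) (complex_to_vec u)"
  have eq: "vec_to_complex -` ((*) a -` box l u) = T ` ?B"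
  proof (intro set_eqI iffI)
    fix v assume "v \<in> vec_to_complex -` ((*) a -` box l u)"
    then have "complex_to_vec (a * vec_to_complex v) \<in> ?B"
      by (simp flip: vimage_vec_to_complex_box)
    moreover have "v = T (complex_to_vec (a * vec_to_complex v))"
      by (simp add: T_def aa mult.assoc[symmetric])
    ultimately show "v \<in> T ` ?B" by blast
  next
    fix v assume "v \<in> T ` ?B"
    then obtain w where w: "v = T w" "vec_to_complex w \<in> box l u"
      by (auto simp flip: vimage_vec_to_complex_box)
    then show "v \<in> vec_to_complex -` ((*) a -` box l u)"
      by (simp add: T_def aa mult.assoc[symmetric])
  qed
  have [measurable]: "(*) a \<in> borel_measurable borel"
    by (intro borel_measurable_continuous_onI continuous_intros)
  have meas: "vec_to_complex -` ((*) a -` box l u) \<in> sets borel"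
    using measurable_sets[of "\<lambda>v. a * vec_to_complex v" borel borel "box l u"]
    by (simp add: vimage_def)
  have "emeasure (distr lborel borel ((*) a)) (box l u) = emeasure lborel ((*) a -` box l u)"
    by (subst emeasure_distr) auto
  also have "\<dots> = emeasure lborel (vec_to_complex -` ((*) a -` box l u))"
    using measurable_sets[of "(*) a" borel borel "box l u"]
    by (subst lborel_complex_eq_distr, subst emeasure_distr) auto
  also have "\<dots> = emeasure lebesgue (T ` ?B)"
    using meas by (simp add: eq)
  also have "\<dots> = ennreal (measure lebesgue (T ` ?B))"
    by (intro emeasure_eq_measure2 measurable_orthogonal_image T) simp
  also have "measure lebesgue (T ` ?B) = measure lebesgue ?B"
    by (intro measure_orthogonal_image T) simp
  also have "ennreal (measure lebesgue ?B) = emeasure lborel ?B"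
    using emeasure_lborel_box_finite[of "complex_to_vec l" "complex_to_vec u"]
    by (subst emeasure_eq_ennreal_measure) auto
  also have "\<dots> = emeasure (distr lborel borel vec_to_complex) (box l u)"
    by (subst emeasure_distr) (auto simp: vimage_vec_to_complex_box)
  also have "\<dots> = (\<Prod>b\<in>Basis. (u - l) \<bullet> b)"
    using le by (simp flip: lborel_complex_eq_distr)
  finally show "emeasure (distr lborel borel ((*) a)) (box l u) = (\<Prod>b\<in>Basis. (u - l) \<bullet> b)" .
qed simp

section \<open>Area measure on the disk: rotations and the radial distribution\<close>

abbreviation lborel_disk :: "complex measure"
  where "lborel_disk \<equiv> restrict_space lborel unit_disk"

lemma lborel_disk_rotation:
  assumes a: "cmod a = 1"
  shows "distr lborel_disk lborel_disk ((*) a) = lborel_disk"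
proof (rule measure_eqI)
  have ms: "(*) a \<in> measurable lborel_disk lborel_disk"
    by (intro measurable_restrict_space3) (auto simp: norm_mult a)
  fix A assume "A \<in> sets (distr lborel_disk lborel_disk ((*) a))"
  then have A: "A \<in> sets borel" "A \<subseteq> unit_disk" by (auto simp: sets_restrict_space)
  have sub: "(*) a -` A \<subseteq> unit_disk"
  proof
    fix z assume "z \<in> (*) a -` A"
    then have "a * z \<in> unit_disk" using A by auto
    then show "z \<in> unit_disk" by (simp add: norm_mult a)
  qed
  have "emeasure (distr lborel_disk lborel_disk ((*) a)) A = emeasure lborel_disk ((*) a -` A \<inter> unit_disk)"
    using A by (subst emeasure_distr[OF ms]) (auto simp: sets_restrict_space space_restrict_space)
  also have "\<dots> = emeasure lborel ((*) a -` A)"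
    using sub by (subst emeasure_restrict_space) (auto simp: Int_absorb2)
  also have "\<dots> = emeasure (distr lborel borel ((*) a)) A"
    using A by (subst emeasure_distr) auto
  also have "\<dots> = emeasure lborel_disk A"
    using A by (simp add: lborel_distr_rotation[OF a] emeasure_restrict_space)
  finally show "emeasure (distr lborel_disk lborel_disk ((*) a)) A = emeasure lborel_disk A" .
qed simp

lemma emeasure_lborel_cball_complex: "0 \<le> \<rho> \<Longrightarrow> emeasure lborel (cball (z::complex) \<rho>) = ennreal (pi * \<rho>\<^sup>2)"
  by (simp add: emeasure_cball unit_ball_vol_2)

lemma emeasure_lborel_ball_complex: "0 \<le> \<rho> \<Longrightarrow> emeasure lborel (ball (z::complex) \<rho>) = ennreal (pi * \<rho>\<^sup>2)"
  by (simp add: emeasure_ball unit_ball_vol_2)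

text \<open>Polar coordinates for radial functions without a Jacobian: for \<open>x\<close> in
  \<open>{0..1}\<close> the part of the disk with \<open>(cmod w) ^ 2 \<le> x\<close> has area
  \<open>pi * x\<close>, linear in \<open>x\<close>, so the distribution has constant density.
  Half-lines generate the sigma-algebra.\<close>

lemma distr_lborel_disk_cmod_square:
  "distr lborel_disk borel (\<lambda>w. (cmod w)\<^sup>2) = density lborel (\<lambda>s. ennreal pi * indicator {0..1} s)"
    (is "?L = ?R")
proof (rule measure_eqI_generator_eq)
  let ?E = "range (\<lambda>x::real. {..x})"
  have ms: "(\<lambda>w. (cmod w)\<^sup>2) \<in> borel_measurable lborel_disk"
    by (intro measurable_restrict_space1) simp
  show "Int_stable ?E" by (auto simp: Int_stable_def)
  show "?E \<subseteq> Pow UNIV" "sets ?L = sigma_sets UNIV ?E" "sets ?R = sigma_sets UNIV ?E"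
    by (simp_all add: borel_eq_atMost)
  show "range (\<lambda>n::nat. {..real n}) \<subseteq> ?E" "(\<Union>i. {..real i}) = UNIV"
    by (auto simp: real_arch_simple)
  have eq: "emeasure ?L {..x} = ennreal pi * emeasure lborel ({..x} \<inter> {0..1})" for x
  proof -
    have "emeasure ?L {..x} = emeasure lborel_disk {w \<in> unit_disk. (cmod w)\<^sup>2 \<le> x}"
      by (subst emeasure_distr[OF ms]) (auto simp: space_restrict_space intro!: arg_cong2[where f=emeasure])
    also have "\<dots> = emeasure lborel {w \<in> unit_disk. (cmod w)\<^sup>2 \<le> x}"
      by (subst emeasure_restrict_space) auto
    also have "\<dots> = ennreal pi * emeasure lborel ({..x} \<inter> {0..1})"
    proof -
      consider "x < 0" | "0 \<le> x" "x < 1" | "1 \<le> x" by linarith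
      then show ?thesis
      proof cases
        case 1
        then have "{w \<in> unit_disk. (cmod w)\<^sup>2 \<le> x} = {}" "{..x} \<inter> {0..1} = {}"
          using zero_le_power2 by (auto simp: not_le intro: less_le_trans)
        then show ?thesis by (simp only: emeasure_empty mult_zero_right)
      next
        case 2
        have iff: "(cmod w)\<^sup>2 \<le> x \<longleftrightarrow> cmod w \<le> sqrt x" for w
          using real_sqrt_le_iff[of "(cmod w)\<^sup>2" x] by (simp del: real_sqrt_le_iff)
        have "sqrt x < 1" using 2 by simp
        then have "cmod w < 1 \<and> (cmod w)\<^sup>2 \<le> x \<longleftrightarrow> cmod w \<le> sqrt x" for w
          unfolding iff by linarith
        then have "{w \<in> unit_disk. (cmod w)\<^sup>2 \<le> x} = cball 0 (sqrt x)"
          by (intro set_eqI) simp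
        moreover have "{..x} \<inter> {0..1} = {0..x}" using 2 by auto
        ultimately show ?thesis using 2
          by (simp add: emeasure_lborel_cball_complex ennreal_mult)
      next
        case 3
        have "(cmod w)\<^sup>2 \<le> x" if "cmod w < 1" for w
          using that 3 power_le_one[of "cmod w" 2] by (simp add: order_trans)
        then have "{w \<in> unit_disk. (cmod w)\<^sup>2 \<le> x} = unit_disk" by (auto simp: dist_norm)
        moreover have "{..x} \<inter> {0..1} = {0..1}" using 3 by auto
        ultimately show ?thesis
          by (simp add: emeasure_lborel_ball_complex)
      qed
    qed
    finally show ?thesis .
  qed
  show "emeasure ?L X = emeasure ?R X" if in_E: "X \<in> ?E" for X
  proof -
    obtain x where X: "X = {..x}" using in_E by (elim rangeE)
    have "emeasure ?R {..x} = (\<integral>\<^sup>+s. ennreal pi * indicator ({..x} \<inter> {0..1}) s \<partial>lborel)"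
      by (subst emeasure_density) (auto intro!: nn_integral_cong simp: indicator_def)
    also have "\<dots> = ennreal pi * emeasure lborel ({..x} \<inter> {0..1})"
      by (subst nn_integral_cmult_indicator) auto
    finally show ?thesis by (simp add: X eq)
  qed
  show "emeasure ?L {..real i} \<noteq> \<infinity>" for i
  proof -
    have "emeasure lborel ({..real i} \<inter> {0..1}) \<le> emeasure lborel {0..1::real}"
      by (intro emeasure_mono) auto
    then have "emeasure lborel ({..real i} \<inter> {0..1}) < \<infinity>" by (rule le_less_trans) simp
    then show ?thesis unfolding eq by (simp add: ennreal_mult_eq_top_iff)
  qed
qed

section \<open>Moments of holomorphic functions against radial weights\<close>

lemma measurable_lborel_disk_continuous:
  "continuous_on unit_disk f \<Longrightarrow> f \<in> borel_measurable lborel_disk"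
  using borel_measurable_continuous_on_restrict[of unit_disk f]
  by (simp cong: measurable_cong_sets)

lemma borel_measurable_cnj [measurable]: "cnj \<in> borel_measurable borel"
  by (intro borel_measurable_continuous_onI continuous_intros)

lemma space_lborel_disk: "space lborel_disk = unit_disk"
  by (simp add: space_restrict_space)

lemma measurable_lborel_disk_borel: "f \<in> borel_measurable borel \<Longrightarrow> f \<in> borel_measurable lborel_disk"
  by (intro measurable_restrict_space1) simp

lemma finite_measure_lborel_disk: "finite_measure lborel_disk"
  by (rule finite_measureI) (simp add: space_lborel_disk emeasure_restrict_space emeasure_ball)

lemma integral_disk_radial:
  fixes \<phi> :: "real \<Rightarrow> real"
  assumes \<phi>[measurable]: "\<phi> \<in> borel_measurable borel"
  shows "(LINT w|lborel_disk. \<phi> ((cmod w)\<^sup>2)) = pi * (LINT s:{0..1}|lborel. \<phi> s)"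
proof -
  have ms: "(\<lambda>w. (cmod w)\<^sup>2) \<in> borel_measurable lborel_disk"
    by (intro measurable_lborel_disk_borel) simp
  have dens: "density lborel (\<lambda>s::real. ennreal pi * indicator {0..1} s) =
      density lborel (\<lambda>s. ennreal (pi * indicator {0..1} s))"
    by (intro density_cong) (auto simp: indicator_def)
  show ?thesis
    using integral_distr[OF ms \<phi>]
    by (simp add: distr_lborel_disk_cmod_square dens integral_density set_lebesgue_integral_def mult.assoc)
qed

lemma nn_integral_disk_radial:
  fixes \<phi> :: "real \<Rightarrow> ennreal"
  assumes \<phi>[measurable]: "\<phi> \<in> borel_measurable borel"
  shows "(\<integral>\<^sup>+w. \<phi> ((cmod w)\<^sup>2) \<partial>lborel_disk) = ennreal pi * (\<integral>\<^sup>+s\<in>{0..1}. \<phi> s \<partial>lborel)"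
proof -
  have ms: "(\<lambda>w. (cmod w)\<^sup>2) \<in> borel_measurable lborel_disk"
    by (intro measurable_lborel_disk_borel) simp
  have "(\<integral>\<^sup>+w. \<phi> ((cmod w)\<^sup>2) \<partial>lborel_disk) =
      (\<integral>\<^sup>+s. \<phi> s \<partial>density lborel (\<lambda>s. ennreal pi * indicator {0..1} s))"
    using nn_integral_distr[OF ms, of \<phi>] by (simp add: distr_lborel_disk_cmod_square)
  also have "\<dots> = (\<integral>\<^sup>+s. ennreal pi * (\<phi> s * indicator {0..1} s) \<partial>lborel)"
    by (subst nn_integral_density) (auto intro!: nn_integral_cong simp: mult_ac)
  also have "\<dots> = ennreal pi * (\<integral>\<^sup>+s\<in>{0..1}. \<phi> s \<partial>lborel)"
    by (subst nn_integral_cmult) auto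
  finally show ?thesis .
qed

lemma integral_disk_power:
  shows "(LINT w|lborel_disk. (1 - (cmod w)\<^sup>2) ^ m * ((cmod w)\<^sup>2) ^ n) = pi * (fact n * fact m / fact (n + m + 1))"
proof -
  have "((\<lambda>s. s powr real n * (1 - s) powr real m) has_integral Beta (real n + 1) (real m + 1)) {0..1}"
    using has_integral_Beta_real[of "real n + 1" "real m + 1"] by simp
  \<comment> \<open>Ordinary powers replace \<open>powr\<close> off the endpoints; there they can
    differ, as \<open>0 powr 0 = 0\<close> but \<open>0 ^ 0 = 1\<close>.\<close>
  then have "((\<lambda>s. (1 - s) ^ m * s ^ n) has_integral Beta (real n + 1) (real m + 1)) {0..1::real}"
    by (rule has_integral_spike[of "{0,1}", rotated 2]) (auto simp: powr_realpow)
  moreover have "Beta (real n + 1) (real m + 1) = fact n * fact m / fact (n + m + 1)"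
    using Gamma_fact[of n, where ?'a = real] Gamma_fact[of m, where ?'a = real]
      Gamma_fact[of "n + m + 1", where ?'a = real]
    by (simp add: Beta_def add_ac)
  moreover have "set_integrable lborel {0..1} (\<lambda>s::real. (1 - s) ^ m * s ^ n)"
    by (intro borel_integrable_atLeastAtMost' continuous_intros)
  ultimately have "(LINT s:{0..1}|lborel. (1 - s) ^ m * s ^ n) = (fact n * fact m / fact (n + m + 1) :: real)"
    using set_borel_integral_eq_integral(2) by (metis integral_unique)
  then show ?thesis
    using integral_disk_radial[of "\<lambda>s. (1 - s) ^ m * s ^ n"] by simp
qed

text \<open>Rotation by the unimodular \<open>a\<close> multiplies the integrand by
  \<open>a ^ i * cnj a ^ j\<close> and preserves the integral; the angle \<open>pi / (i - j)\<close>
  makes this factor \<open>-1\<close>.\<close>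

lemma integral_disk_monomials_eq_0:
  fixes \<phi> :: "real \<Rightarrow> real"
  assumes "i \<noteq> j"
  shows "(LINT w|lborel_disk. of_real (\<phi> ((cmod w)\<^sup>2)) * (w ^ i * cnj w ^ j)) = 0"
proof (cases "(\<lambda>w. of_real (\<phi> ((cmod w)\<^sup>2)) * (w ^ i * cnj w ^ j)) \<in> borel_measurable lborel_disk")
  case True
  let ?f = "\<lambda>w. of_real (\<phi> ((cmod w)\<^sup>2)) * (w ^ i * cnj w ^ j) :: complex"
  define d where "d = real i - real j"
  define a where "a = cis (pi / d)"
  have d: "d \<noteq> 0" using assms by (simp add: d_def)
  have a: "cmod a = 1" by (simp add: a_def)
  have "real i * (pi / d) + real j * - (pi / d) = pi"
  proof -
    have "real i * (pi / d) + real j * - (pi / d) = (real i - real j) * (pi / d)"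
      by (simp add: left_diff_distrib diff_divide_distrib)
    then show ?thesis using d by (simp flip: d_def)
  qed
  then have "a ^ i * cnj a ^ j = -1"
    by (simp add: a_def cis_cnj Complex.DeMoivre cis_mult)
  moreover have "(a * w) ^ i * cnj (a * w) ^ j = (a ^ i * cnj a ^ j) * (w ^ i * cnj w ^ j)" for w
    by (simp add: power_mult_distrib mult_ac)
  ultimately have rot: "?f (a * w) = - ?f w" for w
    by (simp add: norm_mult a)
  have ms: "(*) a \<in> measurable lborel_disk lborel_disk"
    by (intro measurable_restrict_space3) (auto simp: norm_mult a)
  have "integral\<^sup>L lborel_disk ?f = integral\<^sup>L (distr lborel_disk lborel_disk ((*) a)) ?f"
    by (simp only: lborel_disk_rotation[OF a])
  also have "\<dots> = (LINT w|lborel_disk. ?f (a * w))"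
    by (rule integral_distr[OF ms True])
  also have "\<dots> = - integral\<^sup>L lborel_disk ?f" by (simp only: rot integral_minus)
  finally show ?thesis by simp
next
  case False
  \<comment> \<open>A function that is not measurable is not integrable, and its integral is 0 by
    convention.\<close>
  then show ?thesis using not_integrable_integral_eq borel_measurable_integrable by blast
qed

text \<open>The power series of \<open>h\<close> need not converge uniformly on the disk, so termwise integration is
  applied to the dilates \<open>h (\<rho> * w)\<close>; the monotone majorant \<open>B\<close> dominates them all as \<open>\<rho>\<close> tends to 1.\<close>

lemma integral_disk_cnj_power_mult:
  fixes h :: "complex \<Rightarrow> complex" and \<phi> B :: "real \<Rightarrow> real"
  assumes h: "h holomorphic_on unit_disk"
    and \<phi>[measurable]: "\<phi> \<in> borel_measurable borel"
    and int: "integrable lborel_disk (\<lambda>w. \<phi> ((cmod w)\<^sup>2))"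
    and B: "\<And>w. w \<in> unit_disk \<Longrightarrow> cmod (h w) \<le> B (cmod w)"
    and B_mono: "\<And>x y. 0 \<le> x \<Longrightarrow> x \<le> y \<Longrightarrow> y < 1 \<Longrightarrow> B x \<le> B y"
    and intB: "integrable lborel_disk (\<lambda>w. \<phi> ((cmod w)\<^sup>2) * B (cmod w))"
  shows "(LINT w|lborel_disk. of_real (\<phi> ((cmod w)\<^sup>2)) * (cnj w ^ j * h w)) =
    (deriv ^^ j) h 0 / fact j * of_real (LINT w|lborel_disk. \<phi> ((cmod w)\<^sup>2) * ((cmod w)\<^sup>2) ^ j)"
proof -
  define c where "c n = (deriv ^^ n) h 0 / fact n" for n
  define I :: complex where "I = of_real (LINT w|lborel_disk. \<phi> ((cmod w)\<^sup>2) * ((cmod w)\<^sup>2) ^ j)"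
  let ?F = "\<lambda>w. of_real (\<phi> ((cmod w)\<^sup>2)) * (cnj w ^ j * h w)"
  let ?G = "\<lambda>n w. of_real (\<phi> ((cmod w)\<^sup>2)) * (w ^ n * cnj w ^ j)"
  have sums: "(\<lambda>n. c n * w ^ n) sums h w" if "w \<in> unit_disk" for w
    using holomorphic_power_series[OF h that] by (simp add: c_def)
  have msG: "?G n \<in> borel_measurable lborel_disk" for n
    by (intro measurable_lborel_disk_borel) measurable
  have le1: "cmod (w ^ n) \<le> 1" "cmod (cnj w ^ n) \<le> 1" if "w \<in> unit_disk" for w n
    using that by (auto simp: norm_power intro!: power_le_one)
  have bdG: "cmod (?G n w) \<le> \<bar>\<phi> ((cmod w)\<^sup>2)\<bar>" if "w \<in> unit_disk" for n w
  proof -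
    have "cmod (w ^ n) * cmod (cnj w ^ j) \<le> 1 * 1"
      using le1[OF that] by (intro mult_mono) auto
    then show ?thesis
      using mult_left_mono[of "cmod (w ^ n) * cmod (cnj w ^ j)" 1 "\<bar>\<phi> ((cmod w)\<^sup>2)\<bar>"]
      by (simp add: norm_mult)
  qed
  have intG: "integrable lborel_disk (?G n)" for n
    by (rule Bochner_Integration.integrable_bound[OF integrable_abs[OF int] msG])
      (use bdG in \<open>auto simp: space_lborel_disk intro!: AE_I2\<close>)
  have G_j: "integral\<^sup>L lborel_disk (?G n) = (if n = j then I else 0)" for n
  proof (cases "n = j")
    case True
    have "?G j w = of_real (\<phi> ((cmod w)\<^sup>2) * ((cmod w)\<^sup>2) ^ j)" for w
      by (metis complex_norm_square of_real_mult of_real_power power_mult_distrib)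
    then show ?thesis using True unfolding I_def by (simp only: integral_complex_of_real simp_thms if_True)
  next
    case False
    then show ?thesis by (simp add: integral_disk_monomials_eq_0)
  qed
  have dilate: "(LINT w|lborel_disk. of_real (\<phi> ((cmod w)\<^sup>2)) * (cnj w ^ j * h (of_real \<rho> * w))) =
      c j * of_real \<rho> ^ j * I" if \<rho>: "0 \<le> \<rho>" "\<rho> < 1" for \<rho>
  proof -
    let ?T = "\<lambda>n w. (c n * of_real \<rho> ^ n) * ?G n w"
    \<comment> \<open>The power series converges at the larger point \<open>(1 + \<rho>) / 2\<close>
      of the disk, hence absolutely at \<open>\<rho>\<close>. Up to the factor
      \<open>\<bar>\<phi>\<bar>\<close> this one series majorises the terms \<open>?T n w\<close>
      for all \<open>w\<close>.\<close>
    have summ: "summable (\<lambda>n. cmod (c n * of_real \<rho> ^ n))"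
    proof (rule powser_insidea)
      show "summable (\<lambda>n. c n * of_real ((1 + \<rho>) / 2) ^ n)"
        by (rule sums_summable, rule sums) (use \<rho> in \<open>simp del: of_real_divide of_real_add\<close>)
      show "cmod (of_real \<rho>) < cmod (of_real ((1 + \<rho>) / 2))"
        unfolding norm_of_real using \<rho> by simp
    qed
    have bdT: "cmod (?T n w) \<le> cmod (c n * of_real \<rho> ^ n) * \<bar>\<phi> ((cmod w)\<^sup>2)\<bar>" if "w \<in> unit_disk" for n w
      by (subst norm_mult) (rule mult_left_mono[OF bdG[OF that] norm_ge_zero])
    have "(LINT w|lborel_disk. (\<Sum>n. ?T n w)) = (\<Sum>n. integral\<^sup>L lborel_disk (?T n))"
    proof (rule integral_suminf)
      show "integrable lborel_disk (?T n)" for n using intG by simp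
      show "AE w in lborel_disk. summable (\<lambda>n. cmod (?T n w))"
      proof (intro AE_I2)
        fix w assume "w \<in> space lborel_disk"
        then have w: "w \<in> unit_disk" by (simp add: space_lborel_disk)
        show "summable (\<lambda>n. cmod (?T n w))"
          using bdT[OF w] by (intro summable_comparison_test'[OF summable_mult2[OF summ]]) auto
      qed
      show "summable (\<lambda>n. LINT w|lborel_disk. cmod (?T n w))"
      proof (rule summable_comparison_test'[OF summable_mult2[OF summ]])
        fix n
        have "(LINT w|lborel_disk. cmod (?T n w)) \<le>
            (LINT w|lborel_disk. cmod (c n * of_real \<rho> ^ n) * \<bar>\<phi> ((cmod w)\<^sup>2)\<bar>)"
          using intG int bdT by (intro integral_mono) (auto simp: space_lborel_disk)
        then show "norm (LINT w|lborel_disk. cmod (?T n w)) \<le>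
            cmod (c n * of_real \<rho> ^ n) * (LINT w|lborel_disk. \<bar>\<phi> ((cmod w)\<^sup>2)\<bar>)"
          by (simp add: integral_nonneg_AE)
      qed
    qed
    also have "\<dots> = (\<Sum>n. if n = j then c n * of_real \<rho> ^ n * I else 0)"
      by (intro suminf_cong) (simp add: G_j)
    also have "\<dots> = c j * of_real \<rho> ^ j * I"
      using sums_unique[OF sums_single[of j "\<lambda>n. c n * of_real \<rho> ^ n * I"]] by simp
    also have "(LINT w|lborel_disk. (\<Sum>n. ?T n w)) =
        (LINT w|lborel_disk. of_real (\<phi> ((cmod w)\<^sup>2)) * (cnj w ^ j * h (of_real \<rho> * w)))"
    proof (intro Bochner_Integration.integral_cong refl)
      fix w assume "w \<in> space lborel_disk"
      then have "cmod w < 1" by (simp add: space_lborel_disk)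
      moreover have "\<rho> * cmod w \<le> 1 * cmod w" using \<rho> by (intro mult_right_mono) auto
      ultimately have "\<rho> * cmod w < 1" by simp
      then have "of_real \<rho> * w \<in> unit_disk" using \<rho> by (simp add: norm_mult)
      from sums_mult[OF sums[OF this], of "of_real (\<phi> ((cmod w)\<^sup>2)) * cnj w ^ j"]
      have "(\<lambda>n. ?T n w) sums (of_real (\<phi> ((cmod w)\<^sup>2)) * (cnj w ^ j * h (of_real \<rho> * w)))"
        by (simp add: power_mult_distrib mult_ac)
      then show "(\<Sum>n. ?T n w) = of_real (\<phi> ((cmod w)\<^sup>2)) * (cnj w ^ j * h (of_real \<rho> * w))"
        by (rule sums_unique[symmetric])
    qed
    finally show ?thesis .
  qed
  define \<rho> where "\<rho> k = real k / real (Suc k)" for k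
  have \<rho>: "0 \<le> \<rho> k" "\<rho> k < 1" for k by (simp_all add: \<rho>_def)
  have \<rho>_lim: "\<rho> \<longlonglongrightarrow> 1" unfolding \<rho>_def by (rule LIMSEQ_n_over_Suc_n)
  have cont: "continuous_on unit_disk h" using h by (rule holomorphic_on_imp_continuous_on)
  have in_disk: "of_real (\<rho> k) * w \<in> unit_disk" "cmod (of_real (\<rho> k) * w) \<le> cmod w"
    if "w \<in> unit_disk" for w k
  proof -
    have "\<rho> k * cmod w \<le> cmod w" using \<rho>[of k] by (simp add: mult_left_le_one_le)
    then show "of_real (\<rho> k) * w \<in> unit_disk" "cmod (of_real (\<rho> k) * w) \<le> cmod w"
      using that \<rho>[of k] by (simp_all add: norm_mult)
  qed
  have "(\<lambda>k. LINT w|lborel_disk. of_real (\<phi> ((cmod w)\<^sup>2)) * (cnj w ^ j * h (of_real (\<rho> k) * w)))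
      \<longlonglongrightarrow> integral\<^sup>L lborel_disk ?F"
  proof (rule integral_dominated_convergence)
    have ms: "(\<lambda>w. of_real (\<phi> ((cmod w)\<^sup>2)) :: complex) \<in> borel_measurable lborel_disk"
      "(\<lambda>w. cnj w ^ j) \<in> borel_measurable lborel_disk"
      by (intro measurable_lborel_disk_borel; measurable)+
    show "?F \<in> borel_measurable lborel_disk"
      by (intro borel_measurable_times ms measurable_lborel_disk_continuous cont)
    show "(\<lambda>w. of_real (\<phi> ((cmod w)\<^sup>2)) * (cnj w ^ j * h (of_real (\<rho> k) * w))) \<in> borel_measurable lborel_disk" for k
      by (intro borel_measurable_times ms measurable_lborel_disk_continuous
          continuous_on_compose2[OF cont] continuous_intros) (use in_disk in auto)
    show "integrable lborel_disk (\<lambda>w. \<bar>\<phi> ((cmod w)\<^sup>2) * B (cmod w)\<bar>)" using intB by simp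
    show "AE w in lborel_disk. cmod (of_real (\<phi> ((cmod w)\<^sup>2)) * (cnj w ^ j * h (of_real (\<rho> k) * w)))
        \<le> \<bar>\<phi> ((cmod w)\<^sup>2) * B (cmod w)\<bar>" for k
    proof (intro AE_I2)
      fix w assume "w \<in> space lborel_disk"
      then have w: "w \<in> unit_disk" by (simp add: space_lborel_disk)
      have "cmod (h (of_real (\<rho> k) * w)) \<le> B (cmod (of_real (\<rho> k) * w))"
        by (rule B[OF in_disk(1)[OF w]])
      also have "\<dots> \<le> B (cmod w)" using w in_disk[OF w, of k] by (intro B_mono) auto
      finally have "cmod (cnj w ^ j) * cmod (h (of_real (\<rho> k) * w)) \<le> 1 * B (cmod w)"
        using le1(2)[OF w, of j] by (intro mult_mono) auto
      moreover have "B (cmod w) \<le> \<bar>B (cmod w)\<bar>" by simp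
      ultimately show "cmod (of_real (\<phi> ((cmod w)\<^sup>2)) * (cnj w ^ j * h (of_real (\<rho> k) * w)))
          \<le> \<bar>\<phi> ((cmod w)\<^sup>2) * B (cmod w)\<bar>"
        unfolding norm_mult abs_mult norm_of_real by (intro mult_left_mono) auto
    qed
    show "AE w in lborel_disk. (\<lambda>k. of_real (\<phi> ((cmod w)\<^sup>2)) * (cnj w ^ j * h (of_real (\<rho> k) * w))) \<longlonglongrightarrow> ?F w"
    proof (intro AE_I2 tendsto_mult tendsto_const)
      fix w assume "w \<in> space lborel_disk"
      then have w: "w \<in> unit_disk" by (simp add: space_lborel_disk)
      have "(\<lambda>k. of_real (\<rho> k) * w) \<longlonglongrightarrow> of_real 1 * w"
        by (intro tendsto_intros \<rho>_lim)
      then have "(\<lambda>k. of_real (\<rho> k) * w) \<longlonglongrightarrow> w" by simp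
      then show "(\<lambda>k. h (of_real (\<rho> k) * w)) \<longlonglongrightarrow> h w"
        by (rule continuous_on_tendsto_compose[OF cont _ w]) (intro always_eventually allI in_disk(1)[OF w])
    qed
  qed
  moreover have "(\<lambda>k. LINT w|lborel_disk. of_real (\<phi> ((cmod w)\<^sup>2)) * (cnj w ^ j * h (of_real (\<rho> k) * w)))
      \<longlonglongrightarrow> c j * of_real 1 ^ j * I"
    unfolding dilate[OF \<rho>] by (intro tendsto_intros \<rho>_lim)
  ultimately have "integral\<^sup>L lborel_disk ?F = c j * of_real 1 ^ j * I"
    by (rule LIMSEQ_unique)
  then show ?thesis by (simp add: c_def I_def)
qed

section \<open>The Forelli--Rudin estimate\<close>

text \<open>The radial integral is \<open>Beta 1 (a + 1) = 1 / (a + 1)\<close>. The exponent that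
  matters later is \<open>a = t - 2\<close>, for which \<open>a > -1\<close> says
  \<open>t > 1\<close>.\<close>

lemma nn_integral_disk_weight:
  assumes a: "a > -1"
  shows "(\<integral>\<^sup>+w. ennreal ((1 - (cmod w)\<^sup>2) powr a) \<partial>lborel_disk) = ennreal (pi / (a + 1))"
proof -
  have "((\<lambda>s. s powr 0 * (1 - s) powr a) has_integral Beta 1 (a + 1)) {0..1}"
    using has_integral_Beta_real[of 1 "a + 1"] a by simp
  then have int: "((\<lambda>s. (1 - s) powr a) has_integral Beta 1 (a + 1)) {0..1::real}"
    by (rule has_integral_spike[of "{0}", rotated 2]) auto
  have "Gamma (a + 1 + 1) = (a + 1) * Gamma (a + 1)"
    using a by (intro Gamma_plus1) (auto elim!: nonpos_Ints_cases)
  moreover have "Gamma (a + 1) > 0" using a by (intro Gamma_real_pos) simp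
  ultimately have "Beta 1 (a + 1) = 1 / (a + 1)"
    by (simp add: Beta_def add_ac)
  then have "(\<integral>\<^sup>+s\<in>{0..1}. ennreal ((1 - s) powr a) \<partial>lborel) = ennreal (1 / (a + 1))"
    using nn_integral_has_integral_lebesgue[OF _ int] by (simp add: ennreal_mult' ennreal_indicator mult_ac)
  then show ?thesis
    using nn_integral_disk_radial[of "\<lambda>s. ennreal ((1 - s) powr a)"] a
    by (simp flip: ennreal_mult)
qed

lemma integrable_disk_weight:
  assumes "a > -1"
  shows "integrable lborel_disk (\<lambda>w. (1 - (cmod w)\<^sup>2) powr a)"
  using nn_integral_disk_weight[OF assms]
  by (intro integrableI_nonneg measurable_lborel_disk_borel) auto

text \<open>The integral is split at \<open>s = x\<close>. For \<open>s \<le> x\<close> the estimate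
  \<open>1 - s \<le> 1 - x * s\<close> leaves an elementary integral, at most
  \<open>1 / (k - t)\<close> times \<open>(1 - x) powr (t - k)\<close>; for \<open>s > x\<close> the
  estimate \<open>1 - x \<le> 1 - x * s\<close> leaves a constant on an interval of length
  \<open>1 - x\<close>.\<close>

lemma nn_integral_weight_bound:
  fixes t x :: real
  assumes t: "t > 1" and k: "real k > t" and x: "0 \<le> x" "x < 1"
  shows "(\<integral>\<^sup>+s\<in>{0..1}. ennreal ((1 - s) powr (t - 1) / (1 - x * s) ^ k) \<partial>lborel)
    \<le> ennreal ((1 + 1 / (real k - t)) * (1 - x) powr (t - real k))"
proof -
  let ?A = "\<lambda>s::real. ennreal ((1 - s) powr (t - 1 - real k)) * indicator {0..x} s"
  let ?B = "\<lambda>s::real. ennreal ((1 - x) powr (t - 1 - real k)) * indicator {x..1} s"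
  have le: "ennreal ((1 - s) powr (t - 1) / (1 - x * s) ^ k) * indicator {0..1} s \<le> ?A s + ?B s" for s
  proof (cases "s \<in> {0..1}")
    case True
    then have xs: "x * s \<le> x" "x * s \<le> s" using x by (auto simp: mult_left_le mult_left_le_one_le)
    show ?thesis
    proof (cases "s \<le> x")
      case True
      have "(1 - s) powr (t - 1) / (1 - x * s) ^ k \<le> (1 - s) powr (t - 1) / (1 - s) ^ k"
        using xs x True by (intro divide_left_mono power_mono mult_pos_pos zero_less_power) auto
      also have "\<dots> = (1 - s) powr (t - 1 - real k)"
        using True x by (simp add: powr_diff powr_realpow)
      finally show ?thesis
        using True \<open>s \<in> {0..1}\<close> by (simp add: ennreal_leI add_increasing2)
    next
      case False
      have "(1 - s) powr (t - 1) / (1 - x * s) ^ k \<le> (1 - x) powr (t - 1) / (1 - x) ^ k"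
        using xs x False \<open>s \<in> {0..1}\<close> t
        by (intro frac_le powr_mono2 power_mono zero_less_power) auto
      also have "\<dots> = (1 - x) powr (t - 1 - real k)"
        using x by (simp add: powr_diff powr_realpow)
      finally show ?thesis
        using False \<open>s \<in> {0..1}\<close> by (simp add: ennreal_leI)
    qed
  qed simp
  have "(\<integral>\<^sup>+s. ?A s \<partial>lborel) =
      ennreal ((1 - x) powr (t - real k) / (real k - t) - (1 - 0) powr (t - real k) / (real k - t))"
  proof (rule nn_integral_FTC_Icc[where F = "\<lambda>s. (1 - s) powr (t - real k) / (real k - t)"])
    fix s assume "s \<in> {0..x}"
    then have "s < 1" using x by simp
    show "((\<lambda>s. (1 - s) powr (t - real k) / (real k - t)) has_real_derivative (1 - s) powr (t - 1 - real k)) (at s)"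
    proof (rule DERIV_cong)
      show "((\<lambda>s. (1 - s) powr (t - real k) / (real k - t)) has_real_derivative
          (t - real k) * (1 - s) powr (t - real k - 1) * (-1) / (real k - t)) (at s)"
        using \<open>s < 1\<close> k by (auto intro!: derivative_eq_intros)
      have "(t - real k) * (1 - s) powr (t - real k - 1) * (-1) = (real k - t) * (1 - s) powr (t - 1 - real k)"
        by (simp add: algebra_simps)
      then show "(t - real k) * (1 - s) powr (t - real k - 1) * (-1) / (real k - t) = (1 - s) powr (t - 1 - real k)"
        using k by simp
    qed
  qed (use x in auto)
  also have "\<dots> \<le> ennreal (1 / (real k - t) * (1 - x) powr (t - real k))"
    using k by (intro ennreal_leI) simp
  finally have A: "(\<integral>\<^sup>+s. ?A s \<partial>lborel) \<le> ennreal (1 / (real k - t) * (1 - x) powr (t - real k))" .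
  have "(1 - x) powr (t - real k) = (1 - x) powr (t - 1 - real k) * (1 - x) powr 1"
    unfolding powr_add[symmetric] by simp
  then have B: "(\<integral>\<^sup>+s. ?B s \<partial>lborel) = ennreal ((1 - x) powr (t - real k))"
    using x by (subst nn_integral_cmult_indicator) (auto simp flip: ennreal_mult)
  have "(\<integral>\<^sup>+s\<in>{0..1}. ennreal ((1 - s) powr (t - 1) / (1 - x * s) ^ k) \<partial>lborel) \<le> (\<integral>\<^sup>+s. ?A s + ?B s \<partial>lborel)"
    by (intro nn_integral_mono le)
  also have "\<dots> = (\<integral>\<^sup>+s. ?A s \<partial>lborel) + (\<integral>\<^sup>+s. ?B s \<partial>lborel)"
    by (intro nn_integral_add) auto
  also have "\<dots> \<le> ennreal (1 / (real k - t) * (1 - x) powr (t - real k)) + ennreal ((1 - x) powr (t - real k))"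
    using A B by (intro add_mono) auto
  also have "\<dots> = ennreal ((1 + 1 / (real k - t)) * (1 - x) powr (t - real k))"
    using k by (subst ennreal_plus[symmetric]) (auto simp: algebra_simps)
  finally show ?thesis .
qed

section \<open>Kernel estimates and the Poisson kernel\<close>

lemma cmod_one_minus_cnj_commute: "cmod (1 - cnj z * w) = cmod (1 - z * cnj w)"
  by (metis complex_cnj_cnj complex_cnj_diff complex_cnj_mult complex_cnj_one complex_mod_cnj)

lemma cmod_one_minus_ge: "cmod z < 1 \<Longrightarrow> 1 - cmod w \<le> cmod (1 - z * cnj w)"
proof -
  assume z: "cmod z < 1"
  have "cmod z * cmod w \<le> 1 * cmod w" using z by (intro mult_right_mono) auto
  then show ?thesis
    using norm_triangle_ineq2[of 1 "z * cnj w"] by (simp add: norm_mult)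
qed

lemma one_minus_mult_cnj_nonzero:
  "z \<in> unit_disk \<Longrightarrow> w \<in> unit_disk \<Longrightarrow> 1 - z * cnj w \<noteq> 0"
  using cmod_one_minus_ge[of z w] by auto

lemma cmod_one_minus_mult_cnj_ge:
  "w \<in> unit_disk \<Longrightarrow> 1 - cmod z \<le> cmod (1 - z * cnj w)"
  using cmod_one_minus_ge[of w z] cmod_one_minus_cnj_commute[of w z] by (simp add: mult.commute)

lemma Re_Cayley:
  fixes u :: complex
  assumes "u \<noteq> 1"
  shows "Re ((1 + u) / (1 - u)) = (1 - (cmod u)\<^sup>2) / (cmod (1 - u))\<^sup>2"
proof -
  have "(1 + u) / (1 - u) = (1 + u) * cnj (1 - u) / of_real ((cmod (1 - u))\<^sup>2)"
    by (rule complex_div_cnj)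
  then have "Re ((1 + u) / (1 - u)) = Re ((1 + u) * cnj (1 - u)) / (cmod (1 - u))\<^sup>2"
    by (simp only: Re_divide_of_real)
  also have "Re ((1 + u) * cnj (1 - u)) = 1 - (cmod u)\<^sup>2"
    unfolding cmod_power2 by (simp add: algebra_simps power2_eq_square)
  finally show ?thesis .
qed

text \<open>The Poisson kernel is the real part of \<open>H\<close>, a Cayley transform that is
  holomorphic and bounded in \<open>w\<close> with \<open>H 0 = 1\<close>. The mean value property
  against a radial weight is \<open>integral_disk_cnj_power_mult\<close> with \<open>j = 0\<close>
  and a constant majorant.\<close>

lemma integral_disk_Poisson:
  fixes \<phi> :: "real \<Rightarrow> real" and z :: complex
  assumes z: "z \<in> unit_disk" and \<phi>[measurable]: "\<phi> \<in> borel_measurable borel"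
    and int: "integrable lborel_disk (\<lambda>w. \<phi> ((cmod w)\<^sup>2))"
  shows "integrable lborel_disk (\<lambda>w. \<phi> ((cmod w)\<^sup>2) * ((1 - (cmod (z * w))\<^sup>2) / (cmod (1 - z * cnj w))\<^sup>2))"
    and "(LINT w|lborel_disk. \<phi> ((cmod w)\<^sup>2) * ((1 - (cmod (z * w))\<^sup>2) / (cmod (1 - z * cnj w))\<^sup>2)) =
      (LINT w|lborel_disk. \<phi> ((cmod w)\<^sup>2))"
proof -
  define H where "H w = (1 + cnj z * w) / (1 - cnj z * w)" for w
  have less: "cmod (cnj z * w) < 1" if "w \<in> unit_disk" for w
    using z that mult_strict_mono'[of "cmod z" 1 "cmod w" 1] by (simp add: norm_mult)
  have ne: "1 - cnj z * w \<noteq> 0" if "w \<in> unit_disk" for w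
    using less[OF that] by auto
  have hol: "H holomorphic_on unit_disk"
    unfolding H_def using ne by (intro holomorphic_intros) auto
  have bd: "cmod (H w) \<le> 2 / (1 - cmod z)" if w: "w \<in> unit_disk" for w
  proof -
    have "1 - cmod z \<le> cmod (1 - cnj z * w)"
      using cmod_one_minus_ge[of w z] w by (simp add: mult.commute cmod_one_minus_cnj_commute)
    moreover have "cmod (1 + cnj z * w) \<le> 2"
      using norm_triangle_ineq[of 1 "cnj z * w"] less[OF w] by simp
    ultimately show ?thesis using z by (auto simp: H_def norm_divide intro!: frac_le)
  qed
  have ReH: "Re (H w) = (1 - (cmod (z * w))\<^sup>2) / (cmod (1 - z * cnj w))\<^sup>2" if "w \<in> unit_disk" for w
    using Re_Cayley[of "cnj z * w"] ne[OF that]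
    by (simp add: H_def cmod_one_minus_cnj_commute norm_mult)
  have ms: "(\<lambda>w. of_real (\<phi> ((cmod w)\<^sup>2)) * H w) \<in> borel_measurable lborel_disk"
    by (intro borel_measurable_times measurable_lborel_disk_borel measurable_lborel_disk_continuous
        holomorphic_on_imp_continuous_on hol) measurable
  have intH: "integrable lborel_disk (\<lambda>w. of_real (\<phi> ((cmod w)\<^sup>2)) * H w)"
  proof (rule Bochner_Integration.integrable_bound[OF _ ms])
    show "integrable lborel_disk (\<lambda>w. \<bar>\<phi> ((cmod w)\<^sup>2)\<bar> * (2 / (1 - cmod z)))"
      using int by (intro integrable_mult_left integrable_abs)
    show "AE w in lborel_disk. cmod (of_real (\<phi> ((cmod w)\<^sup>2)) * H w)
        \<le> norm (\<bar>\<phi> ((cmod w)\<^sup>2)\<bar> * (2 / (1 - cmod z)))"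
    proof (intro AE_I2)
      fix w assume "w \<in> space lborel_disk"
      then have "cmod (H w) \<le> 2 / (1 - cmod z)" by (intro bd) (simp add: space_lborel_disk)
      also have "\<dots> \<le> \<bar>2 / (1 - cmod z)\<bar>" by (rule abs_ge_self)
      finally show "cmod (of_real (\<phi> ((cmod w)\<^sup>2)) * H w)
        \<le> norm (\<bar>\<phi> ((cmod w)\<^sup>2)\<bar> * (2 / (1 - cmod z)))"
        unfolding norm_mult norm_of_real real_norm_def abs_mult abs_abs by (rule mult_left_mono) simp
    qed
  qed
  have eq: "(LINT w|lborel_disk. of_real (\<phi> ((cmod w)\<^sup>2)) * H w) = of_real (LINT w|lborel_disk. \<phi> ((cmod w)\<^sup>2))"
    using integral_disk_cnj_power_mult[OF hol \<phi> int, of "\<lambda>_. 2 / (1 - cmod z)" 0] bd int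
    by (simp add: H_def)
  have re: "Re (of_real (\<phi> ((cmod w)\<^sup>2)) * H w) =
      \<phi> ((cmod w)\<^sup>2) * ((1 - (cmod (z * w))\<^sup>2) / (cmod (1 - z * cnj w))\<^sup>2)" if "w \<in> unit_disk" for w
    using ReH[OF that] by simp
  show "integrable lborel_disk (\<lambda>w. \<phi> ((cmod w)\<^sup>2) * ((1 - (cmod (z * w))\<^sup>2) / (cmod (1 - z * cnj w))\<^sup>2))"
    using integrable_Re[OF intH]
    by (rule iffD1[OF Bochner_Integration.integrable_cong[OF refl], rotated])
      (use re in \<open>simp add: space_lborel_disk\<close>)
  have "(LINT w|lborel_disk. \<phi> ((cmod w)\<^sup>2) * ((1 - (cmod (z * w))\<^sup>2) / (cmod (1 - z * cnj w))\<^sup>2)) =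
      (LINT w|lborel_disk. Re (of_real (\<phi> ((cmod w)\<^sup>2)) * H w))"
    using re by (intro Bochner_Integration.integral_cong) (auto simp: space_lborel_disk)
  also have "\<dots> = Re (LINT w|lborel_disk. of_real (\<phi> ((cmod w)\<^sup>2)) * H w)"
    by (rule integral_Re[OF intH])
  finally show "(LINT w|lborel_disk. \<phi> ((cmod w)\<^sup>2) * ((1 - (cmod (z * w))\<^sup>2) / (cmod (1 - z * cnj w))\<^sup>2)) =
      (LINT w|lborel_disk. \<phi> ((cmod w)\<^sup>2))"
    by (simp only: eq Re_complex_of_real)
qed

text \<open>Since \<open>1 - (cmod (z * w)) ^ 2 \<le> 2 * cmod (1 - z * cnj w)\<close>,
  \<open>k - 1\<close> of the \<open>k + 1\<close> factors in the denominator are traded for the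
  radial quantity \<open>1 - (cmod (z * w)) ^ 2\<close> at the price \<open>2 ^ (k - 1)\<close>. The
  two factors left over form the Poisson kernel, which integrates out and leaves the one-dimensional
  \<open>nn_integral_weight_bound\<close>.\<close>

lemma Forelli_Rudin_estimate:
  fixes t :: real
  assumes t: "t > 1" and k: "real k > t" and z: "z \<in> unit_disk"
  shows "(\<integral>\<^sup>+w. ennreal ((1 - (cmod w)\<^sup>2) powr (t - 1) / cmod (1 - z * cnj w) ^ (k + 1)) \<partial>lborel_disk)
    \<le> ennreal (2 ^ (k - 1) * pi * (1 + 1 / (real k - t)) * (1 - (cmod z)\<^sup>2) powr (t - real k))"
proof -
  define x where "x = (cmod z)\<^sup>2"
  have x: "0 \<le> x" "x < 1" using z by (auto simp: x_def power_less_one_iff abs_square_less_1)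
  \<comment> \<open>The power is \<open>k\<close> rather than \<open>k - 1\<close>: one more factor
    compensates the numerator of the Poisson kernel.\<close>
  define \<phi> where "\<phi> s = (1 - s) powr (t - 1) / (1 - x * s) ^ k" for s
  have [measurable]: "\<phi> \<in> borel_measurable borel" unfolding \<phi>_def by measurable
  have xw: "0 < 1 - x * (cmod w)\<^sup>2" if "w \<in> unit_disk" for w
    using x that mult_left_le[of "(cmod w)\<^sup>2" x] by (simp add: abs_square_le_1)
  have \<phi>_nonneg: "0 \<le> \<phi> ((cmod w)\<^sup>2)" if "w \<in> unit_disk" for w
    using xw[OF that] by (simp add: \<phi>_def)
  have nn: "(\<integral>\<^sup>+w. ennreal (\<phi> ((cmod w)\<^sup>2)) \<partial>lborel_disk) \<le>
      ennreal (pi * ((1 + 1 / (real k - t)) * (1 - x) powr (t - real k)))"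
    using nn_integral_disk_radial[of "\<lambda>s. ennreal (\<phi> s)"] nn_integral_weight_bound[OF t k x] k
    by (simp add: \<phi>_def ennreal_mult' mult_left_mono)
  have int: "integrable lborel_disk (\<lambda>w. \<phi> ((cmod w)\<^sup>2))"
    using nn by (intro integrableI_nonneg measurable_lborel_disk_borel)
      (auto simp: space_lborel_disk \<phi>_nonneg intro: le_less_trans)
  let ?P = "\<lambda>w. \<phi> ((cmod w)\<^sup>2) * ((1 - (cmod (z * w))\<^sup>2) / (cmod (1 - z * cnj w))\<^sup>2)"
  have le: "(1 - (cmod w)\<^sup>2) powr (t - 1) / cmod (1 - z * cnj w) ^ (k + 1) \<le> 2 ^ (k - 1) * ?P w"
    if w: "w \<in> unit_disk" for w
  proof -
    define y where "y = 1 - x * (cmod w)\<^sup>2"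
    define d where "d = cmod (1 - z * cnj w)"
    have y: "0 < y" "1 - (cmod (z * w))\<^sup>2 = y"
      using xw[OF w] by (simp_all add: y_def x_def norm_mult power_mult_distrib)
    have zw: "cmod (z * w) < 1"
      using z w mult_strict_mono'[of "cmod z" 1 "cmod w" 1] by (simp add: norm_mult)
    have "y \<le> 2 * (1 - cmod (z * w))"
      using mult_right_mono[of "1 + cmod (z * w)" 2 "1 - cmod (z * w)"] zw
      by (simp flip: y(2)) (simp add: power2_eq_square algebra_simps)
    moreover have "1 - cmod (z * w) \<le> d"
      using norm_triangle_ineq2[of 1 "z * cnj w"] by (simp add: d_def norm_mult)
    ultimately have yd: "y \<le> 2 * d" by simp
    then have d: "0 < d" using y by simp
    obtain m where m: "k = Suc m" using t k by (cases k) auto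
    have "y ^ m \<le> (2 * d) ^ m" using yd y by (intro power_mono) auto
    then have "y ^ m * d ^ 2 \<le> 2 ^ m * d ^ (k + 1)"
      using mult_right_mono[of "y ^ m" "(2 * d) ^ m" "d ^ 2"]
      by (simp add: m power_mult_distrib power2_eq_square mult_ac)
    then have "1 / d ^ (k + 1) \<le> 2 ^ m / (y ^ m * d ^ 2)"
      using y d by (simp add: field_simps)
    then have "(1 - (cmod w)\<^sup>2) powr (t - 1) * (1 / d ^ (k + 1)) \<le> (1 - (cmod w)\<^sup>2) powr (t - 1) * (2 ^ m / (y ^ m * d ^ 2))"
      by (intro mult_left_mono) auto
    also have "\<dots> = 2 ^ (k - 1) * ?P w"
      unfolding y(2) \<phi>_def using y by (simp add: m y_def[symmetric] d_def[symmetric])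
    finally show ?thesis by (simp add: d_def)
  qed
  have P_nonneg: "0 \<le> ?P w" if "w \<in> unit_disk" for w
  proof -
    have "0 \<le> (1 - (cmod w)\<^sup>2) powr (t - 1) / cmod (1 - z * cnj w) ^ (k + 1)" by simp
    from order_trans[OF this le[OF that]] show ?thesis
      by (subst (asm) zero_le_mult_iff, elim disjE) (use zero_less_power[of "2::real" "k - 1"] in linarith)+
  qed
  have "(\<integral>\<^sup>+w. ennreal ((1 - (cmod w)\<^sup>2) powr (t - 1) / cmod (1 - z * cnj w) ^ (k + 1)) \<partial>lborel_disk)
      \<le> (\<integral>\<^sup>+w. ennreal (2 ^ (k - 1) * ?P w) \<partial>lborel_disk)"
    using le by (intro nn_integral_mono ennreal_leI) (auto simp: space_lborel_disk)
  also have "\<dots> = ennreal (LINT w|lborel_disk. 2 ^ (k - 1) * ?P w)"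
    using integral_disk_Poisson(1)[OF z _ int]
    by (intro nn_integral_eq_integral integrable_mult_right AE_I2 mult_nonneg_nonneg[OF _ P_nonneg])
      (auto simp: space_lborel_disk)
  also have "\<dots> = ennreal (2 ^ (k - 1)) * ennreal (LINT w|lborel_disk. \<phi> ((cmod w)\<^sup>2))"
    by (subst integral_mult_right_zero, subst integral_disk_Poisson(2)[OF z _ int]) (auto simp: ennreal_mult')
  also have "ennreal (LINT w|lborel_disk. \<phi> ((cmod w)\<^sup>2)) = (\<integral>\<^sup>+w. ennreal (\<phi> ((cmod w)\<^sup>2)) \<partial>lborel_disk)"
    using int \<phi>_nonneg by (intro nn_integral_eq_integral[symmetric]) (auto simp: space_lborel_disk)
  also have "ennreal (2 ^ (k - 1)) * \<dots> \<le>
      ennreal (2 ^ (k - 1)) * ennreal (pi * ((1 + 1 / (real k - t)) * (1 - x) powr (t - real k)))"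
    by (intro mult_left_mono nn) simp
  also have "\<dots> = ennreal (2 ^ (k - 1) * pi * (1 + 1 / (real k - t)) * (1 - (cmod z)\<^sup>2) powr (t - real k))"
    by (simp add: x_def mult.assoc flip: ennreal_mult')
  finally show ?thesis .
qed

section \<open>Growth of derivatives\<close>

text \<open>Pointwise form of the boundedness in \<open>analytic_Lipschitz\<close>, used with
  \<open>s = k - t\<close>. The constant is required to be nonnegative so that such bounds can be
  multiplied and chained.\<close>

definition weighted_bound :: "real \<Rightarrow> (complex \<Rightarrow> complex) \<Rightarrow> bool"
  where "weighted_bound s u \<longleftrightarrow>
    (\<exists>C\<ge>0. \<forall>z\<in>unit_disk. cmod (u z) \<le> C * (1 - (cmod z)\<^sup>2) powr (- s))"

lemma one_minus_cmod_square_pos: "z \<in> unit_disk \<Longrightarrow> 0 < 1 - (cmod z)\<^sup>2"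
  by (simp add: abs_square_less_1)

lemma analytic_Lipschitz_iff:
  "f \<in> analytic_Lipschitz k t \<longleftrightarrow>
    f holomorphic_on unit_disk \<and> weighted_bound (real k - t) ((deriv ^^ k) f)"
proof -
  have "cmod (of_real ((1 - (cmod z)\<^sup>2) powr (real k - t)) * u) \<le> B \<longleftrightarrow>
      cmod u \<le> B * (1 - (cmod z)\<^sup>2) powr (- (real k - t))" if "z \<in> unit_disk" for z u B
    unfolding powr_minus_divide using one_minus_cmod_square_pos[OF that]
    by (simp add: norm_mult pos_le_divide_eq mult.commute del: minus_diff_eq)
  then have "bounded ((\<lambda>z. of_real ((1 - (cmod z)\<^sup>2) powr (real k - t)) * (deriv ^^ k) f z) ` unit_disk)
      \<longleftrightarrow> (\<exists>B. \<forall>z\<in>unit_disk. cmod ((deriv ^^ k) f z) \<le> B * (1 - (cmod z)\<^sup>2) powr (- (real k - t)))"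
    unfolding bounded_iff by simp
  also have "\<dots> \<longleftrightarrow> weighted_bound (real k - t) ((deriv ^^ k) f)"
    unfolding weighted_bound_def
  proof
    assume "\<exists>B. \<forall>z\<in>unit_disk. cmod ((deriv ^^ k) f z) \<le> B * (1 - (cmod z)\<^sup>2) powr (- (real k - t))"
    then obtain B where B: "\<And>z. z \<in> unit_disk \<Longrightarrow>
        cmod ((deriv ^^ k) f z) \<le> B * (1 - (cmod z)\<^sup>2) powr (- (real k - t))" by blast
    have "cmod ((deriv ^^ k) f 0) \<le> B" using B[of 0] by simp
    then have "0 \<le> B" using norm_ge_zero order_trans by blast
    then show "\<exists>C\<ge>0. \<forall>z\<in>unit_disk. cmod ((deriv ^^ k) f z) \<le> C * (1 - (cmod z)\<^sup>2) powr (- (real k - t))"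
      using B by blast
  qed blast
  finally show ?thesis by (simp add: analytic_Lipschitz_def)
qed

text \<open>Nonnegativity of the constant is automatic, since the weight is 1 at the origin.\<close>

lemma weighted_boundI:
  assumes "\<And>z. z \<in> unit_disk \<Longrightarrow> cmod (u z) \<le> C * (1 - (cmod z)\<^sup>2) powr (- s)"
  shows "weighted_bound s u"
proof -
  have "cmod (u 0) \<le> C" using assms[of 0] by simp
  then have "0 \<le> C" using norm_ge_zero order_trans by blast
  then show ?thesis using assms by (auto simp: weighted_bound_def)
qed

lemma weighted_boundE:
  assumes "weighted_bound s u"
  obtains C where "0 \<le> C" "\<And>z. z \<in> unit_disk \<Longrightarrow> cmod (u z) \<le> C * (1 - (cmod z)\<^sup>2) powr (- s)"
  using assms by (auto simp: weighted_bound_def)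

lemma weighted_bound_cong:
  "(\<And>z. z \<in> unit_disk \<Longrightarrow> u z = v z) \<Longrightarrow> weighted_bound s u = weighted_bound s v"
  by (auto simp: weighted_bound_def)

lemma weighted_bound_add:
  assumes "weighted_bound s u" "weighted_bound s v"
  shows "weighted_bound s (\<lambda>z. u z + v z)"
proof -
  obtain C where C: "\<And>z. z \<in> unit_disk \<Longrightarrow> cmod (u z) \<le> C * (1 - (cmod z)\<^sup>2) powr (- s)"
    using weighted_boundE[OF assms(1)] by blast
  obtain D where D: "\<And>z. z \<in> unit_disk \<Longrightarrow> cmod (v z) \<le> D * (1 - (cmod z)\<^sup>2) powr (- s)"
    using weighted_boundE[OF assms(2)] by blast
  show ?thesis
  proof (rule weighted_boundI)
    fix z :: complex assume z: "z \<in> unit_disk"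
    have "cmod (u z + v z) \<le> cmod (u z) + cmod (v z)" by (rule norm_triangle_ineq)
    also have "\<dots> \<le> (C + D) * (1 - (cmod z)\<^sup>2) powr (- s)"
      using C[OF z] D[OF z] by (simp add: distrib_right)
    finally show "cmod (u z + v z) \<le> (C + D) * (1 - (cmod z)\<^sup>2) powr (- s)" .
  qed
qed

lemma weighted_bound_mult_bounded:
  assumes u: "weighted_bound s u" and b: "\<And>z. z \<in> unit_disk \<Longrightarrow> cmod (b z) \<le> K"
  shows "weighted_bound s (\<lambda>z. b z * u z)"
proof -
  obtain C where C: "0 \<le> C" "\<And>z. z \<in> unit_disk \<Longrightarrow> cmod (u z) \<le> C * (1 - (cmod z)\<^sup>2) powr (- s)"
    using weighted_boundE[OF u] by blast
  show ?thesis
  proof (rule weighted_boundI)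
    fix z :: complex assume z: "z \<in> unit_disk"
    have "cmod (b z * u z) \<le> K * (C * (1 - (cmod z)\<^sup>2) powr (- s))"
      unfolding norm_mult using C b z norm_ge_zero[of "b z"] order_trans[OF norm_ge_zero b[OF z]]
      by (intro mult_mono) auto
    then show "cmod (b z * u z) \<le> (K * C) * (1 - (cmod z)\<^sup>2) powr (- s)"
      by (simp add: mult.assoc)
  qed
qed

lemma weighted_bound_sum:
  assumes "\<And>i. i \<in> I \<Longrightarrow> weighted_bound s (u i)"
  shows "weighted_bound s (\<lambda>z. \<Sum>i\<in>I. u i z)"
  using assms
proof (induction I rule: infinite_finite_induct)
  case (insert i I)
  then show ?case by (simp add: weighted_bound_add)
qed (auto intro: weighted_boundI[of _ 0])

text \<open>The weight grows with \<open>cmod z\<close>, so on \<open>cball 0 (cmod z)\<close> the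
  derivative obeys the bound valid at \<open>z\<close>, and the mean value inequality controls
  \<open>u z - u 0\<close>. The value \<open>u 0\<close> is absorbed because the weight is at least
  1. The exponent does not improve, which is enough for the Leibniz rule below.\<close>

lemma weighted_bound_deriv:
  assumes hol: "u holomorphic_on unit_disk" and s: "0 \<le> s" and du: "weighted_bound s (deriv u)"
  shows "weighted_bound s u"
proof -
  obtain C where C: "0 \<le> C" "\<And>z. z \<in> unit_disk \<Longrightarrow> cmod (deriv u z) \<le> C * (1 - (cmod z)\<^sup>2) powr (- s)"
    using weighted_boundE[OF du] by blast
  show ?thesis
  proof (rule weighted_boundI)
    fix z :: complex assume z: "z \<in> unit_disk"
    let ?W = "(1 - (cmod z)\<^sup>2) powr (- s)"
    have W: "1 \<le> ?W"
      using powr_mono2'[of "- s" "1 - (cmod z)\<^sup>2" 1] s one_minus_cmod_square_pos[OF z] by simp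
    have "cmod (u z - u 0) \<le> (C * ?W) * cmod (z - 0)"
    proof (rule field_differentiable_bound[of "cball 0 (cmod z)"])
      fix \<zeta> :: complex assume "\<zeta> \<in> cball 0 (cmod z)"
      then have \<zeta>: "\<zeta> \<in> unit_disk" "cmod \<zeta> \<le> cmod z" using z by auto
      show "(u has_field_derivative deriv u \<zeta>) (at \<zeta> within cball 0 (cmod z))"
        using holomorphic_derivI[OF hol _ \<zeta>(1)] by (simp add: has_field_derivative_at_within)
      have "(1 - (cmod \<zeta>)\<^sup>2) powr (- s) \<le> ?W"
        using \<zeta> s one_minus_cmod_square_pos[OF z] by (intro powr_mono2') (auto intro: power_mono)
      then show "cmod (deriv u \<zeta>) \<le> C * ?W"
        using C(2)[OF \<zeta>(1)] C(1) by (meson mult_left_mono order_trans)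
    qed auto
    also have "\<dots> \<le> (C * ?W) * 1" using z C W by (intro mult_left_mono) auto
    finally have "cmod (u z) \<le> C * ?W + cmod (u 0)"
      using norm_triangle_sub[of "u z" "u 0"] by simp
    also have "\<dots> \<le> C * ?W + cmod (u 0) * ?W"
      using mult_left_mono[OF W norm_ge_zero[of "u 0"]] by simp
    finally show "cmod (u z) \<le> (C + cmod (u 0)) * ?W" by (simp add: distrib_right)
  qed
qed

lemma weighted_bound_higher_deriv:
  assumes hol: "f holomorphic_on unit_disk" and s: "0 \<le> s"
    and k: "weighted_bound s ((deriv ^^ k) f)" and "i \<le> k"
  shows "weighted_bound s ((deriv ^^ i) f)"
  using \<open>i \<le> k\<close>
proof (induction rule: inc_induct)
  case (step n)
  then show ?case
    using weighted_bound_deriv[of "(deriv ^^ n) f" s] holomorphic_higher_deriv[OF hol] s by simp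
qed (rule k)

text \<open>Leibniz rule: derivatives of \<open>w ^ n\<close> are bounded on the disk, and all lower
  derivatives of \<open>f\<close> share the growth of the \<open>k\<close>-th one.\<close>

lemma weighted_bound_higher_deriv_power_mult:
  assumes hol: "f holomorphic_on unit_disk" and s: "0 \<le> s"
    and k: "weighted_bound s ((deriv ^^ k) f)"
  shows "weighted_bound s ((deriv ^^ k) (\<lambda>w. w ^ n * f w))"
proof -
  have "weighted_bound s (\<lambda>z. \<Sum>i = 0..k. (of_nat (k choose i) * (deriv ^^ i) (\<lambda>w. w ^ n) z) * (deriv ^^ (k - i)) f z)"
  proof (intro weighted_bound_sum weighted_bound_mult_bounded)
    fix i z assume "z \<in> unit_disk"
    then have "cmod (z ^ (n - i)) \<le> 1" by (auto simp: norm_power intro!: power_le_one)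
    \<comment> \<open>For \<open>i > n\<close> truncated subtraction turns the coefficient into
      \<open>pochhammer 0 i = 0\<close>, as it should be.\<close>
    moreover have "(deriv ^^ i) (\<lambda>w. w ^ n) z = pochhammer (of_nat (Suc n - i)) i * z ^ (n - i)"
      using higher_deriv_power[of i 0 n z] by simp
    ultimately show "cmod (of_nat (k choose i) * (deriv ^^ i) (\<lambda>w. w ^ n) z) \<le>
        cmod (of_nat (k choose i) * pochhammer (of_nat (Suc n - i)) i)"
      using mult_left_mono[of "cmod (z ^ (n - i))" 1 "cmod (of_nat (k choose i) * pochhammer (of_nat (Suc n - i)) i)"]
      by (simp add: norm_mult mult.assoc)
  qed (use weighted_bound_higher_deriv[OF hol s k] in auto)
  then show ?thesis
    by (subst weighted_bound_cong[where v = "\<lambda>z. \<Sum>i = 0..k. (of_nat (k choose i) * (deriv ^^ i) (\<lambda>w. w ^ n) z) * (deriv ^^ (k - i)) f z"])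
      (auto intro!: higher_deriv_mult[of _ unit_disk] holomorphic_intros hol)
qed

text \<open>Read off the formal power series of \<open>w ^ (k - 1) * f w\<close>, whose coefficient
  at \<open>n + k\<close> is that of \<open>f\<close> at \<open>n + 1\<close>; the \<open>n\<close>
  outer derivatives merge with the \<open>k\<close> inner ones.\<close>

lemma higher_deriv_0_power_mult:
  fixes f :: "complex \<Rightarrow> complex"
  assumes hol: "f holomorphic_on unit_disk" and k: "k \<ge> 1"
  shows "(deriv ^^ n) ((deriv ^^ k) (\<lambda>w. w ^ (k - 1) * f w)) 0 / fact n =
    fact (n + k) / fact n * ((deriv ^^ Suc n) f 0 / fact (Suc n))"
proof -
  have "f analytic_on {0}"
    using hol by (intro holomorphic_on_imp_analytic_at[of _ unit_disk]) auto
  then obtain F where F: "f has_fps_expansion F"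
    using analytic_at_imp_has_fps_expansion_0 by blast
  have "(\<lambda>w. w ^ (k - 1) * f w) has_fps_expansion fps_X ^ (k - 1) * F"
    by (intro fps_expansion_intros F)
  then have "(deriv ^^ (n + k)) (\<lambda>w. w ^ (k - 1) * f w) 0 / fact (n + k) = fps_nth (fps_X ^ (k - 1) * F) (n + k)"
    by (simp add: fps_nth_fps_expansion)
  also have "\<dots> = fps_nth F (Suc n)"
    using k by (simp add: fps_X_power_mult_nth Suc_diff_le)
  also have "\<dots> = (deriv ^^ Suc n) f 0 / fact (Suc n)"
    by (rule fps_nth_fps_expansion[OF F])
  finally have "(deriv ^^ (n + k)) (\<lambda>w. w ^ (k - 1) * f w) 0 =
      fact (n + k) * ((deriv ^^ Suc n) f 0 / fact (Suc n))"
    by (simp only: divide_eq_eq) (simp add: mult.commute)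
  then show ?thesis by (simp add: funpow_add)
qed

section \<open>The representing density\<close>

text \<open>The closed form of the sum is \<open>z * (1 - |w| ^ 2) / (1 - z * cnj w)\<close>, a
  geometric series; adding \<open>w\<close> has removed the only term without a factor
  \<open>z\<close>.\<close>

lemma Mobius_kernel_sums:
  fixes z w :: complex
  assumes "z \<in> unit_disk" "w \<in> unit_disk"
  shows "(\<lambda>n. z ^ Suc n * (of_real (1 - (cmod w)\<^sup>2) * cnj w ^ n)) sums ((z - w) / (1 - z * cnj w) + w)"
proof -
  have less: "cmod (z * cnj w) < 1"
    using assms mult_strict_mono'[of "cmod z" 1 "cmod w" 1] by (simp add: norm_mult)
  then have ne: "1 - z * cnj w \<noteq> 0" by auto
  have "(\<lambda>n. (z * of_real (1 - (cmod w)\<^sup>2)) * (z * cnj w) ^ n) sums ((z * of_real (1 - (cmod w)\<^sup>2)) * (1 / (1 - z * cnj w)))"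
    by (intro sums_mult geometric_sums less)
  moreover have "(z * of_real (1 - (cmod w)\<^sup>2)) * (1 / (1 - z * cnj w)) = (z - w) / (1 - z * cnj w) + w"
    unfolding of_real_diff complex_norm_square using ne by (simp add: field_simps)
  moreover have "(z * of_real (1 - (cmod w)\<^sup>2)) * (z * cnj w) ^ n = z ^ Suc n * (of_real (1 - (cmod w)\<^sup>2) * cnj w ^ n)" for n
    by (simp add: power_mult_distrib mult_ac)
  ultimately show ?thesis by (simp only:)
qed

lemma Mobius_kernel_measurable:
  assumes "z \<in> unit_disk"
  shows "(\<lambda>w. (z - w) / (1 - z * cnj w)) \<in> borel_measurable lborel_disk"
  using one_minus_mult_cnj_nonzero[OF assms]
  by (intro measurable_lborel_disk_continuous continuous_intros) auto

lemma Mobius_kernel_bound: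
  assumes "z \<in> unit_disk" "w \<in> unit_disk"
  shows "cmod ((z - w) / (1 - z * cnj w)) \<le> 2 / (1 - cmod z)"
proof -
  have "1 - cmod z \<le> cmod (1 - z * cnj w)"
    using assms(2) by (rule cmod_one_minus_mult_cnj_ge)
  moreover have "cmod (z - w) \<le> 2"
    using norm_triangle_ineq4[of z w] assms by simp
  ultimately show ?thesis
    using assms unfolding norm_divide by (intro frac_le) auto
qed

lemma integrable_mult_Mobius_kernel:
  fixes g :: "complex \<Rightarrow> complex"
  assumes z: "z \<in> unit_disk" and g: "integrable lborel_disk g"
  shows "integrable lborel_disk (\<lambda>w. g w * ((z - w) / (1 - z * cnj w)))"
proof (rule Bochner_Integration.integrable_bound)
  show "integrable lborel_disk (\<lambda>w. g w * of_real (2 / (1 - cmod z)))"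
    using g by (rule integrable_mult_left)
  show "(\<lambda>w. g w * ((z - w) / (1 - z * cnj w))) \<in> borel_measurable lborel_disk"
    using g by (intro borel_measurable_times Mobius_kernel_measurable z) auto
  show "AE w in lborel_disk. cmod (g w * ((z - w) / (1 - z * cnj w))) \<le> cmod (g w * of_real (2 / (1 - cmod z)))"
  proof (intro AE_I2)
    fix w assume "w \<in> space lborel_disk"
    then have "cmod ((z - w) / (1 - z * cnj w)) \<le> 2 / (1 - cmod z)"
      by (intro Mobius_kernel_bound z) (simp add: space_lborel_disk)
    also have "\<dots> \<le> \<bar>2 / (1 - cmod z)\<bar>" by (rule abs_ge_self)
    finally have "cmod ((z - w) / (1 - z * cnj w)) \<le> \<bar>2 / (1 - cmod z)\<bar>" .
    then show "cmod (g w * ((z - w) / (1 - z * cnj w))) \<le> cmod (g w * of_real (2 / (1 - cmod z)))"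
      unfolding norm_mult norm_of_real by (rule mult_left_mono) simp
  qed
qed

lemma analytic_Lipschitz_Mobius_representation:
  fixes t :: real
  assumes t: "t > 1" and k: "real k > t" and f: "f \<in> analytic_Lipschitz k t"
  obtains g C where "g \<in> borel_measurable lborel_disk"
    and "\<And>w. w \<in> unit_disk \<Longrightarrow> cmod (g w) \<le> C * (1 - (cmod w)\<^sup>2) powr (t - 2)"
    and "\<And>z. z \<in> unit_disk \<Longrightarrow> f z = (LINT w|lborel_disk. g w * ((z - w) / (1 - z * cnj w)))"
proof -
  have hol: "f holomorphic_on unit_disk" and wb: "weighted_bound (real k - t) ((deriv ^^ k) f)"
    using f by (simp_all add: analytic_Lipschitz_iff)
  \<comment> \<open>\<open>k > t > 1\<close> forces this, so the weight exponent
    \<open>m = k - 2\<close> is a natural number.\<close>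
  have "k \<ge> 2" using t k by linarith
  then obtain m where m: "k = m + 2" by (metis add.commute le_Suc_ex)
  \<comment> \<open>The normalisation inverts the factor \<open>pi * fact (k - 1)\<close> of the
    Beta integral in \<open>moment_h\<close> at weight exponent \<open>k - 1\<close>.\<close>
  define h where "h w = inverse (of_real (pi * fact (k - 1))) * (deriv ^^ k) (\<lambda>w. w ^ (k - 1) * f w) w" for w
  \<comment> \<open>\<open>pi / ((m + 1) * (m + 2))\<close> is the integral of \<open>(1 - \<bar>w\<bar>\<^sup>2) ^ m * \<bar>w\<bar>\<^sup>2\<close>\<close>
  define c where "c = f 0 / of_real (pi * (1 / ((real m + 1) * (real m + 2))))"
  define g where "g w = of_real ((1 - (cmod w)\<^sup>2) ^ m) * (h w - c * cnj w)" for w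
  define a where "a n = (deriv ^^ n) f 0 / fact n" for n
  have hol_p: "(\<lambda>w. w ^ (k - 1) * f w) holomorphic_on unit_disk"
    by (intro holomorphic_intros hol)
  have hol_h: "h holomorphic_on unit_disk"
    unfolding h_def by (intro holomorphic_intros hol_p) auto
  have wb_h: "weighted_bound (real k - t) h"
    unfolding h_def using k
    by (intro weighted_bound_mult_bounded weighted_bound_higher_deriv_power_mult hol wb) auto
  obtain A where A: "0 \<le> A" "\<And>w. w \<in> unit_disk \<Longrightarrow> cmod (h w) \<le> A * (1 - (cmod w)\<^sup>2) powr (- (real k - t))"
    using weighted_boundE[OF wb_h] by blast
  \<comment> \<open>Radial majorant of \<open>h\<close>, monotone because its exponent is negative,
    as \<open>integral_disk_cnj_power_mult\<close> demands.\<close>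
  define B where "B x = A * (1 - x\<^sup>2) powr (- (real k - t))" for x :: real
  have B_mono: "B x \<le> B y" if "0 \<le> x" "x \<le> y" "y < 1" for x y
    unfolding B_def using A that k
    by (intro mult_left_mono powr_mono2') (auto intro: power_mono simp: abs_square_less_1)
  have weight: "(1 - (cmod w)\<^sup>2) ^ n * B (cmod w) = A * (1 - (cmod w)\<^sup>2) powr (t - real k + real n)"
    if "w \<in> unit_disk" for w n
    using one_minus_cmod_square_pos[OF that] by (simp add: B_def powr_add powr_realpow)
  \<comment> \<open>For \<open>n \<ge> m\<close> the resulting exponent \<open>t - k + n\<close> is
    at least \<open>t - 2 > -1\<close>.\<close>
  have int_B: "integrable lborel_disk (\<lambda>w. (1 - (cmod w)\<^sup>2) ^ n * B (cmod w))" if "m \<le> n" for n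
  proof -
    have "integrable lborel_disk (\<lambda>w. A * (1 - (cmod w)\<^sup>2) powr (t - real k + real n))"
      using that m t by (intro integrable_mult_right integrable_disk_weight) simp
    then show ?thesis
      by (rule iffD1[OF Bochner_Integration.integrable_cong[OF refl], rotated])
        (simp add: weight space_lborel_disk)
  qed
  have int_pow: "integrable lborel_disk (\<lambda>w. (1 - (cmod w)\<^sup>2) ^ n)" for n
  proof (rule finite_measure.integrable_const_bound[OF finite_measure_lborel_disk])
    show "AE w in lborel_disk. norm ((1 - (cmod w)\<^sup>2) ^ n) \<le> 1"
    proof (intro AE_I2)
      fix w assume "w \<in> space lborel_disk"
      then have "0 < 1 - (cmod w)\<^sup>2" by (intro one_minus_cmod_square_pos) (simp add: space_lborel_disk)
      then show "norm ((1 - (cmod w)\<^sup>2) ^ n) \<le> 1" by (simp add: power_le_one)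
    qed
  qed (intro measurable_lborel_disk_borel, measurable)
  have meas_h: "h \<in> borel_measurable lborel_disk"
    by (intro measurable_lborel_disk_continuous holomorphic_on_imp_continuous_on hol_h)
  have meas_borel: "(\<lambda>w. of_real ((1 - (cmod w)\<^sup>2) ^ n) :: complex) \<in> borel_measurable lborel_disk"
    "cnj \<in> borel_measurable lborel_disk" "(\<lambda>w. w) \<in> borel_measurable lborel_disk" for n
    by (intro measurable_lborel_disk_borel; measurable)+
  have meas_g: "g \<in> borel_measurable lborel_disk"
    unfolding g_def by (intro borel_measurable_times borel_measurable_diff meas_h meas_borel borel_measurable_const)
  have g_le: "cmod (g w) \<le> (A + cmod c) * (1 - (cmod w)\<^sup>2) powr (t - 2)" if w: "w \<in> unit_disk" for w
  proof -
    let ?d = "1 - (cmod w)\<^sup>2"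
    have d: "0 < ?d" "?d \<le> 1" using one_minus_cmod_square_pos[OF w] by simp_all
    have "cmod (g w) \<le> ?d ^ m * (cmod (h w) + cmod c * cmod w)"
      unfolding g_def norm_mult using d norm_triangle_ineq4[of "h w" "c * cnj w"]
      by (intro mult_mono) (auto simp: norm_mult norm_power simp del: of_real_diff of_real_power)
    also have "\<dots> \<le> ?d ^ m * (B (cmod w) + cmod c * 1)"
      using d A(2)[OF w] w by (intro mult_left_mono add_mono) (auto simp: B_def)
    also have "\<dots> = A * ?d powr (t - 2) + cmod c * ?d ^ m"
      using weight[OF w, of m] by (simp add: m algebra_simps)
    \<comment> \<open>Here \<open>m = k - 2 > t - 2\<close> and the base is at most 1.\<close>
    also have "?d ^ m \<le> ?d powr (t - 2)"
    proof -
      have "?d ^ m = ?d powr real m" using d by (simp add: powr_realpow)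
      also have "\<dots> \<le> ?d powr (t - 2)" using d k m by (intro powr_mono') auto
      finally show ?thesis .
    qed
    finally show ?thesis by (simp add: distrib_right mult_left_mono)
  qed
  have int_g: "integrable lborel_disk g"
  proof (rule Bochner_Integration.integrable_bound[OF _ meas_g])
    show "integrable lborel_disk (\<lambda>w. (A + cmod c) * (1 - (cmod w)\<^sup>2) powr (t - 2))"
      using t by (intro integrable_mult_right integrable_disk_weight) simp
    show "AE w in lborel_disk. cmod (g w) \<le> norm ((A + cmod c) * (1 - (cmod w)\<^sup>2) powr (t - 2))"
      using g_le A by (intro AE_I2) (auto simp: space_lborel_disk abs_mult)
  qed
  have int_h: "integrable lborel_disk (\<lambda>w. of_real ((1 - (cmod w)\<^sup>2) ^ n) * (b w * h w))"
    if "m \<le> n" and b: "b \<in> borel_measurable lborel_disk" "\<And>w. w \<in> unit_disk \<Longrightarrow> cmod (b w) \<le> 1" for n b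
  proof (rule Bochner_Integration.integrable_bound[OF int_B[OF \<open>m \<le> n\<close>]])
    show "(\<lambda>w. of_real ((1 - (cmod w)\<^sup>2) ^ n) * (b w * h w)) \<in> borel_measurable lborel_disk"
      by (intro borel_measurable_times meas_borel meas_h b)
    show "AE w in lborel_disk. cmod (of_real ((1 - (cmod w)\<^sup>2) ^ n) * (b w * h w)) \<le>
        norm ((1 - (cmod w)\<^sup>2) ^ n * B (cmod w))"
    proof (intro AE_I2)
      fix w assume "w \<in> space lborel_disk"
      then have w: "w \<in> unit_disk" by (simp add: space_lborel_disk)
      have "cmod (b w) * cmod (h w) \<le> 1 * B (cmod w)"
        using b(2)[OF w] A(2)[OF w] by (intro mult_mono) (auto simp: B_def)
      also have "\<dots> \<le> \<bar>B (cmod w)\<bar>" by simp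
      finally show "cmod (of_real ((1 - (cmod w)\<^sup>2) ^ n) * (b w * h w)) \<le>
          norm ((1 - (cmod w)\<^sup>2) ^ n * B (cmod w))"
        unfolding norm_mult norm_of_real real_norm_def abs_mult by (rule mult_left_mono) simp
    qed
  qed
  have le1: "cmod (w ^ i * cnj w ^ j) \<le> 1" if "w \<in> unit_disk" for w i j
    using that by (auto simp: norm_mult norm_power intro!: mult_le_one power_le_one)
  have int_mon: "integrable lborel_disk (\<lambda>w. of_real ((1 - (cmod w)\<^sup>2) ^ n) * (w ^ i * cnj w ^ j) :: complex)" for n i j
  proof (rule Bochner_Integration.integrable_bound[OF int_pow[of n]])
    show "(\<lambda>w. of_real ((1 - (cmod w)\<^sup>2) ^ n) * (w ^ i * cnj w ^ j) :: complex) \<in> borel_measurable lborel_disk"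
      by (intro borel_measurable_times borel_measurable_power meas_borel)
    show "AE w in lborel_disk. cmod (of_real ((1 - (cmod w)\<^sup>2) ^ n) * (w ^ i * cnj w ^ j)) \<le> norm ((1 - (cmod w)\<^sup>2) ^ n)"
      unfolding norm_mult[of "of_real _"] norm_of_real real_norm_def using le1
      by (intro AE_I2 mult_left_le) (auto simp: space_lborel_disk)
  qed
  have moment_h: "(LINT w|lborel_disk. of_real ((1 - (cmod w)\<^sup>2) ^ n) * (cnj w ^ j * h w)) =
      (deriv ^^ j) h 0 / fact j * of_real (pi * (fact j * fact n / fact (j + n + 1)))" if "m \<le> n" for n j
    using integral_disk_cnj_power_mult[OF hol_h, of "\<lambda>s. (1 - s) ^ n" B j] int_pow int_B[OF that] B_mono A(2)
      integral_disk_power[of n j] by (simp add: B_def)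
  have coeff_h: "(deriv ^^ n) h 0 / fact n = fact (n + k) / fact n * a (Suc n) / of_real (pi * fact (k - 1))" for n
  proof -
    have "(deriv ^^ n) h 0 = inverse (of_real (pi * fact (k - 1))) * (deriv ^^ n) ((deriv ^^ k) (\<lambda>w. w ^ (k - 1) * f w)) 0"
      unfolding h_def by (rule higher_deriv_cmult[of _ unit_disk]) (auto intro!: holomorphic_intros hol)
    then have "(deriv ^^ n) h 0 / fact n = inverse (of_real (pi * fact (k - 1))) *
        ((deriv ^^ n) ((deriv ^^ k) (\<lambda>w. w ^ (k - 1) * f w)) 0 / fact n)" by simp
    also have "\<dots> = inverse (of_real (pi * fact (k - 1))) * (fact (n + k) / fact n * a (Suc n))"
      unfolding a_def using \<open>k \<ge> 2\<close> by (subst higher_deriv_0_power_mult[OF hol]) auto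
    finally show ?thesis by (simp add: field_simps)
  qed
  \<comment> \<open>The kernel series starts with \<open>- w\<close>, so the transform at 0 is minus
    this integral. The part with \<open>w * h w\<close> vanishes by the mean value property, since
    \<open>w * h w\<close> is 0 at the origin, and \<open>c\<close> is chosen for the remaining
    \<open>|w| ^ 2\<close> term.\<close>
  have zeroth: "(LINT w|lborel_disk. w * g w) = - f 0"
  proof -
    have "(LINT w|lborel_disk. w * g w) =
        (LINT w|lborel_disk. of_real ((1 - (cmod w)\<^sup>2) ^ m) * (w * h w)
          - c * (of_real ((1 - (cmod w)\<^sup>2) ^ m) * (w ^ 1 * cnj w ^ 1)))"
      by (intro Bochner_Integration.integral_cong) (auto simp: g_def algebra_simps)
    also have "\<dots> = (LINT w|lborel_disk. of_real ((1 - (cmod w)\<^sup>2) ^ m) * (w * h w))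
        - c * (LINT w|lborel_disk. of_real ((1 - (cmod w)\<^sup>2) ^ m) * (w ^ 1 * cnj w ^ 1))"
      using int_mon[of m 1 1] int_h[of m "\<lambda>w. w"] meas_borel(3)
      by (subst Bochner_Integration.integral_diff) (auto simp del: power_one_right of_real_power of_real_diff)
    also have "(LINT w|lborel_disk. of_real ((1 - (cmod w)\<^sup>2) ^ m) * (w * h w)) = 0"
    proof -
      have "cmod (w * h w) \<le> B (cmod w)" if w: "w \<in> unit_disk" for w
        using mult_mono[of "cmod w" 1 "cmod (h w)" "B (cmod w)"] A(2)[OF w] w by (auto simp: B_def norm_mult)
      moreover have "(\<lambda>w. w * h w) holomorphic_on unit_disk"
        by (intro holomorphic_intros hol_h)
      ultimately show ?thesis
        using integral_disk_cnj_power_mult[of "\<lambda>w. w * h w" "\<lambda>s. (1 - s) ^ m" B 0] int_pow int_B[of m] B_mono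
        by simp
    qed
    also have "(LINT w|lborel_disk. of_real ((1 - (cmod w)\<^sup>2) ^ m) * (w ^ 1 * cnj w ^ 1)) =
        of_real (LINT w|lborel_disk. (1 - (cmod w)\<^sup>2) ^ m * ((cmod w)\<^sup>2) ^ 1)"
    proof -
      have "of_real ((1 - (cmod w)\<^sup>2) ^ m) * (w ^ 1 * cnj w ^ 1) = complex_of_real ((1 - (cmod w)\<^sup>2) ^ m * ((cmod w)\<^sup>2) ^ 1)" for w
        by (simp only: of_real_mult power_one_right complex_norm_square)
      then show ?thesis by (simp only: integral_complex_of_real)
    qed
    also have "\<dots> = of_real (pi * (1 / ((real m + 1) * (real m + 2))))"
    proof -
      have "fact (1 + m + 1) = (real m + 1) * (real m + 2) * fact m" by (simp add: algebra_simps)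
      then have "fact 1 * fact m / fact (1 + m + 1) = 1 / ((real m + 1) * (real m + 2))" by simp
      then show ?thesis by (simp only: integral_disk_power)
    qed
    also have "0 - c * \<dots> = - f 0"
    proof -
      have "of_real (pi * (1 / ((real m + 1) * (real m + 2)))) \<noteq> (0 :: complex)"
        unfolding of_real_eq_0_iff by simp
      then show ?thesis unfolding c_def by (simp del: of_real_mult of_real_divide)
    qed
    finally show ?thesis .
  qed
  \<comment> \<open>The term \<open>c * cnj w\<close> contributes \<open>cnj w ^ Suc n\<close>,
    which integrates to 0 against a radial weight. In the other term the factor
    \<open>1 - |w| ^ 2\<close> raises the weight exponent to \<open>Suc m = k - 1\<close>, the one
    for which \<open>h\<close> was normalised.\<close>
  have moment: "(LINT w|lborel_disk. of_real (1 - (cmod w)\<^sup>2) * cnj w ^ n * g w) = a (Suc n)" for n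
  proof -
    have "(LINT w|lborel_disk. of_real (1 - (cmod w)\<^sup>2) * cnj w ^ n * g w) =
        (LINT w|lborel_disk. of_real ((1 - (cmod w)\<^sup>2) ^ Suc m) * (cnj w ^ n * h w)
          - c * (of_real ((1 - (cmod w)\<^sup>2) ^ Suc m) * (w ^ 0 * cnj w ^ Suc n)))"
      by (intro Bochner_Integration.integral_cong) (auto simp: g_def algebra_simps)
    also have "\<dots> = (LINT w|lborel_disk. of_real ((1 - (cmod w)\<^sup>2) ^ Suc m) * (cnj w ^ n * h w))
        - c * (LINT w|lborel_disk. of_real ((1 - (cmod w)\<^sup>2) ^ Suc m) * (w ^ 0 * cnj w ^ Suc n))"
    proof (subst Bochner_Integration.integral_diff)
      show "integrable lborel_disk (\<lambda>w. of_real ((1 - (cmod w)\<^sup>2) ^ Suc m) * (cnj w ^ n * h w))"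
        by (intro int_h borel_measurable_power meas_borel) (use le1[of _ 0 n] in auto)
      show "integrable lborel_disk (\<lambda>w. c * (of_real ((1 - (cmod w)\<^sup>2) ^ Suc m) * (w ^ 0 * cnj w ^ Suc n)))"
        by (intro integrable_mult_right int_mon)
    qed (simp only: integral_mult_right_zero)
    also have "(LINT w|lborel_disk. of_real ((1 - (cmod w)\<^sup>2) ^ Suc m) * (w ^ 0 * cnj w ^ Suc n)) = 0"
      using integral_disk_monomials_eq_0[of 0 "Suc n" "\<lambda>s. (1 - s) ^ Suc m"] by simp
    also have "(LINT w|lborel_disk. of_real ((1 - (cmod w)\<^sup>2) ^ Suc m) * (cnj w ^ n * h w)) = a (Suc n)"
    proof -
      define X :: complex where "X = of_real (pi * fact (k - 1))"
      have X: "X \<noteq> 0" unfolding X_def of_real_eq_0_iff by simp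
      have "n + Suc m + 1 = n + k" "Suc m = k - 1" by (simp_all add: m)
      then have "of_real (pi * (fact n * fact (Suc m) / fact (n + Suc m + 1))) = X * (fact n / fact (n + k))"
        by (simp only:) (simp add: X_def)
      moreover have "fact (n + k) / fact n * a (Suc n) / X * (X * (fact n / fact (n + k))) = a (Suc n)"
        using X by (simp add: field_simps)
      ultimately show ?thesis
        by (subst moment_h) (simp_all only: coeff_h X_def[symmetric] le_Suc_eq order_refl simp_thms)
    qed
    finally show ?thesis by simp
  qed
  have rep: "f z = (LINT w|lborel_disk. g w * ((z - w) / (1 - z * cnj w)))" if z: "z \<in> unit_disk" for z
  proof -
    \<comment> \<open>Termwise integration is justified by the bound
      \<open>cmod z ^ n * cmod (g w)\<close>, summable in \<open>n\<close> and integrable in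
      \<open>w\<close>.\<close>
    let ?T = "\<lambda>n w. z ^ Suc n * (of_real (1 - (cmod w)\<^sup>2) * cnj w ^ n * g w)"
    have int_T: "integrable lborel_disk (\<lambda>w. of_real (1 - (cmod w)\<^sup>2) * cnj w ^ n * g w)"
      and le_T: "\<And>w. w \<in> unit_disk \<Longrightarrow> cmod (?T n w) \<le> cmod z ^ n * cmod (g w)" for n
    proof -
      have le: "cmod (of_real (1 - (cmod w)\<^sup>2) * cnj w ^ n) \<le> 1" if "w \<in> unit_disk" for w
      proof -
        have "cmod (of_real (1 - (cmod w)\<^sup>2)) \<le> 1"
          unfolding norm_of_real using one_minus_cmod_square_pos[OF that] by simp
        moreover have "cmod (cnj w ^ n) \<le> 1" using le1[OF that, of 0 n] by simp
        ultimately show ?thesis unfolding norm_mult by (intro mult_le_one norm_ge_zero)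
      qed
      have "integrable lborel_disk (\<lambda>w. cmod (g w))" using int_g by simp
      then show "integrable lborel_disk (\<lambda>w. of_real (1 - (cmod w)\<^sup>2) * cnj w ^ n * g w)"
      proof (rule Bochner_Integration.integrable_bound)
        show "(\<lambda>w. of_real (1 - (cmod w)\<^sup>2) * cnj w ^ n * g w) \<in> borel_measurable lborel_disk"
          using meas_borel(1)[of 1] by (intro borel_measurable_times borel_measurable_power meas_g meas_borel(2)) simp
        show "AE w in lborel_disk. cmod (of_real (1 - (cmod w)\<^sup>2) * cnj w ^ n * g w) \<le> norm (cmod (g w))"
        proof (intro AE_I2)
          fix w assume "w \<in> space lborel_disk"
          then have "w \<in> unit_disk" by (simp add: space_lborel_disk)
          from mult_right_mono[OF le[OF this], of "cmod (g w)"]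
          show "cmod (of_real (1 - (cmod w)\<^sup>2) * cnj w ^ n * g w) \<le> norm (cmod (g w))"
            by (subst norm_mult) simp
        qed
      qed
      show "cmod (?T n w) \<le> cmod z ^ n * cmod (g w)" if w: "w \<in> unit_disk" for w
      proof -
        have "cmod (?T n w) \<le> cmod z ^ Suc n * (1 * cmod (g w))"
          unfolding norm_mult[of "z ^ Suc n"] norm_mult[of _ "g w"] norm_power
          by (intro mult_left_mono mult_right_mono le[OF w]) auto
        also have "\<dots> \<le> cmod z ^ n * (1 * cmod (g w))"
          using z by (intro mult_right_mono power_decreasing) auto
        finally show ?thesis by simp
      qed
    qed
    have summ: "summable (\<lambda>n. cmod z ^ n)" using z by simp
    have sums_T: "(\<lambda>n. integral\<^sup>L lborel_disk (?T n)) sums (LINT w|lborel_disk. (\<Sum>n. ?T n w))"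
    proof (rule sums_integral)
      show "integrable lborel_disk (?T n)" for n using int_T by (rule integrable_mult_right)
      show "AE w in lborel_disk. summable (\<lambda>n. cmod (?T n w))"
        by (intro AE_I2 summable_comparison_test'[OF summable_mult2[OF summ]])
          (use le_T in \<open>simp add: space_lborel_disk\<close>)
      show "summable (\<lambda>n. LINT w|lborel_disk. cmod (?T n w))"
      proof (rule summable_comparison_test'[OF summable_mult2[OF summ]])
        fix n
        have "(LINT w|lborel_disk. cmod (?T n w)) \<le> (LINT w|lborel_disk. cmod z ^ n * cmod (g w))"
        proof (rule integral_mono)
          show "integrable lborel_disk (\<lambda>w. cmod (?T n w))"
            using int_T by (intro integrable_norm integrable_mult_right)
          show "integrable lborel_disk (\<lambda>w. cmod z ^ n * cmod (g w))"
            using int_g by (intro integrable_mult_right integrable_norm)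
        qed (use le_T in \<open>simp add: space_lborel_disk\<close>)
        then show "norm (LINT w|lborel_disk. cmod (?T n w)) \<le> cmod z ^ n * (LINT w|lborel_disk. cmod (g w))"
          by (simp add: integral_nonneg_AE)
      qed
    qed
    have "(\<Sum>n. ?T n w) = g w * ((z - w) / (1 - z * cnj w)) + w * g w" if "w \<in> space lborel_disk" for w
    proof -
      have "w \<in> unit_disk" using that by (simp add: space_lborel_disk)
      from sums_mult2[OF Mobius_kernel_sums[OF z this], of "g w"]
      have "(\<lambda>n. ?T n w) sums (((z - w) / (1 - z * cnj w) + w) * g w)"
        by (simp only: mult.assoc)
      then have "(\<Sum>n. ?T n w) = ((z - w) / (1 - z * cnj w) + w) * g w"
        by (rule sums_unique[symmetric])
      then show ?thesis
        by (simp only: distrib_right mult.commute[of "(z - w) / (1 - z * cnj w)" "g w"])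
    qed
    then have "(LINT w|lborel_disk. (\<Sum>n. ?T n w)) = (LINT w|lborel_disk. g w * ((z - w) / (1 - z * cnj w)) + w * g w)"
      by (intro Bochner_Integration.integral_cong refl)
    also have "\<dots> = (LINT w|lborel_disk. g w * ((z - w) / (1 - z * cnj w))) + (LINT w|lborel_disk. w * g w)"
    proof (rule Bochner_Integration.integral_add)
      show "integrable lborel_disk (\<lambda>w. w * g w)"
        using int_g
      proof (rule Bochner_Integration.integrable_bound)
        show "AE w in lborel_disk. cmod (w * g w) \<le> cmod (g w)"
          by (intro AE_I2) (auto simp: space_lborel_disk norm_mult intro!: mult_left_le_one_le)
      qed (intro borel_measurable_times meas_borel meas_g)
    qed (intro integrable_mult_Mobius_kernel z int_g)
    finally have eq: "(LINT w|lborel_disk. (\<Sum>n. ?T n w)) = (LINT w|lborel_disk. g w * ((z - w) / (1 - z * cnj w))) - f 0"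
      using zeroth by simp
    have "(\<lambda>n. a n * z ^ n) sums f z"
      using holomorphic_power_series[OF hol z] by (simp add: a_def)
    then have "(\<lambda>n. a (Suc n) * z ^ Suc n) sums (f z - a 0 * z ^ 0)"
      by (subst sums_Suc_iff) simp
    then have "(\<lambda>n. a (Suc n) * z ^ Suc n) sums (f z - f 0)" by (simp add: a_def)
    moreover have moment_T: "integral\<^sup>L lborel_disk (?T n) = a (Suc n) * z ^ Suc n" for n
      by (simp only: integral_mult_right_zero moment) (rule mult.commute)
    have "(\<lambda>n. a (Suc n) * z ^ Suc n) sums ((LINT w|lborel_disk. g w * ((z - w) / (1 - z * cnj w))) - f 0)"
      using sums_T by (simp only: moment_T eq)
    ultimately have "f z - f 0 = (LINT w|lborel_disk. g w * ((z - w) / (1 - z * cnj w))) - f 0"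
      by (rule sums_unique2)
    then show ?thesis by simp
  qed
  show ?thesis using that meas_g g_le rep by blast
qed

section \<open>Averaging over hyperbolic disks\<close>

lemma one_minus_cmod_square_bounds:
  assumes "w \<in> unit_disk"
  shows "1 - cmod w \<le> 1 - (cmod w)\<^sup>2" "1 - (cmod w)\<^sup>2 \<le> 2 * (1 - cmod w)"
proof -
  have "cmod w < 1" using assms by simp
  then have "0 \<le> (1 - cmod w) * cmod w" "0 \<le> (1 - cmod w) * (1 - cmod w)" by auto
  then show "1 - cmod w \<le> 1 - (cmod w)\<^sup>2" "1 - (cmod w)\<^sup>2 \<le> 2 * (1 - cmod w)"
    by (simp_all add: power2_eq_square algebra_simps)
qed

lemma sets_pseudohyperbolic_disk [measurable]: "pseudohyperbolic_disk z r \<in> sets borel"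
proof -
  have "pseudohyperbolic_disk z r = unit_disk \<inter> {w. cmod ((z - w) / (1 - z * cnj w)) < r}"
    by (auto simp: pseudohyperbolic_disk_def)
  moreover have "{w. cmod ((z - w) / (1 - z * cnj w)) < r} \<in> sets borel" by measurable
  ultimately show ?thesis by auto
qed

lemma pseudohyperbolic_disk_subset: "pseudohyperbolic_disk z r \<subseteq> unit_disk"
  by (auto simp: pseudohyperbolic_disk_def)

lemma sets_disk_pseudohyperbolic_disk: "pseudohyperbolic_disk z r \<in> sets borel_disk"
  using sets_pseudohyperbolic_disk pseudohyperbolic_disk_subset by (subst sets_restrict_space_iff) auto

text \<open>The Euclidean disk of radius \<open>r * (1 - cmod w)\<close> at \<open>w\<close> is
  small on the hyperbolic scale, because \<open>1 - cmod w \<le> cmod (1 - z * cnj w)\<close> for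
  every \<open>z\<close> in the unit disk. Membership is stated for \<open>w\<close> in the disk at
  \<open>\<zeta>\<close>, since Tonelli's theorem will fix \<open>\<zeta>\<close> and integrate over
  \<open>w\<close>.\<close>

lemma
  assumes w: "w \<in> unit_disk" and \<zeta>: "cmod (\<zeta> - w) < r * (1 - cmod w)" and r: "0 < r" "r < 1"
  shows near_in_unit_disk: "\<zeta> \<in> unit_disk"
    and near_in_pseudohyperbolic_disk: "w \<in> pseudohyperbolic_disk \<zeta> r"
    and near_boundary_distance:
      "(1 - r) * (1 - cmod w) \<le> 1 - cmod \<zeta>" "1 - cmod \<zeta> \<le> 2 * (1 - cmod w)"
    and near_kernel: "z \<in> unit_disk \<Longrightarrow> cmod (1 - z * cnj \<zeta>) \<le> 2 * cmod (1 - z * cnj w)"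
proof -
  have w1: "cmod w < 1" using w by simp
  have r1: "r * (1 - cmod w) \<le> 1 * (1 - cmod w)" using r w1 by (intro mult_right_mono) auto
  have tri: "cmod \<zeta> \<le> cmod w + cmod (\<zeta> - w)" "cmod w \<le> cmod \<zeta> + cmod (\<zeta> - w)"
    using norm_triangle_sub[of \<zeta> w] norm_triangle_sub[of w \<zeta>] by (simp_all add: norm_minus_commute)
  show in_disk: "\<zeta> \<in> unit_disk" using tri \<zeta> r1 by simp
  show "(1 - r) * (1 - cmod w) \<le> 1 - cmod \<zeta>" using tri \<zeta> by (simp add: algebra_simps)
  show "1 - cmod \<zeta> \<le> 2 * (1 - cmod w)" using tri \<zeta> r1 by simp
  have ge: "1 - cmod w \<le> cmod (1 - z * cnj w)" if "z \<in> unit_disk" for z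
    using that by (intro cmod_one_minus_ge) simp
  then have "r * (1 - cmod w) \<le> r * cmod (1 - \<zeta> * cnj w)"
    using r by (intro mult_left_mono[OF ge[OF in_disk]]) simp
  then have "cmod (\<zeta> - w) < r * cmod (1 - \<zeta> * cnj w)"
    using \<zeta> by simp
  moreover have "0 < cmod (1 - \<zeta> * cnj w)"
    by (rule less_le_trans[OF _ ge[OF in_disk]]) (use w1 in simp)
  ultimately show "w \<in> pseudohyperbolic_disk \<zeta> r"
    using w by (simp add: pseudohyperbolic_disk_def norm_divide pos_divide_less_eq)
  assume z: "z \<in> unit_disk"
  have "1 - z * cnj \<zeta> = (1 - z * cnj w) - z * cnj (\<zeta> - w)" by (simp add: algebra_simps)
  then have "cmod (1 - z * cnj \<zeta>) \<le> cmod (1 - z * cnj w) + cmod z * cmod (\<zeta> - w)"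
    by (metis norm_triangle_ineq4 norm_mult complex_mod_cnj)
  also have "cmod z * cmod (\<zeta> - w) \<le> 1 * (1 - cmod w)"
    using z \<zeta> r1 by (intro mult_mono) auto
  also have "\<dots> \<le> cmod (1 - z * cnj w)" using ge[OF z] by simp
  finally show "cmod (1 - z * cnj \<zeta>) \<le> 2 * cmod (1 - z * cnj w)" by simp
qed

text \<open>Average \<open>G\<close> over Euclidean disks of radius proportional to the distance to the boundary;
  Tonelli's theorem then replaces \<open>\<lambda>\<close> by area measure.\<close>

lemma Carleson_nn_integral_le:
  fixes \<Lambda> :: "complex measure" and G :: "complex \<Rightarrow> real"
  assumes sf: "sigma_finite_measure \<Lambda>" and sets: "sets \<Lambda> = sets borel_disk"
    and r: "0 < r" "r < 1" and C: "0 \<le> C" and K: "0 \<le> K"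
    and Carleson: "\<And>\<zeta>. \<zeta> \<in> unit_disk \<Longrightarrow>
      emeasure \<Lambda> (pseudohyperbolic_disk \<zeta> r) \<le> ennreal (C * (1 - (cmod \<zeta>)\<^sup>2) powr t)"
    and G[measurable]: "G \<in> borel_measurable borel" and G_nonneg: "\<And>\<zeta>. \<zeta> \<in> unit_disk \<Longrightarrow> 0 \<le> G \<zeta>"
    and G_near: "\<And>w \<zeta>. w \<in> unit_disk \<Longrightarrow> cmod (\<zeta> - w) < r * (1 - cmod w) \<Longrightarrow> G w \<le> K * G \<zeta>"
  shows "(\<integral>\<^sup>+w. ennreal (G w) \<partial>\<Lambda>) \<le>
    ennreal (16 * K * C / (pi * r\<^sup>2)) * (\<integral>\<^sup>+\<zeta>. ennreal (G \<zeta> * (1 - (cmod \<zeta>)\<^sup>2) powr (t - 2)) \<partial>lborel_disk)"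
proof -
  have space: "space \<Lambda> = unit_disk"
    using sets_eq_imp_space_eq[OF sets] by (simp add: space_restrict_space)
  have sf': "sigma_finite_measure lborel_disk"
    using finite_measure_lborel_disk by (rule finite_measure.axioms(1))
  \<comment> \<open>\<open>pi * r ^ 2\<close> comes from the area of the averaging disk, and 16 from
    squaring \<open>1 - |\<zeta>| ^ 2 \<le> 4 * (1 - cmod w)\<close>.\<close>
  define Q where "Q = 16 * K / (pi * r\<^sup>2)"
  have Q: "0 \<le> Q" using K by (simp add: Q_def)
  define N where "N w \<zeta> = (if cmod (\<zeta> - w) < r * (1 - cmod w) then 1 else 0 :: real)" for w \<zeta>
  \<comment> \<open>\<open>F w\<close> dominates \<open>G w\<close> times the normalised indicator
    of the averaging disk at \<open>w\<close>. The area is expressed through \<open>\<zeta>\<close>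
    instead of \<open>w\<close>, so that for fixed \<open>\<zeta>\<close> only the measure of a set
    remains to be computed.\<close>
  define F where "F w \<zeta> = ennreal (Q * G \<zeta> / (1 - (cmod \<zeta>)\<^sup>2)\<^sup>2) * ennreal (N w \<zeta>)" for w \<zeta>
  have id_meas: "(\<lambda>w. w) \<in> borel_measurable \<Lambda>" "(\<lambda>w. w) \<in> borel_measurable lborel_disk"
    by (simp_all add: measurable_restrict_space1 sets cong: measurable_cong_sets)
  have [measurable]: "fst \<in> borel_measurable (\<Lambda> \<Otimes>\<^sub>M lborel_disk)"
    by (rule measurable_compose[OF measurable_fst id_meas(1)])
  have [measurable]: "snd \<in> borel_measurable (\<Lambda> \<Otimes>\<^sub>M lborel_disk)"
    by (rule measurable_compose[OF measurable_snd id_meas(2)])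
  have meas_F: "case_prod F \<in> borel_measurable (\<Lambda> \<Otimes>\<^sub>M lborel_disk)"
    unfolding F_def N_def case_prod_beta by measurable
  have pointwise: "ennreal (G w) \<le> (\<integral>\<^sup>+\<zeta>. F w \<zeta> \<partial>lborel_disk)" if w: "w \<in> unit_disk" for w
  proof -
    define \<rho> where "\<rho> = r * (1 - cmod w)"
    have w1: "cmod w < 1" using w by simp
    then have \<rho>: "0 < \<rho>" using r by (simp add: \<rho>_def)
    have sub: "ball w \<rho> \<subseteq> unit_disk"
      using near_in_unit_disk[OF w _ r] by (auto simp: \<rho>_def dist_norm norm_minus_commute)
    have le: "ennreal (G w / (pi * \<rho>\<^sup>2)) * indicator (ball w \<rho>) \<zeta> \<le> F w \<zeta>" for \<zeta>
    proof (cases "\<zeta> \<in> ball w \<rho>")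
      case True
      then have near: "cmod (\<zeta> - w) < r * (1 - cmod w)" by (simp add: \<rho>_def dist_norm norm_minus_commute)
      have \<zeta>: "\<zeta> \<in> unit_disk" using near_in_unit_disk[OF w near r] .
      have d: "0 < 1 - (cmod \<zeta>)\<^sup>2" using \<zeta> by (simp add: abs_square_less_1)
      have "1 - (cmod \<zeta>)\<^sup>2 \<le> 4 * (1 - cmod w)"
        using one_minus_cmod_square_bounds(2)[OF \<zeta>] near_boundary_distance(2)[OF w near r] by simp
      then have "(1 - (cmod \<zeta>)\<^sup>2)\<^sup>2 \<le> (4 * (1 - cmod w))\<^sup>2" using d by (intro power_mono) auto
      also have "\<dots> = 16 * (1 - cmod w)\<^sup>2" by (simp only: power_mult_distrib) simp
      finally have "pi * r\<^sup>2 * (1 - (cmod \<zeta>)\<^sup>2)\<^sup>2 \<le> pi * r\<^sup>2 * (16 * (1 - cmod w)\<^sup>2)"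
        by (intro mult_left_mono) auto
      then have "pi * r\<^sup>2 * (1 - (cmod \<zeta>)\<^sup>2)\<^sup>2 / 16 \<le> pi * \<rho>\<^sup>2"
        unfolding \<rho>_def power_mult_distrib by (simp add: mult_ac)
      moreover have "G w \<le> K * G \<zeta>" by (rule G_near[OF w near])
      ultimately have "G w / (pi * \<rho>\<^sup>2) \<le> K * G \<zeta> / (pi * r\<^sup>2 * (1 - (cmod \<zeta>)\<^sup>2)\<^sup>2 / 16)"
        using r d G_nonneg[OF w] by (intro frac_le) auto
      also have "\<dots> = Q * G \<zeta> / (1 - (cmod \<zeta>)\<^sup>2)\<^sup>2" by (simp add: Q_def)
      finally show ?thesis
        using True near by (simp add: F_def N_def ennreal_leI)
    qed simp
    have "ennreal (G w) = ennreal (G w / (pi * \<rho>\<^sup>2)) * emeasure lborel_disk (ball w \<rho>)"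
      using \<rho> G_nonneg[OF w] sub
      by (simp add: emeasure_restrict_space emeasure_lborel_ball_complex flip: ennreal_mult)
    also have "\<dots> = (\<integral>\<^sup>+\<zeta>. ennreal (G w / (pi * \<rho>\<^sup>2)) * indicator (ball w \<rho>) \<zeta> \<partial>lborel_disk)"
      using sub by (subst nn_integral_cmult_indicator) (auto simp: sets_restrict_space)
    also have "\<dots> \<le> (\<integral>\<^sup>+\<zeta>. F w \<zeta> \<partial>lborel_disk)" by (intro nn_integral_mono le)
    finally show ?thesis .
  qed
  \<comment> \<open>For fixed \<open>\<zeta>\<close> the averaging relation confines
    \<open>w\<close> to the pseudo-hyperbolic disk at \<open>\<zeta>\<close>, where the Carleson
    condition applies; dividing by the squared weight turns the exponent \<open>t\<close> into
    \<open>t - 2\<close>.\<close>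
  have inner: "(\<integral>\<^sup>+w. F w \<zeta> \<partial>\<Lambda>) \<le> ennreal (Q * C) * ennreal (G \<zeta> * (1 - (cmod \<zeta>)\<^sup>2) powr (t - 2))"
    if \<zeta>: "\<zeta> \<in> unit_disk" for \<zeta>
  proof -
    let ?c = "Q * G \<zeta> / (1 - (cmod \<zeta>)\<^sup>2)\<^sup>2"
    have d: "0 < 1 - (cmod \<zeta>)\<^sup>2" using \<zeta> by (simp add: abs_square_less_1)
    have c: "0 \<le> ?c" using Q G_nonneg[OF \<zeta>] by simp
    have "(\<integral>\<^sup>+w. F w \<zeta> \<partial>\<Lambda>) \<le> (\<integral>\<^sup>+w. ennreal ?c * indicator (pseudohyperbolic_disk \<zeta> r) w \<partial>\<Lambda>)"
    proof (rule nn_integral_mono)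
      fix w assume "w \<in> space \<Lambda>"
      then have w: "w \<in> unit_disk" by (simp add: space)
      show "F w \<zeta> \<le> ennreal ?c * indicator (pseudohyperbolic_disk \<zeta> r) w"
        using near_in_pseudohyperbolic_disk[OF w _ r, of \<zeta>] by (simp add: F_def N_def)
    qed
    also have "\<dots> = ennreal ?c * emeasure \<Lambda> (pseudohyperbolic_disk \<zeta> r)"
      using sets_disk_pseudohyperbolic_disk by (intro nn_integral_cmult_indicator) (simp add: sets)
    also have "\<dots> \<le> ennreal ?c * ennreal (C * (1 - (cmod \<zeta>)\<^sup>2) powr t)"
      by (intro mult_left_mono Carleson \<zeta>) simp
    also have "\<dots> = ennreal (?c * (C * (1 - (cmod \<zeta>)\<^sup>2) powr t))"
      by (rule ennreal_mult'[OF c, symmetric])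
    also have "?c * (C * (1 - (cmod \<zeta>)\<^sup>2) powr t) = (Q * C) * (G \<zeta> * (1 - (cmod \<zeta>)\<^sup>2) powr (t - 2))"
      using d by (simp add: powr_diff powr_numeral)
    also have "ennreal \<dots> = ennreal (Q * C) * ennreal (G \<zeta> * (1 - (cmod \<zeta>)\<^sup>2) powr (t - 2))"
      using Q C by (intro ennreal_mult') simp
    finally show ?thesis .
  qed
  have "(\<integral>\<^sup>+w. ennreal (G w) \<partial>\<Lambda>) \<le> (\<integral>\<^sup>+w. \<integral>\<^sup>+\<zeta>. F w \<zeta> \<partial>lborel_disk \<partial>\<Lambda>)"
    using pointwise by (intro nn_integral_mono) (simp add: space)
  also have "\<dots> = (\<integral>\<^sup>+\<zeta>. \<integral>\<^sup>+w. F w \<zeta> \<partial>\<Lambda> \<partial>lborel_disk)"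
    using meas_F sf sf' by (intro pair_sigma_finite.Fubini'[symmetric]) (simp_all add: pair_sigma_finite_def)
  also have "\<dots> \<le> (\<integral>\<^sup>+\<zeta>. ennreal (Q * C) * ennreal (G \<zeta> * (1 - (cmod \<zeta>)\<^sup>2) powr (t - 2)) \<partial>lborel_disk)"
    using inner by (intro nn_integral_mono) (simp add: space_lborel_disk)
  also have "\<dots> = ennreal (Q * C) * (\<integral>\<^sup>+\<zeta>. ennreal (G \<zeta> * (1 - (cmod \<zeta>)\<^sup>2) powr (t - 2)) \<partial>lborel_disk)"
    by (intro nn_integral_cmult measurable_lborel_disk_borel) measurable
  finally show ?thesis by (simp add: Q_def)
qed

text \<open>Tonelli's theorem needs sigma-finiteness before finiteness is known. Pseudo-hyperbolic
  disks with centres in a countable dense set cover the unit disk, and each has finite measure by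
  the Carleson condition.\<close>

lemma Carleson_sigma_finite:
  fixes \<Lambda> :: "complex measure"
  assumes sets: "sets \<Lambda> = sets borel_disk" and r: "0 < r" "r < 1"
    and Carleson: "\<And>\<zeta>. \<zeta> \<in> unit_disk \<Longrightarrow>
      emeasure \<Lambda> (pseudohyperbolic_disk \<zeta> r) \<le> ennreal (C * (1 - (cmod \<zeta>)\<^sup>2) powr t)"
  shows "sigma_finite_measure \<Lambda>"
proof
  have space: "space \<Lambda> = unit_disk"
    using sets_eq_imp_space_eq[OF sets] by (simp add: space_restrict_space)
  obtain Q :: "complex set" where Q: "countable Q" "\<And>X. open X \<Longrightarrow> X \<noteq> {} \<Longrightarrow> \<exists>q\<in>Q. q \<in> X"
    using countable_dense_exists by blast
  let ?A = "(\<lambda>q. pseudohyperbolic_disk q r) ` (Q \<inter> unit_disk)"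
  have cover: "w \<in> \<Union>?A" if w: "w \<in> unit_disk" for w
  proof -
    have "0 < r * (1 - cmod w)" using w r by simp
    then have "ball w (r * (1 - cmod w)) \<noteq> {}" by auto
    then obtain q where q: "q \<in> Q" "q \<in> ball w (r * (1 - cmod w))" using Q(2) open_ball by blast
    then have near: "cmod (q - w) < r * (1 - cmod w)" by (simp add: dist_norm norm_minus_commute)
    show ?thesis
      using near_in_unit_disk[OF w near r] near_in_pseudohyperbolic_disk[OF w near r] q by blast
  qed
  show "\<exists>A. countable A \<and> A \<subseteq> sets \<Lambda> \<and> \<Union>A = space \<Lambda> \<and> (\<forall>a\<in>A. emeasure \<Lambda> a \<noteq> \<infinity>)"
  proof (intro exI[of _ ?A] conjI ballI)
    show "countable ?A" using Q(1) by auto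
    show "?A \<subseteq> sets \<Lambda>" using sets_disk_pseudohyperbolic_disk by (auto simp: sets)
    show "\<Union>?A = space \<Lambda>" using cover pseudohyperbolic_disk_subset by (auto simp: space)
    fix a assume "a \<in> ?A"
    then obtain q where "a = pseudohyperbolic_disk q r" "q \<in> unit_disk" by auto
    then have "emeasure \<Lambda> a < top" using le_less_trans[OF Carleson ennreal_less_top] by simp
    then show "emeasure \<Lambda> a \<noteq> \<infinity>" by simp
  qed
qed

text \<open>The averaging estimate with \<open>G = 1\<close> and \<open>K = 1\<close>; the remaining
  integral of \<open>(1 - |w| ^ 2) powr (t - 2)\<close> converges because \<open>t > 1\<close>.
  Applied to the total variation, it supplies the finiteness on which the Jordan decomposition
  rests.\<close>

lemma Carleson_finite:
  fixes \<Lambda> :: "complex measure"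
  assumes sets: "sets \<Lambda> = sets borel_disk" and r: "0 < r" "r < 1" and t: "t > 1" and C: "0 \<le> C"
    and Carleson: "\<And>\<zeta>. \<zeta> \<in> unit_disk \<Longrightarrow>
      emeasure \<Lambda> (pseudohyperbolic_disk \<zeta> r) \<le> ennreal (C * (1 - (cmod \<zeta>)\<^sup>2) powr t)"
  shows "emeasure \<Lambda> (space \<Lambda>) < \<infinity>"
proof -
  have "emeasure \<Lambda> (space \<Lambda>) = (\<integral>\<^sup>+w. ennreal 1 \<partial>\<Lambda>)" by simp
  also have "\<dots> \<le> ennreal (16 * 1 * C / (pi * r\<^sup>2)) * (\<integral>\<^sup>+\<zeta>. ennreal (1 * (1 - (cmod \<zeta>)\<^sup>2) powr (t - 2)) \<partial>lborel_disk)"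
    using Carleson C by (intro Carleson_nn_integral_le[OF Carleson_sigma_finite[OF sets r Carleson] sets r]) auto
  also have "\<dots> < \<infinity>"
    using nn_integral_disk_weight[of "t - 2"] t by (simp add: ennreal_mult_less_top)
  finally show ?thesis .
qed

section \<open>Differentiating the integral transform\<close>

text \<open>Difference quotients are bounded by \<open>B\<close> through the mean value inequality
  on the convex set \<open>S\<close>, and constants are integrable for a finite measure, so
  dominated convergence applies.\<close>

lemma has_field_derivative_integral:
  fixes K K' :: "complex \<Rightarrow> 'a \<Rightarrow> complex"
  assumes fin: "finite_measure M" and S: "open S" "convex S" "z \<in> S"
    and K: "\<And>\<zeta>. \<zeta> \<in> S \<Longrightarrow> integrable M (K \<zeta>)" and K': "K' z \<in> borel_measurable M"
    and der: "\<And>\<zeta> w. \<zeta> \<in> S \<Longrightarrow> w \<in> space M \<Longrightarrow> ((\<lambda>\<zeta>. K \<zeta> w) has_field_derivative K' \<zeta> w) (at \<zeta>)"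
    and bd: "\<And>\<zeta> w. \<zeta> \<in> S \<Longrightarrow> w \<in> space M \<Longrightarrow> cmod (K' \<zeta> w) \<le> B"
  shows "((\<lambda>\<zeta>. LINT w|M. K \<zeta> w) has_field_derivative (LINT w|M. K' z w)) (at z)"
proof -
  let ?F = "\<lambda>\<zeta>. LINT w|M. K \<zeta> w"
  have "((\<lambda>y. (?F y - ?F z) / (y - z)) \<longlongrightarrow> (LINT w|M. K' z w)) (at z within S)"
    unfolding tendsto_at_iff_sequentially comp_def
  proof (intro allI impI)
    fix X assume X: "\<forall>i. X i \<in> S - {z}" and lim: "X \<longlonglongrightarrow> z"
    have "(\<lambda>i. LINT w|M. (K (X i) w - K z w) / (X i - z)) \<longlonglongrightarrow> (LINT w|M. K' z w)"
    proof (rule integral_dominated_convergence[where w = "\<lambda>_. B"])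
      show "integrable M (\<lambda>_. B)"
        using fin by (rule finite_measure.integrable_const)
      show "(\<lambda>w. (K (X i) w - K z w) / (X i - z)) \<in> borel_measurable M" for i
        using K X S by (intro borel_measurable_divide borel_measurable_diff borel_measurable_integrable) auto
      show "AE w in M. (\<lambda>i. (K (X i) w - K z w) / (X i - z)) \<longlonglongrightarrow> K' z w"
      proof (intro AE_I2)
        fix w assume w: "w \<in> space M"
        have "((\<lambda>y. (K y w - K z w) / (y - z)) \<longlongrightarrow> K' z w) (at z)"
          using der[OF S(3) w] by (simp add: has_field_derivative_iff)
        moreover have "filterlim X (at z) sequentially"
          using X lim by (intro filterlim_atI) auto
        ultimately show "(\<lambda>i. (K (X i) w - K z w) / (X i - z)) \<longlonglongrightarrow> K' z w"
          by (rule filterlim_compose)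
      qed
      show "AE w in M. norm ((K (X i) w - K z w) / (X i - z)) \<le> B" for i
      proof (intro AE_I2)
        fix w assume w: "w \<in> space M"
        have "cmod (K (X i) w - K z w) \<le> B * cmod (X i - z)"
          using X S der[OF _ w] bd[OF _ w]
          by (intro field_differentiable_bound[OF S(2)]) (auto intro: has_field_derivative_at_within)
        moreover have "X i \<noteq> z" using X by auto
        ultimately show "norm ((K (X i) w - K z w) / (X i - z)) \<le> B"
          by (simp add: norm_divide pos_divide_le_eq)
      qed
    qed (rule K')
    moreover have "(LINT w|M. (K (X i) w - K z w) / (X i - z)) = (?F (X i) - ?F z) / (X i - z)" for i
      by (subst integral_divide_zero, subst Bochner_Integration.integral_diff) (use K X S in auto)
    ultimately show "(\<lambda>i. (?F (X i) - ?F z) / (X i - z)) \<longlonglongrightarrow> (LINT w|M. K' z w)" by (simp only:)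
  qed
  then show ?thesis
    using S by (simp add: has_field_derivative_iff at_within_open[OF S(3,1)])
qed

text \<open>The derivative of order \<open>j + 1\<close> in \<open>z\<close> of the Moebius kernel,
  divided by \<open>fact (j + 1)\<close>. Index 0 is the first derivative, since the kernel itself
  does not fit the pattern.\<close>

definition Mobius_kernel_deriv :: "nat \<Rightarrow> complex \<Rightarrow> complex \<Rightarrow> complex"
  where "Mobius_kernel_deriv j z w = of_real (1 - (cmod w)\<^sup>2) * cnj w ^ j / (1 - z * cnj w) ^ (j + 2)"

definition Mobius_transform :: "complex measure \<Rightarrow> complex \<Rightarrow> complex"
  where "Mobius_transform \<Lambda> z = (LINT w|\<Lambda>. (z - w) / (1 - z * cnj w))"

lemma Mobius_kernel_has_derivative:
  assumes "z \<in> unit_disk" "w \<in> unit_disk"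
  shows "((\<lambda>z. (z - w) / (1 - z * cnj w)) has_field_derivative Mobius_kernel_deriv 0 z w) (at z)"
proof -
  have ne: "1 - z * cnj w \<noteq> 0" using assms by (rule one_minus_mult_cnj_nonzero)
  have "((\<lambda>z. z - w) has_field_derivative 1) (at z)"
    "((\<lambda>z. 1 - z * cnj w) has_field_derivative - cnj w) (at z)"
    by (auto intro!: derivative_eq_intros)
  from DERIV_divide[OF this ne]
  have "((\<lambda>z. (z - w) / (1 - z * cnj w)) has_field_derivative
      (1 * (1 - z * cnj w) - (z - w) * - cnj w) / ((1 - z * cnj w) * (1 - z * cnj w))) (at z)" .
  moreover have "1 * (1 - z * cnj w) - (z - w) * - cnj w = of_real (1 - (cmod w)\<^sup>2)"
    unfolding of_real_diff complex_norm_square by (simp add: algebra_simps)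
  ultimately show ?thesis
    by (simp only: Mobius_kernel_deriv_def power_0 mult_1_right add_0 power2_eq_square)
qed

lemma Mobius_kernel_deriv_has_derivative:
  assumes "z \<in> unit_disk" "w \<in> unit_disk"
  shows "((\<lambda>z. Mobius_kernel_deriv j z w) has_field_derivative of_nat (j + 2) * Mobius_kernel_deriv (Suc j) z w) (at z)"
proof -
  have ne: "1 - z * cnj w \<noteq> 0" using assms by (rule one_minus_mult_cnj_nonzero)
  let ?D = "1 - z * cnj w" and ?c = "of_real (1 - (cmod w)\<^sup>2) * cnj w ^ j"
  have den: "((\<lambda>z. 1 - z * cnj w) has_field_derivative - cnj w) (at z)"
    by (auto intro!: derivative_eq_intros)
  have pow: "((\<lambda>z. (1 - z * cnj w) ^ (j + 2)) has_field_derivative of_nat (j + 2) * ?D ^ (j + 1) * (- cnj w)) (at z)"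
    by (rule DERIV_cong[OF DERIV_power[OF den]]) simp
  have "?D ^ (j + 2) \<noteq> 0" using ne by simp
  from DERIV_divide[OF DERIV_const[of ?c] pow this]
  have "((\<lambda>z. ?c / (1 - z * cnj w) ^ (j + 2)) has_field_derivative
      (0 * ?D ^ (j + 2) - ?c * (of_nat (j + 2) * ?D ^ (j + 1) * (- cnj w))) / (?D ^ (j + 2) * ?D ^ (j + 2))) (at z)" .
  moreover have "(0 * ?D ^ (j + 2) - ?c * (of_nat (j + 2) * ?D ^ (j + 1) * (- cnj w))) / (?D ^ (j + 2) * ?D ^ (j + 2)) =
      of_nat (j + 2) * Mobius_kernel_deriv (Suc j) z w"
  proof -
    have "?D ^ (j + 2) * ?D ^ (j + 2) = ?D ^ (j + 1) * ?D ^ (Suc j + 2)"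
      by (simp add: mult_ac flip: power_add)
    moreover have "0 * ?D ^ (j + 2) - ?c * (of_nat (j + 2) * ?D ^ (j + 1) * (- cnj w)) =
        ?D ^ (j + 1) * (of_nat (j + 2) * (of_real (1 - (cmod w)\<^sup>2) * cnj w ^ Suc j))"
      by simp
    ultimately show ?thesis
      using ne by (simp only: Mobius_kernel_deriv_def) simp
  qed
  ultimately show ?thesis by (simp only: Mobius_kernel_deriv_def)
qed

lemma Mobius_kernel_deriv_bound:
  assumes z: "z \<in> unit_disk" and w: "w \<in> unit_disk"
  shows "cmod (Mobius_kernel_deriv j z w) \<le> (1 - (cmod w)\<^sup>2) / cmod (1 - z * cnj w) ^ (j + 2)"
    and "cmod (Mobius_kernel_deriv j z w) \<le> 1 / (1 - cmod z) ^ (j + 2)"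
proof -
  have d: "0 < 1 - (cmod w)\<^sup>2" "1 - (cmod w)\<^sup>2 \<le> 1" using one_minus_cmod_square_pos[OF w] by simp_all
  have "cmod (cnj w ^ j) \<le> 1" using w by (auto simp: norm_power intro!: power_le_one)
  then have num: "(1 - (cmod w)\<^sup>2) * cmod (cnj w ^ j) \<le> 1 - (cmod w)\<^sup>2" using d by (intro mult_left_le) auto
  have eq: "cmod (Mobius_kernel_deriv j z w) = (1 - (cmod w)\<^sup>2) * cmod (cnj w ^ j) / cmod (1 - z * cnj w) ^ (j + 2)"
    unfolding Mobius_kernel_deriv_def norm_divide norm_mult[of "of_real _"] norm_of_real norm_power[of "1 - z * cnj w"]
    using d by simp
  show "cmod (Mobius_kernel_deriv j z w) \<le> (1 - (cmod w)\<^sup>2) / cmod (1 - z * cnj w) ^ (j + 2)"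
    unfolding eq by (intro divide_right_mono num) simp
  also have "\<dots> \<le> 1 / (1 - cmod z) ^ (j + 2)"
    using d z cmod_one_minus_mult_cnj_ge[OF w, of z] by (intro frac_le power_mono) auto
  finally show "cmod (Mobius_kernel_deriv j z w) \<le> 1 / (1 - cmod z) ^ (j + 2)" .
qed

lemma sets_borel_disk_measurable:
  assumes sets: "sets \<Lambda> = sets borel_disk" and f: "continuous_on unit_disk f"
  shows "f \<in> borel_measurable \<Lambda>"
  using borel_measurable_continuous_on_restrict[OF f] by (simp add: sets cong: measurable_cong_sets)

context
  fixes \<Lambda> :: "complex measure"
  assumes sets: "sets \<Lambda> = sets borel_disk" and fin: "finite_measure \<Lambda>"
begin

lemma space_eq_unit_disk: "space \<Lambda> = unit_disk"
  using sets_eq_imp_space_eq[OF sets] by (simp add: space_restrict_space)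

lemma Mobius_kernel_integrable:
  assumes z: "z \<in> unit_disk"
  shows "integrable \<Lambda> (\<lambda>w. (z - w) / (1 - z * cnj w))"
proof (rule finite_measure.integrable_const_bound[OF fin])
  show "(\<lambda>w. (z - w) / (1 - z * cnj w)) \<in> borel_measurable \<Lambda>"
    using one_minus_mult_cnj_nonzero[OF z]
    by (intro sets_borel_disk_measurable[OF sets] continuous_intros) auto
  show "AE w in \<Lambda>. cmod ((z - w) / (1 - z * cnj w)) \<le> 2 / (1 - cmod z)"
  proof (intro AE_I2)
    fix w assume "w \<in> space \<Lambda>"
    then have w: "w \<in> unit_disk" by (simp add: space_eq_unit_disk)
    have "cmod (z - w) \<le> 2" using norm_triangle_ineq4[of z w] z w by simp
    then show "cmod ((z - w) / (1 - z * cnj w)) \<le> 2 / (1 - cmod z)"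
      using z cmod_one_minus_mult_cnj_ge[OF w, of z] unfolding norm_divide by (intro frac_le) auto
  qed
qed

lemma Mobius_kernel_deriv_integrable:
  assumes z: "z \<in> unit_disk"
  shows "integrable \<Lambda> (Mobius_kernel_deriv j z)"
proof (rule finite_measure.integrable_const_bound[OF fin])
  show "Mobius_kernel_deriv j z \<in> borel_measurable \<Lambda>"
    unfolding Mobius_kernel_deriv_def using one_minus_mult_cnj_nonzero[OF z]
    by (intro sets_borel_disk_measurable[OF sets] continuous_intros) auto
  show "AE w in \<Lambda>. cmod (Mobius_kernel_deriv j z w) \<le> 1 / (1 - cmod z) ^ (j + 2)"
    using Mobius_kernel_deriv_bound(2)[OF z] by (intro AE_I2) (simp add: space_eq_unit_disk)
qed

text \<open>Around \<open>z\<close> the argument stays in the disk of radius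
  \<open>(1 + cmod z) / 2\<close>, where the kernel derivatives are bounded uniformly in both
  variables, as \<open>has_field_derivative_integral\<close> requires.\<close>

lemma
  assumes z: "z \<in> unit_disk"
  shows Mobius_transform_has_derivative:
      "(Mobius_transform \<Lambda> has_field_derivative (LINT w|\<Lambda>. Mobius_kernel_deriv 0 z w)) (at z)"
    and Mobius_kernel_deriv_integral_has_derivative:
      "((\<lambda>z. LINT w|\<Lambda>. Mobius_kernel_deriv j z w) has_field_derivative
        of_nat (j + 2) * (LINT w|\<Lambda>. Mobius_kernel_deriv (Suc j) z w)) (at z)"
proof -
  define \<rho> where "\<rho> = (1 + cmod z) / 2"
  have \<rho>: "cmod z < \<rho>" "\<rho> < 1" using z by (simp_all add: \<rho>_def)
  have sub: "\<zeta> \<in> unit_disk" if "\<zeta> \<in> ball 0 \<rho>" for \<zeta> :: complex using that \<rho> by simp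
  have S: "open (ball (0::complex) \<rho>)" "convex (ball (0::complex) \<rho>)" "z \<in> ball 0 \<rho>" using \<rho> by simp_all
  have bd: "cmod (Mobius_kernel_deriv j \<zeta> w) \<le> 1 / (1 - \<rho>) ^ (j + 2)"
    if "\<zeta> \<in> ball 0 \<rho>" "w \<in> space \<Lambda>" for \<zeta> w j
  proof -
    have "cmod (Mobius_kernel_deriv j \<zeta> w) \<le> 1 / (1 - cmod \<zeta>) ^ (j + 2)"
      using that sub by (intro Mobius_kernel_deriv_bound(2)) (simp_all add: space_eq_unit_disk)
    also have "\<dots> \<le> 1 / (1 - \<rho>) ^ (j + 2)"
      using that \<rho> by (intro frac_le power_mono) auto
    finally show ?thesis .
  qed
  show "(Mobius_transform \<Lambda> has_field_derivative (LINT w|\<Lambda>. Mobius_kernel_deriv 0 z w)) (at z)"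
    unfolding Mobius_transform_def[abs_def]
  proof (rule has_field_derivative_integral[OF fin S])
    show "Mobius_kernel_deriv 0 z \<in> borel_measurable \<Lambda>"
      using Mobius_kernel_deriv_integrable[OF z] by simp
  qed (use bd sub Mobius_kernel_integrable Mobius_kernel_has_derivative in \<open>auto simp: space_eq_unit_disk\<close>)
  have "((\<lambda>z. LINT w|\<Lambda>. Mobius_kernel_deriv j z w) has_field_derivative
      (LINT w|\<Lambda>. of_nat (j + 2) * Mobius_kernel_deriv (Suc j) z w)) (at z)"
  proof (rule has_field_derivative_integral[OF fin S])
    show "(\<lambda>w. of_nat (j + 2) * Mobius_kernel_deriv (Suc j) z w) \<in> borel_measurable \<Lambda>"
      using Mobius_kernel_deriv_integrable[OF z] by (intro borel_measurable_times) auto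
    show "cmod (of_nat (j + 2) * Mobius_kernel_deriv (Suc j) \<zeta> w) \<le> real (j + 2) * (1 / (1 - \<rho>) ^ (Suc j + 2))"
      if "\<zeta> \<in> ball 0 \<rho>" "w \<in> space \<Lambda>" for \<zeta> w
      using bd[OF that, of "Suc j"] unfolding norm_mult norm_of_nat by (intro mult_left_mono) auto
    show "((\<lambda>\<zeta>. Mobius_kernel_deriv j \<zeta> w) has_field_derivative of_nat (j + 2) * Mobius_kernel_deriv (Suc j) \<zeta> w) (at \<zeta>)"
      if "\<zeta> \<in> ball 0 \<rho>" "w \<in> space \<Lambda>" for \<zeta> w
      using that sub by (intro Mobius_kernel_deriv_has_derivative) (simp_all add: space_eq_unit_disk)
  qed (use sub Mobius_kernel_deriv_integrable in auto)
  then show "((\<lambda>z. LINT w|\<Lambda>. Mobius_kernel_deriv j z w) has_field_derivative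
      of_nat (j + 2) * (LINT w|\<Lambda>. Mobius_kernel_deriv (Suc j) z w)) (at z)"
    by (simp only: integral_mult_right_zero)
qed

lemma Mobius_transform_holomorphic: "Mobius_transform \<Lambda> holomorphic_on unit_disk"
  unfolding holomorphic_on_open[OF open_ball] using Mobius_transform_has_derivative by blast

lemma higher_deriv_Mobius_transform:
  assumes "z \<in> unit_disk"
  shows "(deriv ^^ Suc n) (Mobius_transform \<Lambda>) z = fact (Suc n) * (LINT w|\<Lambda>. Mobius_kernel_deriv n z w)"
  using assms
proof (induction n arbitrary: z)
  case 0
  then show ?case using DERIV_imp_deriv[OF Mobius_transform_has_derivative] by simp
next
  case (Suc n)
  have "((\<lambda>z. fact (Suc n) * (LINT w|\<Lambda>. Mobius_kernel_deriv n z w)) has_field_derivative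
      fact (Suc n) * (of_nat (n + 2) * (LINT w|\<Lambda>. Mobius_kernel_deriv (Suc n) z w))) (at z)"
    by (intro DERIV_cmult Mobius_kernel_deriv_integral_has_derivative Suc.prems)
  then have "((deriv ^^ Suc n) (Mobius_transform \<Lambda>) has_field_derivative
      fact (Suc n) * (of_nat (n + 2) * (LINT w|\<Lambda>. Mobius_kernel_deriv (Suc n) z w))) (at z)"
    by (rule has_field_derivative_transform_within_open[OF _ open_ball Suc.prems]) (simp only: Suc.IH)
  then have "(deriv ^^ Suc (Suc n)) (Mobius_transform \<Lambda>) z =
      fact (Suc n) * (of_nat (n + 2) * (LINT w|\<Lambda>. Mobius_kernel_deriv (Suc n) z w))"
    by (simp only: funpow.simps(2) comp_apply DERIV_imp_deriv)
  also have "\<dots> = fact (Suc (Suc n)) * (LINT w|\<Lambda>. Mobius_kernel_deriv (Suc n) z w)"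
    by (simp add: algebra_simps)
  finally show ?case .
qed

lemma weighted_bound_Mobius_transform:
  assumes t: "t > 1" and k: "real k > t" and r: "0 < r" "r < 1" and C: "0 \<le> C"
    and Carleson: "\<And>\<zeta>. \<zeta> \<in> unit_disk \<Longrightarrow>
      emeasure \<Lambda> (pseudohyperbolic_disk \<zeta> r) \<le> ennreal (C * (1 - (cmod \<zeta>)\<^sup>2) powr t)"
  shows "weighted_bound (real k - t) ((deriv ^^ k) (Mobius_transform \<Lambda>))"
proof -
  obtain n where n: "k = Suc n" using t k by (cases k) auto
  \<comment> \<open>\<open>2 / (1 - r)\<close> bounds the change of \<open>1 - |w| ^ 2\<close> over
    an averaging disk and \<open>2 ^ (k + 1)\<close> that of the denominator of \<open>G\<close>;
    \<open>A\<close> and \<open>E\<close> are the constants of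
    \<open>Carleson_nn_integral_le\<close> and \<open>Forelli_Rudin_estimate\<close>.\<close>
  define K where "K = 2 / (1 - r) * 2 ^ (k + 1)"
  define A where "A = 16 * K * C / (pi * r\<^sup>2)"
  define E where "E = 2 ^ (k - 1) * pi * (1 + 1 / (real k - t))"
  have nonneg: "0 \<le> K" "0 \<le> A" "0 \<le> E" using r C k by (simp_all add: K_def A_def E_def)
  show ?thesis
  proof (rule weighted_boundI)
    fix z :: complex assume z: "z \<in> unit_disk"
    \<comment> \<open>Majorant of the kernel for the derivative of order \<open>k\<close>: its index
      is \<open>n = k - 1\<close>, so the power \<open>n + 2\<close> is
      \<open>k + 1\<close>.\<close>
    define G where "G w = (1 - (cmod w)\<^sup>2) / cmod (1 - z * cnj w) ^ (k + 1)" for w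
    have [measurable]: "G \<in> borel_measurable borel" unfolding G_def by measurable
    have G_nonneg: "0 \<le> G w" if "w \<in> unit_disk" for w
      using one_minus_cmod_square_pos[OF that] by (simp add: G_def)
    have G_near: "G w \<le> K * G \<zeta>" if w: "w \<in> unit_disk" and near: "cmod (\<zeta> - w) < r * (1 - cmod w)" for w \<zeta>
    proof -
      have \<zeta>: "\<zeta> \<in> unit_disk" using near_in_unit_disk[OF w near r] .
      have pos: "0 < cmod (1 - z * cnj \<zeta>)" using one_minus_mult_cnj_nonzero[OF z \<zeta>] by simp
      have "(1 - r) * (1 - (cmod w)\<^sup>2) \<le> (1 - r) * (2 * (1 - cmod w))"
        using one_minus_cmod_square_bounds(2)[OF w] r by (intro mult_left_mono) auto
      also have "\<dots> \<le> 2 * (1 - (cmod \<zeta>)\<^sup>2)"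
        unfolding mult.left_commute[of "1 - r" 2]
        by (intro mult_left_mono
            order_trans[OF near_boundary_distance(1)[OF w near r] one_minus_cmod_square_bounds(1)[OF \<zeta>]]) simp
      finally have num: "1 - (cmod w)\<^sup>2 \<le> 2 / (1 - r) * (1 - (cmod \<zeta>)\<^sup>2)"
        using r by (simp add: field_simps)
      have "(cmod (1 - z * cnj \<zeta>) / 2) ^ (k + 1) \<le> cmod (1 - z * cnj w) ^ (k + 1)"
        using near_kernel[OF w near r z] by (intro power_mono) auto
      then have "G w \<le> 2 / (1 - r) * (1 - (cmod \<zeta>)\<^sup>2) / (cmod (1 - z * cnj \<zeta>) / 2) ^ (k + 1)"
        unfolding G_def using num pos one_minus_cmod_square_pos[OF w] one_minus_cmod_square_pos[OF \<zeta>] r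
        by (intro frac_le zero_less_power) auto
      also have "\<dots> = K * G \<zeta>" by (simp add: K_def G_def power_divide)
      finally show ?thesis .
    qed
    let ?I = "LINT w|\<Lambda>. Mobius_kernel_deriv n z w"
    have "ennreal (cmod ?I) \<le> (\<integral>\<^sup>+w. ennreal (cmod (Mobius_kernel_deriv n z w)) \<partial>\<Lambda>)"
      by (intro integral_norm_bound_ennreal Mobius_kernel_deriv_integrable z)
    also have "\<dots> \<le> (\<integral>\<^sup>+w. ennreal (G w) \<partial>\<Lambda>)"
      using Mobius_kernel_deriv_bound(1)[OF z, of _ n]
      by (intro nn_integral_mono ennreal_leI) (simp add: G_def n space_eq_unit_disk)
    also have "\<dots> \<le> ennreal A * (\<integral>\<^sup>+\<zeta>. ennreal (G \<zeta> * (1 - (cmod \<zeta>)\<^sup>2) powr (t - 2)) \<partial>lborel_disk)"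
      unfolding A_def using Carleson G_near G_nonneg nonneg C r
      by (intro Carleson_nn_integral_le sets finite_measure.axioms(1)[OF fin]) auto
    also have "(\<integral>\<^sup>+\<zeta>. ennreal (G \<zeta> * (1 - (cmod \<zeta>)\<^sup>2) powr (t - 2)) \<partial>lborel_disk) =
        (\<integral>\<^sup>+\<zeta>. ennreal ((1 - (cmod \<zeta>)\<^sup>2) powr (t - 1) / cmod (1 - z * cnj \<zeta>) ^ (k + 1)) \<partial>lborel_disk)"
    proof (intro nn_integral_cong arg_cong[where f = ennreal])
      fix \<zeta> assume "\<zeta> \<in> space lborel_disk"
      then have "0 < 1 - (cmod \<zeta>)\<^sup>2" by (intro one_minus_cmod_square_pos) (simp add: space_lborel_disk)
      then have "(1 - (cmod \<zeta>)\<^sup>2) powr (t - 1) = (1 - (cmod \<zeta>)\<^sup>2) * (1 - (cmod \<zeta>)\<^sup>2) powr (t - 2)"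
        using powr_mult_base[of "1 - (cmod \<zeta>)\<^sup>2" "t - 2"] by simp
      then show "G \<zeta> * (1 - (cmod \<zeta>)\<^sup>2) powr (t - 2) =
          (1 - (cmod \<zeta>)\<^sup>2) powr (t - 1) / cmod (1 - z * cnj \<zeta>) ^ (k + 1)"
        by (simp add: G_def)
    qed
    also have "\<dots> \<le> ennreal (E * (1 - (cmod z)\<^sup>2) powr (t - real k))"
      unfolding E_def by (rule Forelli_Rudin_estimate[OF t k z])
    finally have "ennreal (cmod ?I) \<le> ennreal A * ennreal (E * (1 - (cmod z)\<^sup>2) powr (t - real k))"
      by (simp add: mult_left_mono)
    also have "\<dots> = ennreal (A * (E * (1 - (cmod z)\<^sup>2) powr (t - real k)))"
      using nonneg by (simp add: ennreal_mult')
    finally have "cmod ?I \<le> A * (E * (1 - (cmod z)\<^sup>2) powr (t - real k))"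
      using nonneg by (subst (asm) ennreal_le_iff) auto
    then have "fact k * cmod ?I \<le> fact k * (A * (E * (1 - (cmod z)\<^sup>2) powr (t - real k)))"
      by (intro mult_left_mono) auto
    then show "cmod ((deriv ^^ k) (Mobius_transform \<Lambda>) z) \<le> (fact k * A * E) * (1 - (cmod z)\<^sup>2) powr (- (real k - t))"
      unfolding n higher_deriv_Mobius_transform[OF z] norm_mult norm_fact by (simp add: n mult.assoc)
  qed
qed

end

section \<open>The Carleson condition\<close>

lemma variation_cong_sets: "sets M = sets N \<Longrightarrow> variation M \<mu> = variation N \<mu>"
  by (simp add: variation_def fun_eq_iff)

text \<open>The theorem speaks of \<open>borel_disk\<close>, while densities are taken on
  \<open>lborel_disk\<close>. These notions see a measure only through its sigma-algebra, so the two
  can be exchanged.\<close>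

lemma
  assumes "sets M = sets N"
  shows vector_measure_cong_sets: "vector_measure M \<mu> = vector_measure N \<mu>"
    and total_variation_measure_cong_sets: "total_variation_measure M \<mu> = total_variation_measure N \<mu>"
    and complex_measure_integral_cong_sets: "complex_measure_integral M \<mu> = complex_measure_integral N \<mu>"
  using assms sets_eq_imp_space_eq[OF assms]
  by (simp_all add: vector_measure_def total_variation_measure_def complex_measure_integral_def
      signed_integral_def positive_variation_measure_def negative_variation_measure_def
      variation_cong_sets[OF assms] fun_eq_iff)

lemma sets_lborel_disk: "sets lborel_disk = sets borel_disk"
  by (simp add: sets_restrict_space)

section \<open>Geometry of pseudo-hyperbolic disks and the Carleson bound for densities\<close>

lemma one_minus_pseudohyperbolic_distance_square:
  assumes z: "z \<in> unit_disk" and w: "w \<in> unit_disk"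
  shows "1 - (cmod ((z - w) / (1 - z * cnj w)))\<^sup>2 =
    (1 - (cmod z)\<^sup>2) * (1 - (cmod w)\<^sup>2) / (cmod (1 - z * cnj w))\<^sup>2"
proof -
  have ne: "(cmod (1 - z * cnj w))\<^sup>2 \<noteq> 0" using one_minus_mult_cnj_nonzero[OF z w] by simp
  have "(cmod (1 - z * cnj w))\<^sup>2 - (cmod (z - w))\<^sup>2 = (1 - (cmod z)\<^sup>2) * (1 - (cmod w)\<^sup>2)"
    unfolding cmod_power2 by (simp add: algebra_simps power2_eq_square)
  then show ?thesis using ne by (simp add: norm_divide power_divide field_simps)
qed

text \<open>With \<open>q = 1 - r ^ 2\<close>, \<open>x\<close> and \<open>y\<close> the two weights
  and \<open>D\<close> the modulus of \<open>1 - z * cnj w\<close>, the preceding identity gives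
  \<open>q * D ^ 2 \<le> x * y\<close>. Together with \<open>x \<le> 2 * D\<close> and
  \<open>y \<le> 2 * D\<close> it makes \<open>x\<close> and \<open>y\<close> comparable and bounds
  \<open>D\<close>, hence \<open>cmod (z - w)\<close>, by a multiple of \<open>x\<close>.\<close>

lemma
  assumes z: "z \<in> unit_disk" and w: "w \<in> pseudohyperbolic_disk z r" and r: "0 < r" "r < 1"
  shows pseudohyperbolic_disk_weight_ge: "(1 - r\<^sup>2) / 4 * (1 - (cmod z)\<^sup>2) \<le> 1 - (cmod w)\<^sup>2"
    and pseudohyperbolic_disk_weight_le: "(1 - r\<^sup>2) / 4 * (1 - (cmod w)\<^sup>2) \<le> 1 - (cmod z)\<^sup>2"
    and pseudohyperbolic_disk_dist_le: "cmod (z - w) \<le> 4 / (1 - r\<^sup>2) * (1 - (cmod z)\<^sup>2)"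
proof -
  let ?x = "1 - (cmod z)\<^sup>2" and ?y = "1 - (cmod w)\<^sup>2" and ?D = "cmod (1 - z * cnj w)"
  have w': "w \<in> unit_disk" and near: "cmod ((z - w) / (1 - z * cnj w)) < r"
    using w by (auto simp: pseudohyperbolic_disk_def)
  have xy: "0 < ?x" "0 < ?y" using z w' by (blast intro: one_minus_cmod_square_pos)+
  have D: "0 < ?D" using one_minus_mult_cnj_nonzero[OF z w'] by simp
  have r2: "0 < 1 - r\<^sup>2" using r by (simp add: abs_square_less_1)
  have "(cmod ((z - w) / (1 - z * cnj w)))\<^sup>2 \<le> r\<^sup>2" using near r by (intro power_mono) auto
  then have "1 - r\<^sup>2 \<le> ?x * ?y / ?D\<^sup>2"
    using one_minus_pseudohyperbolic_distance_square[OF z w'] by simp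
  then have key: "(1 - r\<^sup>2) * ?D\<^sup>2 \<le> ?x * ?y" using D by (simp add: pos_le_divide_eq)
  have "?x \<le> 2 * ?D" "?y \<le> 2 * ?D"
    using one_minus_cmod_square_bounds(2)[OF z] one_minus_cmod_square_bounds(2)[OF w']
      cmod_one_minus_mult_cnj_ge[OF w', of z] cmod_one_minus_ge[of z w] z by auto
  then have "?x * ?x \<le> (2 * ?D) * (2 * ?D)" "?y * ?y \<le> (2 * ?D) * (2 * ?D)"
    using xy D by (intro mult_mono; simp)+
  then have sq: "?x * ?x / 4 \<le> ?D\<^sup>2" "?y * ?y / 4 \<le> ?D\<^sup>2" by (simp_all add: power2_eq_square)
  have "(1 - r\<^sup>2) * (?x * ?x / 4) \<le> ?x * ?y"
    by (rule order_trans[OF mult_left_mono[OF sq(1)] key]) (use r2 in simp)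
  then have "?x * ((1 - r\<^sup>2) / 4 * ?x) \<le> ?x * ?y" by (simp add: mult_ac)
  then show ge: "(1 - r\<^sup>2) / 4 * ?x \<le> ?y" using xy by (simp only: mult_le_cancel_left_pos)
  have "(1 - r\<^sup>2) * (?y * ?y / 4) \<le> ?x * ?y"
    by (rule order_trans[OF mult_left_mono[OF sq(2)] key]) (use r2 in simp)
  then have "?y * ((1 - r\<^sup>2) / 4 * ?y) \<le> ?y * ?x" by (simp add: mult_ac)
  then show le: "(1 - r\<^sup>2) / 4 * ?y \<le> ?x" using xy by (simp only: mult_le_cancel_left_pos)
  have "cmod (z - w) < r * ?D" using near D by (simp add: norm_divide pos_divide_less_eq)
  moreover have "r * ?D \<le> 1 * ?D" using r by (intro mult_right_mono) auto
  ultimately have "cmod (z - w) \<le> ?D" by simp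
  moreover have "d \<le> 4 / q * x" if "q * d\<^sup>2 \<le> x * y" "q / 4 * y \<le> x" "0 < q" "0 < x" for q d x y :: real
  proof -
    have "y \<le> 4 / q * x" using that by (simp add: field_simps)
    then have "x * y \<le> x * (4 / q * x)" using that by (intro mult_left_mono) auto
    also have "\<dots> = q * (2 / q * x)\<^sup>2" using that by (simp add: field_simps power2_eq_square)
    finally have "q * d\<^sup>2 \<le> q * (2 / q * x)\<^sup>2" using that(1) by linarith
    then have "d\<^sup>2 \<le> (2 / q * x)\<^sup>2" using that(3) by simp
    then have "d \<le> 2 / q * x" using that by (intro power2_le_imp_le[of d]) auto
    \<comment> \<open>\<open>2 / q\<close> is weakened to the reciprocal of the comparison constant
      \<open>q / 4\<close>, so that a single constant \<open>a\<close> serves in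
      \<open>Carleson_density\<close>.\<close>
    also have "\<dots> \<le> 4 / q * x" using that by (intro mult_right_mono divide_right_mono) auto
    finally show ?thesis .
  qed
  from this[OF key le r2 xy(1)] have "?D \<le> 4 / (1 - r\<^sup>2) * ?x" .
  ultimately show "cmod (z - w) \<le> 4 / (1 - r\<^sup>2) * ?x" by simp
qed

text \<open>Used for the exponent \<open>t - 2\<close>, which can have either sign; hence
  comparability in both directions and \<open>\<bar>s\<bar>\<close> in the constant.\<close>

lemma powr_comparable_le:
  fixes a x y s :: real
  assumes a: "0 < a" "a \<le> 1" and x: "0 < x" and y: "0 < y" and le: "a * x \<le> y" "a * y \<le> x"
  shows "y powr s \<le> a powr (- \<bar>s\<bar>) * x powr s"
proof (cases "0 \<le> s")
  case True
  have "y \<le> x / a" using le a by (simp add: pos_le_divide_eq mult.commute)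
  then have "y powr s \<le> (x / a) powr s" using True y by (intro powr_mono2) auto
  also have "\<dots> = a powr (- \<bar>s\<bar>) * x powr s" using True x a by (simp add: powr_divide powr_minus field_simps)
  finally show ?thesis .
next
  case False
  have "y powr s \<le> (a * x) powr s" using False x a le by (intro powr_mono2') auto
  also have "\<dots> = a powr (- \<bar>s\<bar>) * x powr s" using False x a by (simp add: powr_mult)
  finally show ?thesis .
qed

text \<open>On the pseudo-hyperbolic disk the weight is comparable to its value at \<open>z\<close>,
  and the disk lies in a Euclidean disk of radius \<open>(1 - |z| ^ 2) / a\<close>, whose area
  contributes the missing exponent 2.\<close>

lemma Carleson_density:
  fixes g :: "complex \<Rightarrow> complex"
  assumes r: "0 < r" "r < 1"
    and C: "\<And>w. w \<in> unit_disk \<Longrightarrow> cmod (g w) \<le> C * (1 - (cmod w)\<^sup>2) powr (t - 2)"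
  obtains C' where "\<And>z. z \<in> unit_disk \<Longrightarrow>
    (\<integral>\<^sup>+w\<in>pseudohyperbolic_disk z r. ennreal (cmod (g w)) \<partial>lborel_disk) \<le> ennreal (C' * (1 - (cmod z)\<^sup>2) powr t)"
proof -
  define a where "a = (1 - r\<^sup>2) / 4"
  have r2: "0 < 1 - r\<^sup>2" "1 - r\<^sup>2 \<le> 1" using r by (simp_all add: abs_square_less_1)
  have "(1 - r\<^sup>2) / 4 \<le> 1 / 4" using r2(2) by (rule divide_right_mono) simp
  then have "(1 - r\<^sup>2) / 4 \<le> 1" by (rule order_trans) simp
  then have a: "0 < a" "a \<le> 1" using r2(1) by (simp_all only: a_def) simp
  have C_nonneg: "0 \<le> C" using C[of 0] order_trans[OF norm_ge_zero] by fastforce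
  define B where "B = C * a powr (- \<bar>t - 2\<bar>)"
  show ?thesis
  proof (rule that)
    fix z :: complex assume z: "z \<in> unit_disk"
    let ?x = "1 - (cmod z)\<^sup>2"
    have x: "0 < ?x" using z by (rule one_minus_cmod_square_pos)
    have le: "ennreal (cmod (g w)) * indicator (pseudohyperbolic_disk z r) w \<le>
        ennreal (B * ?x powr (t - 2)) * indicator (unit_disk \<inter> cball z (?x / a)) w" for w
    proof (cases "w \<in> pseudohyperbolic_disk z r")
      case True
      then have w: "w \<in> unit_disk" by (simp add: pseudohyperbolic_disk_def)
      have "cmod (g w) \<le> C * (1 - (cmod w)\<^sup>2) powr (t - 2)" by (rule C[OF w])
      also have "\<dots> \<le> C * (a powr (- \<bar>t - 2\<bar>) * ?x powr (t - 2))"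
        using pseudohyperbolic_disk_weight_ge[OF z True r] pseudohyperbolic_disk_weight_le[OF z True r] a x
          one_minus_cmod_square_pos[OF w] C_nonneg
        by (intro mult_left_mono powr_comparable_le) (simp_all add: a_def)
      finally have "cmod (g w) \<le> B * ?x powr (t - 2)" by (simp add: B_def mult.assoc)
      moreover have "w \<in> cball z (?x / a)"
        using pseudohyperbolic_disk_dist_le[OF z True r] by (simp add: dist_norm a_def mult.commute)
      ultimately show ?thesis using True w by (simp add: ennreal_leI)
    qed simp
    have "(\<integral>\<^sup>+w\<in>pseudohyperbolic_disk z r. ennreal (cmod (g w)) \<partial>lborel_disk) \<le>
        (\<integral>\<^sup>+w. ennreal (B * ?x powr (t - 2)) * indicator (unit_disk \<inter> cball z (?x / a)) w \<partial>lborel_disk)"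
      by (intro nn_integral_mono le)
    also have "\<dots> = ennreal (B * ?x powr (t - 2)) * emeasure lborel_disk (unit_disk \<inter> cball z (?x / a))"
      by (intro nn_integral_cmult_indicator) (auto simp: sets_restrict_space)
    also have "emeasure lborel_disk (unit_disk \<inter> cball z (?x / a)) \<le> emeasure lborel (cball z (?x / a))"
      by (subst emeasure_restrict_space) (auto intro: emeasure_mono)
    also have "\<dots> = ennreal (pi * (?x / a)\<^sup>2)"
      using x a by (intro emeasure_lborel_cball_complex) simp
    also have "ennreal (B * ?x powr (t - 2)) * \<dots> = ennreal (B * ?x powr (t - 2) * (pi * (?x / a)\<^sup>2))"
      using C_nonneg by (subst ennreal_mult') (auto simp: B_def)
    also have "B * ?x powr (t - 2) * (pi * (?x / a)\<^sup>2) = (B * pi / a\<^sup>2) * ?x powr t"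
      using x by (simp add: powr_diff powr_numeral power_divide)
    finally show "(\<integral>\<^sup>+w\<in>pseudohyperbolic_disk z r. ennreal (cmod (g w)) \<partial>lborel_disk) \<le>
        ennreal ((B * pi / a\<^sup>2) * ?x powr t)"
      by (simp add: mult_left_mono)
  qed
qed

text \<open>The weight is positive and finite on the disk, so division by it in
  \<open>ennreal\<close> can be undone; the supremum itself serves as \<open>C\<close>.\<close>

lemma Carleson_sup_iff:
  fixes m :: "complex \<Rightarrow> ennreal"
  shows "(SUP z\<in>unit_disk. m z / ennreal ((1 - (cmod z)\<^sup>2) powr t)) < \<infinity> \<longleftrightarrow>
    (\<exists>C\<ge>0. \<forall>z\<in>unit_disk. m z \<le> ennreal (C * (1 - (cmod z)\<^sup>2) powr t))"
    (is "?S < \<infinity> \<longleftrightarrow> _")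
proof
  let ?d = "\<lambda>z. ennreal ((1 - (cmod z)\<^sup>2) powr t)"
  assume fin: "?S < \<infinity>"
  have "m z \<le> ennreal (enn2real ?S * (1 - (cmod z)\<^sup>2) powr t)" if z: "z \<in> unit_disk" for z
  proof -
    have d: "?d z \<noteq> 0" "?d z < top" using one_minus_cmod_square_pos[OF z] by simp_all
    have "m z = m z / ?d z * ?d z" using d by (simp add: ennreal_divide_times)
    also have "\<dots> \<le> ?S * ?d z" using z by (intro mult_right_mono SUP_upper) auto
    also have "?S = ennreal (enn2real ?S)" using fin by simp
    finally show ?thesis by (simp add: ennreal_mult')
  qed
  then show "\<exists>C\<ge>0. \<forall>z\<in>unit_disk. m z \<le> ennreal (C * (1 - (cmod z)\<^sup>2) powr t)"
    by (intro exI[of _ "enn2real ?S"]) simp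
next
  assume "\<exists>C\<ge>0. \<forall>z\<in>unit_disk. m z \<le> ennreal (C * (1 - (cmod z)\<^sup>2) powr t)"
  then obtain C where C: "0 \<le> C" "\<And>z. z \<in> unit_disk \<Longrightarrow> m z \<le> ennreal (C * (1 - (cmod z)\<^sup>2) powr t)" by blast
  have "?S \<le> ennreal C"
  proof (rule SUP_least)
    fix z :: complex assume z: "z \<in> unit_disk"
    show "m z / ennreal ((1 - (cmod z)\<^sup>2) powr t) \<le> ennreal C"
      using C(2)[OF z] one_minus_cmod_square_pos[OF z] C(1)
      by (intro divide_le_posI_ennreal) (simp_all add: ennreal_mult' mult.commute)
  qed
  then show "?S < \<infinity>" using le_less_trans ennreal_less_top by fastforce
qed

section \<open>Assembling the Jordan parts, and the equivalence\<close>

lemma higher_deriv_sum: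
  fixes F :: "'i \<Rightarrow> complex \<Rightarrow> complex"
  assumes "\<And>i. i \<in> I \<Longrightarrow> F i holomorphic_on S" "open S" "z \<in> S"
  shows "(deriv ^^ k) (\<lambda>w. \<Sum>i\<in>I. F i w) z = (\<Sum>i\<in>I. (deriv ^^ k) (F i) z)"
  using assms
proof (induction I rule: infinite_finite_induct)
  case (insert i I)
  then show ?case
    by (simp add: higher_deriv_add[of "F i" S "\<lambda>w. \<Sum>i\<in>I. F i w"] holomorphic_on_sum)
qed auto

lemma Carleson_complex_measure_in_analytic_Lipschitz:
  fixes \<mu> :: "complex set \<Rightarrow> complex"
  assumes t: "t > 1" and k: "real k > t" and r: "0 < r" "r < 1"
    and hol: "f holomorphic_on unit_disk" and mu: "vector_measure borel_disk \<mu>"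
    and C: "0 \<le> C" "\<And>z. z \<in> unit_disk \<Longrightarrow>
      emeasure (total_variation_measure borel_disk \<mu>) (pseudohyperbolic_disk z r) \<le> ennreal (C * (1 - (cmod z)\<^sup>2) powr t)"
    and f: "\<And>z. z \<in> unit_disk \<Longrightarrow> f z = complex_measure_integral borel_disk \<mu> (\<lambda>w. (z - w) / (1 - z * cnj w))"
  shows "f \<in> analytic_Lipschitz k t"
proof -
  let ?V = "total_variation_measure borel_disk \<mu>"
  \<comment> \<open>Finiteness has to come first: the values of the Jordan parts and their
    domination by the variation are derived from it.\<close>
  have "emeasure ?V (space ?V) < \<infinity>"
    using C by (intro Carleson_finite[OF _ r t]) auto
  then have fin: "variation borel_disk \<mu> (space borel_disk) < \<infinity>"
    by (simp only: space_total_variation_measure emeasure_total_variation_measure[OF mu sets.top])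
  \<comment> \<open>the four Jordan parts of \<open>Re \<mu>\<close> and \<open>Im \<mu>\<close>: \<open>fst p\<close> selects the real part, \<open>snd p\<close> the positive variation\<close>
  define T where "T p = (let \<nu> = (if fst p then \<lambda>A. Re (\<mu> A) else (\<lambda>A. Im (\<mu> A))) in
    if snd p then positive_variation_measure borel_disk \<nu> else negative_variation_measure borel_disk \<nu>)" for p
  have vm: "vector_measure borel_disk (\<lambda>A. Re (\<mu> A))" "vector_measure borel_disk (\<lambda>A. Im (\<mu> A))"
    by (intro vector_measure_bounded_linear[OF _ mu] bounded_linear_Re bounded_linear_Im)+
  have le: "variation borel_disk (\<lambda>A. Re (\<mu> A)) A \<le> variation borel_disk \<mu> A"
    "variation borel_disk (\<lambda>A. Im (\<mu> A)) A \<le> variation borel_disk \<mu> A" for A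
    by (intro variation_mono_norm; simp add: abs_Re_le_cmod abs_Im_le_cmod)+
  have fin': "variation borel_disk (\<lambda>A. Re (\<mu> A)) (space borel_disk) < \<infinity>"
    "variation borel_disk (\<lambda>A. Im (\<mu> A)) (space borel_disk) < \<infinity>"
    using le[of "space borel_disk"] fin by (auto intro: le_less_trans)
  have T_le: "emeasure (T p) A \<le> variation borel_disk \<mu> A" if "A \<in> sets borel_disk" for p A
    unfolding T_def Let_def
    using emeasure_positive_variation_measure_le[OF vm(1) fin'(1) that]
      emeasure_negative_variation_measure_le[OF vm(1) fin'(1) that]
      emeasure_positive_variation_measure_le[OF vm(2) fin'(2) that]
      emeasure_negative_variation_measure_le[OF vm(2) fin'(2) that] le[of A]
    by (auto intro: order_trans)
  have sets_T: "sets (T p) = sets borel_disk" and space_T: "space (T p) = space borel_disk" for p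
    by (simp_all add: T_def Let_def)
  have fin_T: "finite_measure (T p)" for p
  proof (rule finite_measureI)
    have "emeasure (T p) (space (T p)) \<le> variation borel_disk \<mu> (space borel_disk)"
      unfolding space_T by (intro T_le sets.top)
    then show "emeasure (T p) (space (T p)) \<noteq> \<infinity>" using fin by auto
  qed
  define F where "F p = Mobius_transform (T p)" for p
  have hol_F: "F p holomorphic_on unit_disk" for p
    unfolding F_def by (intro Mobius_transform_holomorphic sets_T fin_T)
  have wb_F: "weighted_bound (real k - t) ((deriv ^^ k) (F p))" for p
    unfolding F_def
  proof (rule weighted_bound_Mobius_transform[OF sets_T fin_T t k r C(1)])
    fix \<zeta> :: complex assume \<zeta>: "\<zeta> \<in> unit_disk"
    show "emeasure (T p) (pseudohyperbolic_disk \<zeta> r) \<le> ennreal (C * (1 - (cmod \<zeta>)\<^sup>2) powr t)"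
      using order_trans[OF T_le[OF sets_disk_pseudohyperbolic_disk] C(2)[OF \<zeta>, unfolded
            emeasure_total_variation_measure[OF mu sets_disk_pseudohyperbolic_disk]]] .
  qed
  \<comment> \<open>The coefficients \<open>1\<close>, \<open>-1\<close>, \<open>\<i>\<close> and
    \<open>- \<i>\<close> recombine the four transforms as in
    \<open>complex_measure_integral\<close>.\<close>
  let ?c = "\<lambda>p :: bool \<times> bool. (if fst p then 1 else \<i>) * (if snd p then 1 else -1)"
  have sum4: "(\<Sum>p\<in>UNIV. ?c p * H p) = (H (True, True) - H (True, False)) + \<i> * (H (False, True) - H (False, False))"
    for H :: "bool \<times> bool \<Rightarrow> complex"
    by (simp add: UNIV_bool algebra_simps flip: UNIV_Times_UNIV)
  have f_eq: "f z = (\<Sum>p\<in>UNIV. ?c p * F p z)" if "z \<in> unit_disk" for z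
    unfolding sum4 f[OF that] complex_measure_integral_def signed_integral_def F_def Mobius_transform_def T_def
    by simp
  have "(deriv ^^ k) f z = (\<Sum>p\<in>UNIV. ?c p * (deriv ^^ k) (F p) z)" if z: "z \<in> unit_disk" for z
  proof -
    have "(deriv ^^ k) f z = (deriv ^^ k) (\<lambda>z. \<Sum>p\<in>UNIV. ?c p * F p z) z"
      by (rule higher_deriv_transform_within_open[OF hol _ open_ball z f_eq])
        (intro holomorphic_intros hol_F)
    also have "\<dots> = (\<Sum>p\<in>UNIV. (deriv ^^ k) (\<lambda>z. ?c p * F p z) z)"
      by (rule higher_deriv_sum[OF _ open_ball z]) (intro holomorphic_intros hol_F)
    also have "\<dots> = (\<Sum>p\<in>UNIV. ?c p * (deriv ^^ k) (F p) z)"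
      by (intro sum.cong refl higher_deriv_cmult[OF hol_F z open_ball])
    finally show ?thesis .
  qed
  then have "weighted_bound (real k - t) ((deriv ^^ k) f) = weighted_bound (real k - t) (\<lambda>z. \<Sum>p\<in>UNIV. ?c p * (deriv ^^ k) (F p) z)"
    by (rule weighted_bound_cong)
  moreover have "weighted_bound (real k - t) (\<lambda>z. \<Sum>p\<in>UNIV. ?c p * (deriv ^^ k) (F p) z)"
    by (intro weighted_bound_sum weighted_bound_mult_bounded[where K = 1] wb_F) (auto simp: norm_mult)
  ultimately show ?thesis using hol by (simp add: analytic_Lipschitz_iff)
qed

theorem theoremB:
  fixes t r :: real and k :: nat and f :: "complex \<Rightarrow> complex"
  assumes "t > 1" and "0 < r" and "r < 1"
    and "real k > t"
    and "f holomorphic_on unit_disk"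
  shows "f \<in> analytic_Lipschitz k t \<longleftrightarrow>
    (\<exists>\<mu> :: complex set \<Rightarrow> complex.
       complex_measure borel_disk \<mu> \<and>
       (SUP z\<in>unit_disk.
          emeasure (total_variation_measure borel_disk \<mu>) (pseudohyperbolic_disk z r)
            / ennreal ((1 - (cmod z)\<^sup>2) powr t)) < \<infinity> \<and>
       (\<forall>z\<in>unit_disk.
          f z = complex_measure_integral borel_disk \<mu> (\<lambda>w. (z - w) / (1 - z * cnj w))))"
    (is "_ \<longleftrightarrow> ?R")
proof
  assume "f \<in> analytic_Lipschitz k t"
  then obtain g C where meas: "g \<in> borel_measurable lborel_disk"
    and le: "\<And>w. w \<in> unit_disk \<Longrightarrow> cmod (g w) \<le> C * (1 - (cmod w)\<^sup>2) powr (t - 2)"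
    and rep: "\<And>z. z \<in> unit_disk \<Longrightarrow> f z = (LINT w|lborel_disk. g w * ((z - w) / (1 - z * cnj w)))"
    using analytic_Lipschitz_Mobius_representation[OF assms(1,4)] by blast
  have int_g: "integrable lborel_disk g"
  proof (rule Bochner_Integration.integrable_bound[OF _ meas])
    show "integrable lborel_disk (\<lambda>w. C * (1 - (cmod w)\<^sup>2) powr (t - 2))"
      using assms(1) by (intro integrable_mult_right integrable_disk_weight) simp
    show "AE w in lborel_disk. cmod (g w) \<le> norm (C * (1 - (cmod w)\<^sup>2) powr (t - 2))"
      using order_trans[OF le abs_ge_self] by (intro AE_I2) (simp add: space_lborel_disk)
  qed
  define \<mu> where "\<mu> A = (LINT w:A|lborel_disk. g w)" for A
  have vm: "vector_measure lborel_disk \<mu>"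
    unfolding \<mu>_def by (rule vector_measure_density[OF int_g])
  obtain C' where C': "\<And>z. z \<in> unit_disk \<Longrightarrow>
      (\<integral>\<^sup>+w\<in>pseudohyperbolic_disk z r. ennreal (cmod (g w)) \<partial>lborel_disk) \<le> ennreal (C' * (1 - (cmod z)\<^sup>2) powr t)"
    using Carleson_density[OF assms(2,3) le] by blast
  have "emeasure (total_variation_measure borel_disk \<mu>) (pseudohyperbolic_disk z r) \<le>
      ennreal (max 0 C' * (1 - (cmod z)\<^sup>2) powr t)" if z: "z \<in> unit_disk" for z
  proof -
    have "emeasure (total_variation_measure borel_disk \<mu>) (pseudohyperbolic_disk z r) =
        variation lborel_disk \<mu> (pseudohyperbolic_disk z r)"
      unfolding total_variation_measure_cong_sets[OF sets_lborel_disk, symmetric]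
      using sets_disk_pseudohyperbolic_disk
      by (intro emeasure_total_variation_measure[OF vm]) (simp add: sets_lborel_disk)
    also have "\<dots> \<le> (\<integral>\<^sup>+w\<in>pseudohyperbolic_disk z r. ennreal (cmod (g w)) \<partial>lborel_disk)"
      unfolding \<mu>_def by (rule variation_density_le[OF int_g])
    also have "\<dots> \<le> ennreal (C' * (1 - (cmod z)\<^sup>2) powr t)" by (rule C'[OF z])
    \<comment> \<open>The sign of \<open>C'\<close> is not known, whereas
      \<open>Carleson_sup_iff\<close> asks for a nonnegative constant.\<close>
    also have "\<dots> \<le> ennreal (max 0 C' * (1 - (cmod z)\<^sup>2) powr t)"
      by (intro ennreal_leI mult_right_mono) auto
    finally show ?thesis .
  qed
  then have "\<exists>C\<ge>0. \<forall>z\<in>unit_disk. emeasure (total_variation_measure borel_disk \<mu>) (pseudohyperbolic_disk z r) \<le>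
      ennreal (C * (1 - (cmod z)\<^sup>2) powr t)"
    by (intro exI[of _ "max 0 C'"]) simp
  moreover have "complex_measure borel_disk \<mu>"
    using vm by (simp add: complex_measure_eq_vector_measure vector_measure_cong_sets[OF sets_lborel_disk])
  moreover have "f z = complex_measure_integral borel_disk \<mu> (\<lambda>w. (z - w) / (1 - z * cnj w))"
    if "z \<in> unit_disk" for z
    \<comment> \<open>After passing to \<open>lborel_disk\<close>, the integral against
      \<open>\<mu>\<close> becomes an area integral against its density \<open>g\<close>.\<close>
    unfolding complex_measure_integral_cong_sets[OF sets_lborel_disk, symmetric] \<mu>_def rep[OF that]
    by (rule complex_measure_integral_density[symmetric])
      (intro int_g Mobius_kernel_measurable integrable_mult_Mobius_kernel that)+
  ultimately show ?R unfolding Carleson_sup_iff by blast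
next
  assume ?R
  then show "f \<in> analytic_Lipschitz k t"
    unfolding Carleson_sup_iff complex_measure_eq_vector_measure
    using Carleson_complex_measure_in_analytic_Lipschitz[OF assms(1,4,2,3,5)] by blast
qed

end
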